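(* Let $n\ge3$, $\gamma\ge1$, $k=n/2$, and $\alpha_n=\sqrt{n/(2\pi)}/\mathrm{GH}_n$. Choose $0<\eta<1$ and $0<\kappa<1<R$, and put $\rho=\gamma R$. Assume $\alpha_n/2\le\kappa$ and $\rho\le\alpha_n$. Define $$M_1=\frac{P(k,\pi\rho^2\mathrm{GH}_n^2)-P(k,\pi\kappa^2\mathrm{GH}_n^2)}{\zeta(n)},\qquad M_2=\frac{n(k/e)^k}{\Gamma(k+1)}\,\frac{\zeta(n)-1}{\zeta(n)}\,\log\frac{\rho}{\kappa},$$ $$U=\min\{1,(M_1+M_2)/\eta\},\qquad E_+=\eta+\frac{\kappa^n}{2\zeta(n)}+\frac{2\zeta(n)}{R^n}.$$ Then $$\Pr_{L\sim\mu_n}\Bigl\{\sup_{c>0}\widehat u_{n,\gamma,c}(L)>U\Bigr\}\le E_+ .$$ The same bound holds with $u_{n,\gamma,c}$ (no primitive reduction) in place of $\widehat u_{n,\gamma,c}$.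
   Context: All logarithms are natural; $\zeta$ is the Riemann zeta function and $P(k,x)=\frac1{\Gamma(k)}\int_0^x t^{k-1}e^{-t}\,dt$. $\mu_n$ is the $\mathrm{SL}(n,\mathbb R)$-invariant probability measure on $\mathrm{SL}(n,\mathbb Z)\backslash\mathrm{SL}(n,\mathbb R)$, identified with the space of lattices of covolume $1$ in $\mathbb R^n$. $\lambda_1(L)$ is the length of a shortest nonzero vector of $L$; $v_n$ is the volume of the Euclidean unit ball in $\mathbb R^n$; $\mathrm{GH}_n=v_n^{-1/n}$; for $c>0$, $s_n(c)>0$ is given by $s_n(c)^2=2\pi\,\mathrm{GH}_n^2/(cn)$. $D_{L,s}$ is the probability law on $L$ (zero included) with $D_{L,s}(v)\propto e^{-\pi\|v\|^2/s^2}$. Every nonzero $v\in L$ is uniquely $v=mw$ with integer $m\ge1$ and $w\in L$ primitive (not an integer multiple $m'w'$, $m'\ge2$, of a lattice vector $w'$); put $P_L(v)=w$, $P_L(0)=0$. Define $$u_{n,\gamma,c}(L)=\Pr_{V\sim D_{L,s_n(c)}}\{0<\|V\|\le\gamma\lambda_1(L)\},\qquad \widehat u_{n,\gamma,c}(L)=\Pr_{V\sim D_{L,s_n(c)}}\{0<\|P_L(V)\|\le\gamma\lambda_1(L)\}.$$ *)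

theory Defs
  imports "HOL-Probability.Probability"
begin

text \<open>The Riemann zeta function, given by its Dirichlet series (meaningful for \<open>s > 1\<close> only,
  which is the only range in which it is used).\<close>

definition zeta :: "real \<Rightarrow> real" where
  "zeta s = (\<Sum>m. 1 / real (Suc m) powr s)"

definition gamma_P :: "real \<Rightarrow> real \<Rightarrow> real" where
  "gamma_P k x = 1 / Gamma k * integral {0..x} (\<lambda>t. t powr (k - 1) * exp (- t))"

definition GH :: "nat \<Rightarrow> real" where
  "GH n = unit_ball_vol (real n) powr (- 1 / real n)"

text \<open>The library function \<open>unit_ball_vol\<close> is given by a closed formula; it is the volume
  of the unit ball.\<close>

lemma unit_ball_vol_eq_volume:
  "unit_ball_vol (real CARD('n)) = measure lborel (ball (0 :: real ^ 'n::finite) 1)"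
  by (simp add: content_ball)

definition gauss_width :: "nat \<Rightarrow> real \<Rightarrow> real" where
  "gauss_width n c = sqrt (2 * pi * (GH n)\<^sup>2 / (c * real n))"

text \<open>Vectors are row vectors: \<open>lattice_of g\<close> is \<open>\<int>\<^sup>n g\<close>, the integer span of the rows of \<open>g\<close>.
  Two matrices of determinant one span the same lattice iff they lie in the same
  coset \<open>SL(n,\<int>) g\<close>, and every lattice of covolume one has a basis of
  determinant one (flip the sign of one vector if necessary). Hence \<open>unimodular_lattices\<close> is
  \<open>SL(n,\<int>)\<setminus>SL(n,\<real>)\<close>, with \<open>lattice_of\<close> as the quotient map.\<close>

definition SL_real :: "(real ^ 'n ^ 'n::finite) set" where
  "SL_real = {g. det g = 1}"

definition lattice_of :: "real ^ 'n ^ 'n \<Rightarrow> (real ^ 'n::finite) set" where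
  "lattice_of g = {a v* g | a. \<forall>i. a $ i \<in> \<int>}"

definition unimodular_lattices :: "(real ^ 'n::finite) set set" where
  "unimodular_lattices = lattice_of ` SL_real"

text \<open>The Borel sigma-algebra of the quotient topology on \<open>SL(n,\<int>)\<setminus>SL(n,\<real>)\<close>.\<close>

definition lattice_borel :: "(real ^ 'n::finite) set measure" where
  "lattice_borel = sigma unimodular_lattices
     {A. A \<subseteq> unimodular_lattices \<and>
         openin (top_of_set SL_real) {g \<in> SL_real. lattice_of g \<in> A}}"

definition lattice_act :: "(real ^ 'n) set \<Rightarrow> real ^ 'n ^ 'n \<Rightarrow> (real ^ 'n::finite) set" where
  "lattice_act L g = (\<lambda>v. v v* g) ` L"

text \<open>There is exactly one measure with the following property.\<close>

definition invariant_lattice_measure :: "(real ^ 'n::finite) set measure \<Rightarrow> bool" where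
  "invariant_lattice_measure \<mu> \<longleftrightarrow>
     prob_space \<mu> \<and> sets \<mu> = sets lattice_borel \<and>
     (\<forall>g \<in> SL_real. \<forall>A \<in> sets \<mu>. emeasure \<mu> ((\<lambda>L. lattice_act L g) ` A) = emeasure \<mu> A)"

definition lambda1 :: "(real ^ 'n::finite) set \<Rightarrow> real" where
  "lambda1 L = (LEAST r. \<exists>v \<in> L. v \<noteq> 0 \<and> r = norm v)"

definition primitive_in :: "(real ^ 'n::finite) set \<Rightarrow> real ^ 'n \<Rightarrow> bool" where
  "primitive_in L w \<longleftrightarrow> w \<in> L \<and> \<not> (\<exists>m' \<ge> (2::nat). \<exists>w' \<in> L. w = real m' *\<^sub>R w')"

definition primitive_part :: "(real ^ 'n::finite) set \<Rightarrow> real ^ 'n \<Rightarrow> real ^ 'n" where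
  "primitive_part L v =
     (if v = 0 then 0
      else (THE w. primitive_in L w \<and> (\<exists>m \<ge> (1::nat). v = real m *\<^sub>R w)))"

definition gauss_weight :: "real \<Rightarrow> real ^ 'n::finite \<Rightarrow> real" where
  "gauss_weight s v = exp (- pi * (norm v)\<^sup>2 / s\<^sup>2)"

definition discrete_gaussian :: "(real ^ 'n::finite) set \<Rightarrow> real \<Rightarrow> (real ^ 'n) measure" where
  "discrete_gaussian L s =
     density (count_space L) (\<lambda>v. ennreal (gauss_weight s v / (\<Sum>\<^sub>\<infinity>x\<in>L. gauss_weight s x)))"

definition u_prob :: "real \<Rightarrow> real \<Rightarrow> (real ^ 'n::finite) set \<Rightarrow> real" where
  "u_prob \<gamma> c L =
     measure (discrete_gaussian L (gauss_width CARD('n) c))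
       {v \<in> L. 0 < norm v \<and> norm v \<le> \<gamma> * lambda1 L}"

definition u_hat_prob :: "real \<Rightarrow> real \<Rightarrow> (real ^ 'n::finite) set \<Rightarrow> real" where
  "u_hat_prob \<gamma> c L =
     measure (discrete_gaussian L (gauss_width CARD('n) c))
       {v \<in> L. 0 < norm (primitive_part L v) \<and> norm (primitive_part L v) \<le> \<gamma> * lambda1 L}"

end

theory Submission
  imports Defs
begin

text \<open>Let \<open>\<Theta>\<^sub>s\<close> be the total Gaussian mass of \<open>L\<close>. Since \<open>\<Theta>\<^sub>s \<ge> max 1 s\<^sup>n\<close>, the multiples \<open>m w\<close> of a primitive
  vector \<open>w\<close> contribute to a probability, whatever the width \<open>s\<close> is, at most \<open>exp (- \<pi> \<bar>w\<bar>\<^sup>2)\<close> for \<open>m = 1\<close>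
  (if \<open>\<pi> \<bar>w\<bar>\<^sup>2 \<le> n / 2\<close>) and at most \<open>K / (m \<bar>w\<bar>)\<^sup>n\<close> for \<open>m \<ge> 2\<close>, where \<open>K = (k / (e \<pi>))\<^sup>k\<close>. Unless
  \<open>\<lambda>\<^sub>1(L) \<le> \<kappa> GH\<close> or \<open>\<lambda>\<^sub>1(L) > R GH\<close>, the supremum over \<open>c\<close> is therefore bounded by a sum over the primitive
  vectors in the annulus \<open>\<kappa> GH < \<bar>w\<bar> \<le> \<rho> GH\<close>, whose expectation is \<open>M1 + M2\<close> by Siegel's mean value formula,
  and Markov's inequality applies. The first exceptional event is bounded by the first moment of the number of
  primitive vectors in a ball (they come in pairs \<open>\<plusminus>w\<close>), the second by Chebyshev's inequality and Rogers'
  formula for pairs.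

  The mean value formula for linearly independent \<open>k\<close>-tuples of primitive vectors (\<open>k < n\<close>) does not need
  Haar measure. Write a tuple as \<open>(B, Y)\<close> with an invertible \<open>k\<times>k\<close> block \<open>B\<close>, and take a box in the coordinates
  \<open>(B, B\<^sup>-\<^sup>1 Y)\<close>. If \<open>T\<^sup>n = D\<^sup>n\<^sup>-\<^sup>k\<close>, its dilate by \<open>T\<close> is cut into images of the box itself under
  \<open>D\<^sup>k\<^sup>(\<^sup>n\<^sup>-\<^sup>k\<^sup>)\<close> elements of \<open>SL(n,\<real>)\<close>. So the average of that many identically distributed counts is the
  number of tuples in the dilate divided by \<open>T\<^sup>n\<^sup>k\<close>, which converges for every single lattice.\<close>

section \<open>Primitive vectors of unimodular lattices\<close>

text \<open>The supremum over all widths shapes the estimates: each lattice vector needs a bound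
  free of s, so the lower bounds on \<Theta> must hold for every lattice and every s. The bound s^n,
  usually read off from Poisson summation, comes here from the parallelogram law: \<Theta> / s^n
  does not increase when s is multiplied by sqrt 2, so its behaviour for large s decides. The two
  lower bounds meet at s = 1, and pi |w|^2 <= n/2 is exactly the range in which s = 1 is the worst
  width; this is the hypothesis \<rho> <= \<alpha>. Multiples with m >= 2 can leave that range,
  hence the cruder power bound, whose radial integral is the logarithm in \<open>M2\<close>. The
  coordinate B^-1 Y is homogeneous of degree 0, so a dilation only scales B. A column operation Y +
  B h translates it by h, the same h for every tuple; in the entries of Y itself the shift would
  depend on the tuple. For k < n the factor T is unbounded, so the asymptotic counts apply. Their
  limit is the same constant for every lattice, which replaces an ergodic theorem.\<close>

definition int_vecs :: "(real ^ 'n::finite) set" where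
  "int_vecs = {a. \<forall>i. a $ i \<in> \<int>}"

definition primitives :: "(real ^ 'n::finite) set \<Rightarrow> (real ^ 'n) set" where
  "primitives L = {w. primitive_in L w}"

section \<open>Matrices acting on row vectors and on lattices\<close>

lemma matrix_inv:
  fixes g :: "real ^ 'n::finite ^ 'n"
  assumes "det g \<noteq> 0"
  shows "g ** matrix_inv g = mat 1" "matrix_inv g ** g = mat 1"
proof -
  have "\<exists>g'. g ** g' = mat 1 \<and> g' ** g = mat 1"
    using assms by (simp add: invertible_det_nz[symmetric] invertible_def)
  then have "g ** matrix_inv g = mat 1 \<and> matrix_inv g ** g = mat 1"
    unfolding matrix_inv_def by (rule someI_ex)
  then show "g ** matrix_inv g = mat 1" "matrix_inv g ** g = mat 1" by auto
qed

lemma lattice_of_eq: "lattice_of g = lattice_act int_vecs g"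
  by (auto simp: lattice_of_def lattice_act_def int_vecs_def)

lemma lattice_act_act: "lattice_act (lattice_act L g) h = lattice_act L (g ** h)"
  by (auto simp: lattice_act_def image_image vector_matrix_mul_assoc)

lemma lattice_act_one [simp]: "lattice_act L (mat 1) = L"
  by (auto simp: lattice_act_def)

lemma vector_matrix_inv:
  fixes g :: "real ^ 'n::finite ^ 'n"
  assumes "det g \<noteq> 0"
  shows "(a v* g) v* matrix_inv g = a" "(a v* matrix_inv g) v* g = a"
  using assms by (simp_all add: vector_matrix_mul_assoc matrix_inv)

lemma inj_vector_matrix:
  fixes g :: "real ^ 'n::finite ^ 'n"
  assumes "det g \<noteq> 0"
  shows "inj (\<lambda>a. a v* g)"
  by (metis assms injI vector_matrix_inv(1))

lemma linear_vector_matrix: "linear (\<lambda>x. x v* (g :: real ^ 'n::finite ^ 'm::finite))"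
  by (metis (no_types) matrix_vector_mul_linear transpose_matrix_vector transpose_transpose ext)

lemma continuous_on_vector_matrix [continuous_intros]:
  assumes "continuous_on S f" "continuous_on S g"
  shows "continuous_on S (\<lambda>x. (f x :: real ^ 'm) v* (g x :: real ^ 'n::finite ^ 'm::finite))"
  unfolding vector_matrix_mult_def
  by (intro continuous_intros continuous_on_vec_lambda assms)

lemma norm_vector_matrix_le:
  fixes g :: "real ^ 'n::finite ^ 'm::finite"
  obtains C where "C > 0" "\<And>a. norm (a v* g) \<le> C * norm a"
proof -
  obtain C where "C > 0" "\<And>a. norm (a v* g) \<le> norm a * C"
    using bounded_linear.pos_bounded[OF linear_conv_bounded_linear[THEN iffD1, OF linear_vector_matrix[of g]]] by blast
  then show ?thesis using that[of C] by (simp add: mult.commute)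
qed

lemma SL_real_mult: "g \<in> SL_real \<Longrightarrow> h \<in> SL_real \<Longrightarrow> g ** h \<in> SL_real"
  by (simp add: SL_real_def det_mul)

lemma SL_real_inv:
  assumes "g \<in> SL_real"
  shows "matrix_inv g \<in> SL_real" "g ** matrix_inv g = mat 1" "matrix_inv g ** g = mat 1"
proof -
  show 1: "g ** matrix_inv g = mat 1" and "matrix_inv g ** g = mat 1"
    using assms by (simp_all add: SL_real_def matrix_inv)
  have "det g * det (matrix_inv g) = 1" by (metis 1 det_mul det_I)
  then show "matrix_inv g \<in> SL_real" using assms by (simp add: SL_real_def)
qed

lemma finite_int_vecs_bounded:
  assumes "bounded B"
  shows "finite (int_vecs \<inter> B)"
proof -
  obtain r where r: "\<And>x. x \<in> B \<Longrightarrow> norm x \<le> r" using assms by (auto simp: bounded_iff)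
  have "int_vecs \<inter> B \<subseteq> (\<lambda>f. \<chi> i. of_int (f i)) ` (PiE UNIV (\<lambda>_. {- \<lceil>r\<rceil>..\<lceil>r\<rceil>}))"
  proof
    fix a assume a: "a \<in> int_vecs \<inter> B"
    let ?f = "\<lambda>i. \<lfloor>a $ i\<rfloor>"
    have ai: "real_of_int \<lfloor>a $ i\<rfloor> = a $ i" for i
      using a by (auto simp: int_vecs_def elim: Ints_cases)
    have "\<bar>a $ i\<bar> \<le> r" for i using r[of a] a component_le_norm_cart[of a i] by force
    then have "- \<lceil>r\<rceil> \<le> ?f i \<and> ?f i \<le> \<lceil>r\<rceil>" for i
      using ai[of i] abs_le_D1[of "a $ i" r] abs_le_D2[of "a $ i" r] by (smt (verit) floor_of_int le_of_int_ceiling of_int_le_iff of_int_minus)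
    then show "a \<in> (\<lambda>f. \<chi> i. of_int (f i)) ` (PiE UNIV (\<lambda>_. {- \<lceil>r\<rceil>..\<lceil>r\<rceil>}))"
      by (intro image_eqI[of _ _ ?f]) (auto simp: vec_eq_iff ai)
  qed
  then show ?thesis by (rule finite_subset) (auto intro!: finite_PiE)
qed

section \<open>Primitive and shortest vectors of a discrete subgroup\<close>

locale discrete_subgroup =
  fixes L :: "(real ^ 'n::finite) set"
  assumes diff_closed: "x \<in> L \<Longrightarrow> y \<in> L \<Longrightarrow> x - y \<in> L"
    and finite_bounded: "bounded B \<Longrightarrow> finite (L \<inter> B)"
    and nontrivial: "\<exists>v \<in> L. v \<noteq> 0"
begin

lemma zero_closed: "0 \<in> L"
  using nontrivial diff_closed by force

lemma uminus_closed: "x \<in> L \<Longrightarrow> - x \<in> L"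
  using diff_closed[OF zero_closed] by force

lemma add_closed: "x \<in> L \<Longrightarrow> y \<in> L \<Longrightarrow> x + y \<in> L"
  using diff_closed[of x "- y"] uminus_closed by force

lemma scaleR_nat_closed: "x \<in> L \<Longrightarrow> real m *\<^sub>R x \<in> L"
  by (induction m) (auto simp: zero_closed add_closed scaleR_add_left)

lemma scaleR_int_closed: "x \<in> L \<Longrightarrow> of_int m *\<^sub>R x \<in> L"
  by (cases m rule: int_cases2) (auto simp: scaleR_nat_closed uminus_closed)

lemma primitive_nonzero: "primitive_in L w \<Longrightarrow> w \<noteq> 0"
  unfolding primitive_in_def using zero_closed by (metis order_refl scaleR_zero_right)

lemma primitive_uminus: "primitive_in L w \<Longrightarrow> primitive_in L (- w)"
  unfolding primitive_in_def by (metis uminus_closed minus_minus scaleR_minus_right)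

text \<open>The m with v/m in L form a finite set, because all these v/m lie in the ball of radius
  |v|. Dividing by the largest such m leaves a primitive vector.\<close>

lemma primitive_decomp:
  assumes "v \<in> L" "v \<noteq> 0"
  obtains m w where "m \<ge> (1::nat)" "primitive_in L w" "v = real m *\<^sub>R w"
proof -
  define M where "M = {m::nat. m \<ge> 1 \<and> (1 / real m) *\<^sub>R v \<in> L}"
  have "finite ((\<lambda>m. (1 / real m) *\<^sub>R v) ` M)"
  proof (rule finite_subset)
    show "(\<lambda>m. (1 / real m) *\<^sub>R v) ` M \<subseteq> L \<inter> cball 0 (norm v)"
      by (auto simp: M_def divide_le_eq mult_le_cancel_left1)
  qed (rule finite_bounded, simp)
  moreover have "inj_on (\<lambda>m. (1 / real m) *\<^sub>R v) M"
    using assms by (auto simp: inj_on_def M_def)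
  ultimately have fin: "finite M" by (rule finite_imageD)
  have ne: "M \<noteq> {}" using assms by (auto simp: M_def intro!: exI[of _ 1])
  define m where "m = Max M"
  have m: "m \<in> M" unfolding m_def using fin ne by simp
  have "primitive_in L ((1 / real m) *\<^sub>R v)"
    unfolding primitive_in_def
  proof (intro conjI notI)
    show "(1 / real m) *\<^sub>R v \<in> L" using m by (auto simp: M_def)
    assume "\<exists>m'\<ge>2. \<exists>w'\<in>L. (1 / real m) *\<^sub>R v = real m' *\<^sub>R w'"
    then obtain m' :: nat and w' where *: "m' \<ge> 2" "w' \<in> L" "(1 / real m) *\<^sub>R v = real m' *\<^sub>R w'" by blast
    have "(1 / real (m * m')) *\<^sub>R v = (1 / real m') *\<^sub>R ((1 / real m) *\<^sub>R v)" by simp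
    also have "\<dots> = w'" unfolding *(3) using *(1) by simp
    finally have "m * m' \<in> M" using m * by (auto simp: M_def)
    then have "m * m' \<le> m" unfolding m_def using fin by simp
    then show False using m * by (auto simp: M_def)
  qed
  then show ?thesis using that[of m] m by (auto simp: M_def)
qed

text \<open>If some proper fraction of w lay in L, take the smallest, \<theta>. Division of 1 by
  \<theta> with remainder would produce a smaller one unless 1 = m \<theta>, and then w is m times a
  lattice vector. So there is none; applied to \<open>frac t\<close> this makes t an integer, and
  primitivity of w' leaves only 1 and -1.\<close>

lemma primitive_collinear:
  assumes w: "primitive_in L w" and w': "primitive_in L w'" and eq: "w' = t *\<^sub>R w"
  shows "t = 1 \<or> t = -1"
proof -
  have wL: "w \<in> L" and w0: "w \<noteq> 0" using w primitive_nonzero by (auto simp: primitive_in_def)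
  define \<Theta> where "\<Theta> = {\<theta>. 0 < \<theta> \<and> \<theta> < 1 \<and> \<theta> *\<^sub>R w \<in> L}"
  have "finite ((\<lambda>\<theta>. \<theta> *\<^sub>R w) ` \<Theta>)"
    by (rule finite_subset[OF _ finite_bounded[of "cball 0 (norm w)"]]) (auto simp: \<Theta>_def mult_left_le_one_le)
  moreover have "inj_on (\<lambda>\<theta>. \<theta> *\<^sub>R w) \<Theta>" using w0 by (auto simp: inj_on_def)
  ultimately have fin: "finite \<Theta>" by (rule finite_imageD)
  have empty: "\<Theta> = {}"
  proof (rule ccontr)
    assume ne: "\<Theta> \<noteq> {}"
    define \<theta> where "\<theta> = Min \<Theta>"
    have th: "0 < \<theta>" "\<theta> < 1" "\<theta> *\<^sub>R w \<in> L" using Min_in[OF fin ne] by (auto simp: \<Theta>_def \<theta>_def)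
    define m where "m = \<lfloor>1 / \<theta>\<rfloor>"
    have m: "m * \<theta> \<le> 1" "1 < (m + 1) * \<theta>"
      using th of_int_floor_le[of "1 / \<theta>"] floor_correct[of "1 / \<theta>"]
      by (simp_all only: m_def pos_le_divide_eq pos_divide_less_eq of_int_add of_int_1)
    have m1: "1 \<le> m" using th by (auto simp: m_def le_floor_iff)
    have "(1 - m * \<theta>) *\<^sub>R w = w - of_int m *\<^sub>R (\<theta> *\<^sub>R w)" by (simp add: algebra_simps)
    also have "\<dots> \<in> L" using wL th by (intro diff_closed scaleR_int_closed)
    finally have in_L: "(1 - m * \<theta>) *\<^sub>R w \<in> L" .
    have "m * \<theta> > 0" using m1 th by simp
    then have "1 - m * \<theta> < 1" by simp
    moreover have "1 - m * \<theta> < \<theta>" using m by (simp add: algebra_simps)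
    ultimately have "\<not> 0 < 1 - m * \<theta>"
      using in_L Min_le[OF fin, of "1 - m * \<theta>"] by (auto simp: \<Theta>_def \<theta>_def)
    then have eq1: "m * \<theta> = 1" using m by simp
    then have "m \<noteq> 1" using th by auto
    then have "m \<ge> 2" using m1 by simp
    then have "nat m \<ge> 2" by simp
    moreover have "w = real (nat m) *\<^sub>R (\<theta> *\<^sub>R w)" using eq1 m1 by simp
    ultimately show False using w th(3) unfolding primitive_in_def by blast
  qed
  have fr: "frac t *\<^sub>R w \<in> L"
  proof -
    have "frac t *\<^sub>R w = w' - of_int \<lfloor>t\<rfloor> *\<^sub>R w" by (simp add: eq frac_def algebra_simps)
    also have "\<dots> \<in> L" using w' wL by (intro diff_closed scaleR_int_closed) (auto simp: primitive_in_def)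
    finally show ?thesis .
  qed
  then have "frac t = 0" using empty frac_ge_0[of t] frac_lt_1[of t] by (auto simp: \<Theta>_def order.order_iff_strict)
  then have t: "t = of_int \<lfloor>t\<rfloor>" by (simp add: frac_def)
  define z where "z = \<lfloor>t\<rfloor>"
  have tz: "t = of_int z" using t by (simp add: z_def)
  have z0: "z \<noteq> 0" using primitive_nonzero[OF w'] eq tz by auto
  show ?thesis
  proof (rule ccontr)
    assume "\<not> ?thesis"
    then have z2: "nat \<bar>z\<bar> \<ge> 2" using z0 tz by auto
    \<comment> \<open>Primitivity is phrased with natural factors, so the sign of z moves into the
      vector.\<close>
    have "w' = real (nat \<bar>z\<bar>) *\<^sub>R (if z > 0 then w else - w)"
      using eq tz z0 by auto
    then show False using w' z2 wL uminus_closed[OF wL] unfolding primitive_in_def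
      by (metis (full_types))
  qed
qed

lemma primitive_decomp_unique:
  assumes "primitive_in L w" "primitive_in L w'" "m \<ge> (1::nat)" "m' \<ge> (1::nat)"
    and eq: "real m *\<^sub>R w = real m' *\<^sub>R w'"
  shows "m = m' \<and> w = w'"
proof -
  have "w' = (1 / real m') *\<^sub>R (real m' *\<^sub>R w')" using assms(4) by simp
  also have "\<dots> = (real m / real m') *\<^sub>R w" using eq by (simp flip: eq)
  finally have w': "w' = (real m / real m') *\<^sub>R w" .
  have "real m / real m' > 0" using assms by simp
  with primitive_collinear[OF assms(1,2) w'] have "real m / real m' = 1" by auto
  then show ?thesis using w' assms by (auto simp: divide_simps split: if_splits)
qed

lemma primitive_part_eq:
  assumes "primitive_in L w" "m \<ge> (1::nat)"
  shows "primitive_part L (real m *\<^sub>R w) = w"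
proof -
  have "real m *\<^sub>R w \<noteq> 0" using assms primitive_nonzero by auto
  moreover have "(THE w'. primitive_in L w' \<and> (\<exists>m'\<ge>(1::nat). real m *\<^sub>R w = real m' *\<^sub>R w')) = w"
    by (rule the_equality) (use assms primitive_decomp_unique in blast)+
  ultimately show ?thesis by (simp add: primitive_part_def)
qed

text \<open>The index m stands for the multiple m + 1, so that sums over multiples are series over
  all of \<open>nat\<close>.\<close>

lemma bij_betw_nonzero_vectors:
  "bij_betw (\<lambda>(m, w). real (Suc m) *\<^sub>R w) (UNIV \<times> primitives L) (L - {0})"
proof (rule bij_betwI')
  fix x y :: "nat \<times> (real ^ 'n)"
  assume "x \<in> UNIV \<times> primitives L" "y \<in> UNIV \<times> primitives L"
  then show "((case x of (m, w) \<Rightarrow> real (Suc m) *\<^sub>R w) = (case y of (m, w) \<Rightarrow> real (Suc m) *\<^sub>R w)) = (x = y)"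
    using primitive_decomp_unique[of "snd x" "snd y" "Suc (fst x)" "Suc (fst y)"]
    by (cases x; cases y) (auto simp: primitives_def simp del: of_nat_Suc)
next
  fix x :: "nat \<times> (real ^ 'n)"
  assume "x \<in> UNIV \<times> primitives L"
  then show "(case x of (m, w) \<Rightarrow> real (Suc m) *\<^sub>R w) \<in> L - {0}"
    using primitive_nonzero scaleR_nat_closed
    by (cases x) (auto simp: primitives_def primitive_in_def simp del: of_nat_Suc)
next
  fix v assume "v \<in> L - {0}"
  then obtain m w where "m \<ge> (1::nat)" "primitive_in L w" "v = real m *\<^sub>R w"
    using primitive_decomp by blast
  then show "\<exists>x\<in>UNIV \<times> primitives L. v = (case x of (m, w) \<Rightarrow> real (Suc m) *\<^sub>R w)"
    by (intro bexI[of _ "(m - 1, w)"]) (auto simp: primitives_def)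
qed

text \<open>\<open>LEAST\<close> on the reals is meaningful only if the minimum exists; it does,
  since only finitely many lattice vectors are as short as a given nonzero one.\<close>

lemma lambda1_attained: "\<exists>v\<in>L. v \<noteq> 0 \<and> lambda1 L = norm v"
  and lambda1_le: "v \<in> L \<Longrightarrow> v \<noteq> 0 \<Longrightarrow> lambda1 L \<le> norm v"
proof -
  obtain v0 where v0: "v0 \<in> L" "v0 \<noteq> 0" using nontrivial by blast
  let ?A = "L \<inter> cball 0 (norm v0) - {0}"
  have fin: "finite (norm ` ?A)" using finite_bounded[of "cball 0 (norm v0)"] by simp
  have ne: "norm ` ?A \<noteq> {}" using v0 by auto
  obtain v1 where v1: "v1 \<in> ?A" "norm v1 = Min (norm ` ?A)" using Min_in[OF fin ne] by (metis (no_types, lifting) imageE)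
  have least: "norm v1 \<le> norm v" if "v \<in> L" "v \<noteq> 0" for v
  proof (cases "norm v \<le> norm v0")
    case True then show ?thesis using that v1 fin by simp
  next
    case False then show ?thesis using v1 by auto
  qed
  have eq: "lambda1 L = norm v1"
    unfolding lambda1_def
  proof (rule Least_equality)
    show "\<exists>v\<in>L. v \<noteq> 0 \<and> norm v1 = norm v" using v1 by auto
    show "norm v1 \<le> y" if "\<exists>v\<in>L. v \<noteq> 0 \<and> y = norm v" for y using that least by auto
  qed
  show "\<exists>v\<in>L. v \<noteq> 0 \<and> lambda1 L = norm v" using eq v1 by auto
  show "v \<in> L \<Longrightarrow> v \<noteq> 0 \<Longrightarrow> lambda1 L \<le> norm v" using eq least by auto
qed

lemma lambda1_pos: "lambda1 L > 0"
  using lambda1_attained by auto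

text \<open>The primitive part of a shortest vector is no longer than the vector itself.\<close>

lemma primitive_lambda1: obtains w where "primitive_in L w" "norm w = lambda1 L"
proof -
  obtain v where v: "v \<in> L" "v \<noteq> 0" "lambda1 L = norm v" using lambda1_attained by blast
  obtain m w where m: "m \<ge> (1::nat)" and w: "primitive_in L w" "v = real m *\<^sub>R w" using primitive_decomp v by blast
  have "norm w \<le> real m * norm w" using m by (simp add: mult_le_cancel_right1)
  then have "norm w \<le> lambda1 L" using v w by simp
  moreover have "lambda1 L \<le> norm w" using lambda1_le[of w] w primitive_nonzero by (auto simp: primitive_in_def)
  ultimately show ?thesis using that w by force
qed

lemma primitives_subset: "primitives L \<subseteq> L"
  by (auto simp: primitives_def primitive_in_def)

end

lemma unimodular_latticesE:
  assumes "L \<in> unimodular_lattices"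
  obtains g where "g \<in> SL_real" "L = lattice_of g"
  using assms by (auto simp: unimodular_lattices_def)

lemma discrete_subgroup_unimodular:
  fixes L :: "(real ^ 'n::finite) set"
  assumes "L \<in> unimodular_lattices"
  shows "discrete_subgroup L"
proof -
  obtain g where g: "g \<in> SL_real" and L: "L = lattice_of g" using assms by (rule unimodular_latticesE)
  have dg: "det g \<noteq> 0" using g by (simp add: SL_real_def)
  show ?thesis
  proof
    fix x y assume "x \<in> L" "y \<in> L"
    then show "x - y \<in> L"
      unfolding L lattice_of_eq lattice_act_def int_vecs_def
      by (auto simp flip: vector_matrix_mult_diff_distrib intro!: imageI)
  next
    fix B :: "(real ^ 'n) set" assume B: "bounded B"
    have "bounded ((\<lambda>x. x v* matrix_inv g) ` B)"
      using bounded_linear_image[OF B] linear_vector_matrix[of "matrix_inv g"] unfolding linear_conv_bounded_linear by blast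
    then have "finite ((\<lambda>a. a v* g) ` (int_vecs \<inter> (\<lambda>x. x v* matrix_inv g) ` B))"
      by (intro finite_imageI finite_int_vecs_bounded)
    moreover have "L \<inter> B \<subseteq> (\<lambda>a. a v* g) ` (int_vecs \<inter> (\<lambda>x. x v* matrix_inv g) ` B)"
    proof
      fix x assume x: "x \<in> L \<inter> B"
      then obtain a where a: "a \<in> int_vecs" "x = a v* g"
        by (auto simp: L lattice_of_eq lattice_act_def)
      then have "a = x v* matrix_inv g" using vector_matrix_inv(1)[OF dg] by simp
      then show "x \<in> (\<lambda>a. a v* g) ` (int_vecs \<inter> (\<lambda>x. x v* matrix_inv g) ` B)" using a x by blast
    qed
    ultimately show "finite (L \<inter> B)" by (rule finite_subset[rotated])
  next
    have "(\<chi> i. 1) v* g \<in> L"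
      unfolding L lattice_of_eq lattice_act_def by (auto simp: int_vecs_def)
    moreover have "(\<chi> i. 1) v* g \<noteq> 0"
      using inj_vector_matrix[OF dg, THEN injD, of "\<chi> i. 1" 0] by (auto simp: vec_eq_iff)
    ultimately show "\<exists>v\<in>L. v \<noteq> 0" by blast
  qed
qed

lemma unimodular_lattice_act:
  assumes "L \<in> unimodular_lattices" "g \<in> SL_real"
  shows "lattice_act L g \<in> unimodular_lattices"
  using assms by (auto simp: unimodular_lattices_def lattice_of_eq lattice_act_act SL_real_mult)

lemma primitive_in_act:
  fixes g :: "real ^ 'n::finite ^ 'n"
  assumes "det g \<noteq> 0"
  shows "primitive_in (lattice_act L g) (w v* g) \<longleftrightarrow> primitive_in L w"
proof -
  have inj: "x v* g = y v* g \<longleftrightarrow> x = y" for x y using inj_vector_matrix[OF assms] by (auto dest: injD)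
  have "(\<exists>w'\<in>lattice_act L g. w v* g = real m *\<^sub>R w') \<longleftrightarrow> (\<exists>w'\<in>L. w = real m *\<^sub>R w')" for m
    unfolding lattice_act_def by (simp add: inj flip: scaleR_vector_matrix_assoc)
  moreover have "w v* g \<in> lattice_act L g \<longleftrightarrow> w \<in> L"
    unfolding lattice_act_def using inj by auto
  ultimately show ?thesis by (simp add: primitive_in_def)
qed

lemma primitives_act:
  fixes g :: "real ^ 'n::finite ^ 'n"
  assumes "det g \<noteq> 0"
  shows "primitives (lattice_act L g) = (\<lambda>v. v v* g) ` primitives L"
proof (intro equalityI subsetI)
  fix w assume w: "w \<in> primitives (lattice_act L g)"
  then obtain v where "w = v v* g" by (auto simp: primitives_def primitive_in_def lattice_act_def)
  then show "w \<in> (\<lambda>v. v v* g) ` primitives L"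
    using w primitive_in_act[OF assms] by (auto simp: primitives_def)
qed (use primitive_in_act[OF assms] in \<open>auto simp: primitives_def\<close>)

section \<open>Counting primitive vectors in dilated sets\<close>

text \<open>The library's volume formula for linear images needs an index type of class \<open>wellorder\<close>.\<close>

typedef ('a::finite) windex = "{..<CARD('a)}"
  by (rule exI[of _ 0]) simp

instantiation windex :: (finite) linorder
begin
definition "x \<le> y \<longleftrightarrow> Rep_windex x \<le> Rep_windex y"
definition "x < y \<longleftrightarrow> Rep_windex x < Rep_windex y"
instance by standard (auto simp: less_eq_windex_def less_windex_def Rep_windex_inject)
end

instance windex :: (finite) wellorder
proof
  fix P :: "'a windex \<Rightarrow> bool" and a
  assume *: "\<And>x. (\<And>y. y < x \<Longrightarrow> P y) \<Longrightarrow> P x"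
  show "P a"
    by (induction "Rep_windex a" arbitrary: a rule: less_induct) (rule *, auto simp: less_windex_def)
qed

lemma bij_betw_Abs_windex: "bij_betw Abs_windex {..<CARD('a)} (UNIV :: ('a::finite) windex set)"
  by (rule bij_betwI[where g = Rep_windex]) (use Rep_windex in \<open>auto simp: Abs_windex_inverse Rep_windex_inverse\<close>)

instance windex :: (finite) finite
  by standard (metis bij_betw_Abs_windex bij_betw_finite finite_lessThan)

lemma ex_bij_windex: "\<exists>\<sigma> :: 'a::finite \<Rightarrow> 'a windex. bij \<sigma>"
proof -
  have "CARD('a windex) = CARD('a)" using bij_betw_same_card[OF bij_betw_Abs_windex[where 'a = 'a]] by simp
  then show ?thesis by (intro finite_same_card_bij) auto
qed

text \<open>Conjugation by \<tau> matches the permutations of the two index types and preserves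
  signs, so the two Leibniz expansions agree term by term.\<close>

lemma det_reindex:
  fixes A :: "real ^ 'n::finite ^ 'n" and \<tau> :: "'m::finite \<Rightarrow> 'n"
  assumes "bij \<tau>"
  shows "det (\<chi> i j. A $ \<tau> i $ \<tau> j) = det A"
proof -
  let ?h = "map_permutation UNIV \<tau>"
  have inj: "inj_on \<tau> UNIV" using assms bij_is_inj by blast
  have ap: "?h p (\<tau> x) = \<tau> (p x)" for p x by (rule map_permutation_apply) (use inj in auto)
  have bij: "bij_betw ?h {p. p permutes UNIV} {p. p permutes UNIV}"
  proof (rule bij_betwI[where g = "map_permutation UNIV (inv \<tau>)"])
    show "?h \<in> {p. p permutes UNIV} \<rightarrow> {p. p permutes UNIV}"
      by (auto intro!: map_permutation_permutes assms)
    show "map_permutation UNIV (inv \<tau>) \<in> {p. p permutes UNIV} \<rightarrow> {p. p permutes UNIV}"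
      by (auto intro!: map_permutation_permutes bij_imp_bij_inv assms)
    show "map_permutation UNIV (inv \<tau>) (?h p) = p" if "p \<in> {p. p permutes UNIV}" for p
      using that assms by (intro map_permutation_compose_inv[where B = UNIV]) (auto simp: bij_is_inj)
    show "?h (map_permutation UNIV (inv \<tau>) p) = p" if "p \<in> {p. p permutes UNIV}" for p
      using that assms by (intro map_permutation_compose_inv[where B = UNIV]) (auto simp: bij_imp_bij_inv bij_is_surj surj_f_inv_f)
  qed
  have "of_int (sign p) * (\<Prod>i\<in>UNIV. (\<chi> i j. A $ \<tau> i $ \<tau> j) $ i $ p i) =
      of_int (sign (?h p)) * (\<Prod>i\<in>UNIV. A $ i $ ?h p i)" if "p permutes UNIV" for p
  proof -
    have "(\<Prod>i\<in>UNIV. A $ i $ ?h p i) = (\<Prod>i\<in>UNIV. A $ \<tau> i $ ?h p (\<tau> i))"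
      by (rule prod.reindex_bij_betw[symmetric]) (rule assms)
    moreover have "sign (?h p) = sign p" by (rule sign_map_permutation) (use that inj in auto)
    ultimately show ?thesis by (simp add: ap)
  qed
  then have "det (\<chi> i j. A $ \<tau> i $ \<tau> j) =
      (\<Sum>p\<in>{p. p permutes UNIV}. of_int (sign (?h p)) * (\<Prod>i\<in>UNIV. A $ i $ ?h p i))"
    unfolding det_def by (intro sum.cong) auto
  also have "\<dots> = det A"
    unfolding det_def
    using sum.reindex_bij_betw[OF bij, of "\<lambda>p. of_int (sign p) * (\<Prod>i\<in>UNIV. A $ i $ p i)"] .
  finally show ?thesis .
qed

lemma prod_Basis_cart: "(\<Prod>b\<in>Basis. (x :: real ^ 'k::finite) \<bullet> b) = (\<Prod>i\<in>UNIV. x $ i)"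
proof -
  have "(\<Prod>b\<in>(Basis :: (real ^ 'k) set). x \<bullet> b) = (\<Prod>b\<in>range (\<lambda>i. axis i 1). x \<bullet> b)"
    by (rule prod.cong) (auto simp: Basis_vec_def)
  also have "\<dots> = (\<Prod>i\<in>UNIV. x $ i)"
    by (subst prod.reindex) (auto simp: inj_on_def axis_eq_axis inner_axis)
  finally show ?thesis .
qed

text \<open>Lebesgue measure is characterised by its values on boxes, and relabelling coordinates
  only permutes the sides of a box.\<close>

lemma lborel_distr_reindex:
  fixes \<tau> :: "'m::finite \<Rightarrow> 'n::finite"
  assumes "bij \<tau>"
  shows "distr (lborel :: (real ^ 'n) measure) borel (\<lambda>x. \<chi> i. x $ \<tau> i) = (lborel :: (real ^ 'm) measure)"
proof (rule lborel_eqI[symmetric])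
  have meas [measurable]: "(\<lambda>x::real ^ 'n. \<chi> i. x $ \<tau> i) \<in> borel_measurable borel"
    by (intro borel_measurable_continuous_onI continuous_intros)
  fix l u :: "real ^ 'm" assume lu: "\<And>b. b \<in> Basis \<Longrightarrow> l \<bullet> b \<le> u \<bullet> b"
  define l' u' :: "real ^ 'n" where "l' = (\<chi> i. l $ inv \<tau> i)" and "u' = (\<chi> i. u $ inv \<tau> i)"
  have le: "l $ i \<le> u $ i" for i using lu[of "axis i 1"] by (simp add: inner_axis axis_in_Basis_iff)
  have vim: "(\<lambda>x::real ^ 'n. \<chi> i. x $ \<tau> i) -` box l u = box l' u'"
    using assms by (auto simp: mem_box_cart l'_def u'_def bij_is_surj surj_f_inv_f)
      (metis bij_inv_eq_iff)+
  have "emeasure (distr lborel borel (\<lambda>x::real ^ 'n. \<chi> i. x $ \<tau> i)) (box l u) = emeasure lborel (box l' u')"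
    by (subst emeasure_distr) (auto simp: vim)
  also have "\<dots> = (\<Prod>b\<in>Basis. (u' - l') \<bullet> b)"
    by (rule emeasure_lborel_box) (auto simp: l'_def u'_def Basis_vec_def inner_axis le)
  also have "(\<Prod>b\<in>Basis. (u' - l') \<bullet> b) = (\<Prod>b\<in>Basis. (u - l) \<bullet> b)"
    unfolding prod_Basis_cart l'_def u'_def
    using prod.reindex_bij_betw[OF bij_imp_bij_inv[OF assms], of "\<lambda>i. u $ i - l $ i"] by simp
  finally show "emeasure (distr lborel borel (\<lambda>x::real ^ 'n. \<chi> i. x $ \<tau> i)) (box l u) = ennreal (\<Prod>b\<in>Basis. (u - l) \<bullet> b)" .
qed simp

lemma measure_lebesgue_compact: "compact S \<Longrightarrow> measure lebesgue S = measure lborel S"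
  by (rule measure_completion) (simp add: borel_compact)

text \<open>It suffices to know the factor on boxes. There the coordinates are relabelled by
  \<open>windex\<close>, where the volume formula applies; the relabelling changes neither the
  volume nor the determinant.\<close>

lemma measure_vector_matrix_image:
  fixes M :: "real ^ 'n::finite ^ 'n"
  assumes "S \<in> lmeasurable"
  shows "(\<lambda>x. x v* M) ` S \<in> lmeasurable \<and> \<bar>det M\<bar> * measure lebesgue S = measure lebesgue ((\<lambda>x. x v* M) ` S)"
proof (rule measure_linear_sufficient[OF linear_vector_matrix assms])
  fix a b :: "real ^ 'n"
  obtain \<sigma> :: "'n \<Rightarrow> 'n windex" where \<sigma>: "bij \<sigma>" using ex_bij_windex by blast
  define \<tau> where "\<tau> = inv \<sigma>"
  have \<tau>: "bij \<tau>" using \<sigma> bij_imp_bij_inv by (auto simp: \<tau>_def)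
  have inv: "inv \<tau> (\<tau> i) = i" "\<tau> (inv \<tau> j) = j" for i j
    using \<tau> by (simp_all add: bij_is_inj bij_is_surj surj_f_inv_f)
  define \<Phi> :: "real ^ 'n \<Rightarrow> real ^ 'n windex" where "\<Phi> x = (\<chi> i. x $ \<tau> i)" for x
  define M' :: "real ^ 'n windex ^ 'n windex" where "M' = (\<chi> i j. M $ \<tau> i $ \<tau> j)"
  have inj\<Phi>: "inj \<Phi>"
  proof (rule injI)
    fix x y assume "\<Phi> x = \<Phi> y"
    then have "x $ \<tau> i = y $ \<tau> i" for i by (simp add: \<Phi>_def vec_eq_iff)
    from this[of "inv \<tau> j" for j] show "x = y" by (simp add: vec_eq_iff inv)
  qed
  have meas [measurable]: "\<Phi> \<in> borel_measurable borel"
    unfolding \<Phi>_def by (intro borel_measurable_continuous_onI continuous_intros)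
  have pres: "measure lborel (\<Phi> ` Y) = measure lborel Y" if "compact Y" for Y
  proof -
    have "compact (\<Phi> ` Y)"
      by (rule compact_continuous_image[OF _ that]) (auto simp: \<Phi>_def intro!: continuous_intros)
    then have B: "\<Phi> ` Y \<in> sets borel" by (rule borel_compact)
    have "distr lborel borel \<Phi> = lborel"
      using lborel_distr_reindex[OF \<tau>] unfolding \<Phi>_def[abs_def] .
    then have "measure lborel (\<Phi> ` Y) = measure (distr lborel borel \<Phi>) (\<Phi> ` Y)" by (simp only:)
    also have "\<dots> = measure lborel (\<Phi> -` (\<Phi> ` Y))" using B by (simp add: measure_distr)
    finally show ?thesis by (simp add: inj_vimage_image_eq[OF inj\<Phi>])
  qed
  have comm: "\<Phi> (x v* M) = \<Phi> x v* M'" for x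
  proof (rule vec_eq_iff[THEN iffD2], rule allI)
    fix i
    have "\<Phi> (x v* M) $ i = (\<Sum>j\<in>UNIV. M $ j $ \<tau> i * x $ j)"
      by (simp add: \<Phi>_def vector_matrix_mult_def mult.commute)
    also have "\<dots> = (\<Sum>j\<in>UNIV. M $ \<tau> j $ \<tau> i * x $ \<tau> j)"
      by (rule sum.reindex_bij_betw[OF \<tau>, symmetric])
    also have "\<dots> = (\<Phi> x v* M') $ i"
      by (simp add: \<Phi>_def M'_def vector_matrix_mult_def mult.commute)
    finally show "\<Phi> (x v* M) $ i = (\<Phi> x v* M') $ i" .
  qed
  have "measure lborel ((\<lambda>x. x v* M) ` cbox a b) = measure lborel (\<Phi> ` (\<lambda>x. x v* M) ` cbox a b)"
    by (intro pres[symmetric] compact_continuous_image continuous_intros compact_cbox)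
  also have "\<Phi> ` (\<lambda>x. x v* M) ` cbox a b = (\<lambda>x. x v* M') ` \<Phi> ` cbox a b"
    by (simp add: image_image comm)
  also have "measure lborel \<dots> = \<bar>det M'\<bar> * measure lborel (\<Phi> ` cbox a b)"
  proof -
    have c1: "compact (\<Phi> ` cbox a b)"
      unfolding \<Phi>_def by (intro compact_continuous_image continuous_intros compact_cbox)
    have c2: "compact ((\<lambda>x. x v* M') ` \<Phi> ` cbox a b)"
      by (intro compact_continuous_image continuous_intros c1)
    note c = c1 c2
    have "matrix (\<lambda>x. x v* M') = transpose M'"
      using matrix_of_matrix_vector_mul[of "transpose M'"] by simp
    then have "measure lebesgue ((\<lambda>x. x v* M') ` (\<Phi> ` cbox a b)) = \<bar>det M'\<bar> * measure lebesgue (\<Phi> ` cbox a b)"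
      using measure_linear_image[OF linear_vector_matrix[of M'] lmeasurable_compact[OF c(1)]]
      by (simp add: det_transpose)
    then show ?thesis using c by (simp only: measure_lebesgue_compact)
  qed
  also have "det M' = det M" unfolding M'_def by (rule det_reindex[OF \<tau>])
  also have "measure lborel (\<Phi> ` cbox a b) = measure lborel (cbox a b)" by (rule pres) simp
  finally have "measure lborel ((\<lambda>x. x v* M) ` cbox a b) = \<bar>det M\<bar> * measure lborel (cbox a b)" .
  moreover have "compact ((\<lambda>x. x v* M) ` cbox a b)"
    by (intro compact_continuous_image continuous_intros compact_cbox)
  ultimately show "measure lebesgue ((\<lambda>x. x v* M) ` cbox a b) = \<bar>det M\<bar> * measure lebesgue (cbox a b)"
    by (simp only: measure_lebesgue_compact compact_cbox)
qed

section \<open>Rounding to a lattice: lattice sums as integrals\<close>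

lemma det_scaleR:
  fixes A :: "real ^ 'n::finite ^ 'n"
  shows "det (c *\<^sub>R A) = c ^ CARD('n) * det A"
proof -
  have "c *\<^sub>R A = (\<chi> i. c *s A $ i)" by (simp add: vec_eq_iff)
  then show ?thesis by (simp add: det_rows_mul)
qed

text \<open>For invertible M this is the lower corner of the cell containing x, for the lattice
  spanned by the rows of M. It turns lattice sums into Lebesgue integrals.\<close>

definition round_to :: "real ^ 'n ^ 'n \<Rightarrow> real ^ 'n \<Rightarrow> real ^ 'n::finite" where
  "round_to M x = (\<chi> i. of_int \<lfloor>(x v* matrix_inv M) $ i\<rfloor>) v* M"

lemma borel_measurable_vector_matrix [measurable]:
  "(\<lambda>x. x v* (M :: real ^ 'n ^ 'm)) \<in> borel_measurable borel"
  by (intro borel_measurable_continuous_onI continuous_intros)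

lemma borel_measurable_vec_lambda:
  assumes "\<And>i. (\<lambda>x. f x i) \<in> borel_measurable N"
  shows "(\<lambda>x. (\<chi> i. f x i) :: real ^ 'n) \<in> borel_measurable N"
proof (rule borel_measurable_euclidean_space[THEN iffD2], rule ballI)
  fix b :: "real ^ 'n" assume "b \<in> Basis"
  then obtain i where "b = axis i 1" by (auto simp: Basis_vec_def)
  then show "(\<lambda>x. (\<chi> i. f x i) \<bullet> b) \<in> borel_measurable N" using assms by (simp add: inner_axis)
qed

lemma borel_measurable_round_to [measurable]: "round_to M \<in> borel_measurable borel"
proof -
  have "(\<lambda>x. \<chi> i. real_of_int \<lfloor>(x v* matrix_inv M) $ i\<rfloor>) \<in> borel_measurable borel"
    by (intro borel_measurable_vec_lambda measurable_compose[OF _ borel_measurable_real_floor]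
      borel_measurable_continuous_onI continuous_intros)
  from measurable_compose[OF this borel_measurable_vector_matrix[of M]]
  show ?thesis by (simp add: round_to_def[abs_def])
qed

text \<open>\<open>round_to M\<close> is constant on the cells; they partition the space and have
  volume |det M| each, so the integral is a sum over cells.\<close>

lemma nn_integral_round_to:
  fixes M :: "real ^ 'n::finite ^ 'n"
  assumes dM: "det M \<noteq> 0" and [measurable]: "f \<in> borel_measurable borel"
  shows "(\<integral>\<^sup>+x. f (round_to M x) \<partial>lborel) =
    ennreal \<bar>det M\<bar> * (\<integral>\<^sup>+v. f v \<partial>count_space (lattice_act int_vecs M))"
proof -
  let ?L = "lattice_act int_vecs M"
  let ?H = "{y :: real ^ 'n. \<forall>i. 0 \<le> y $ i \<and> y $ i < 1}"
  have cnt: "countable ?L"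
  proof -
    have "\<exists>m::nat. x \<in> cball 0 (real m)" for x :: "real ^ 'n" by (simp add: real_arch_simple)
    then have "(int_vecs :: (real ^ 'n) set) = (\<Union>m::nat. int_vecs \<inter> cball 0 (real m))" by blast
    also have "countable \<dots>" by (rule countable_UN) (auto intro: countable_finite finite_int_vecs_bounded)
    finally show ?thesis unfolding lattice_act_def by (rule countable_image)
  qed
  have in_L: "round_to M x \<in> ?L" for x
    by (auto simp: round_to_def lattice_act_def int_vecs_def intro!: imageI)
  have cell: "{x. round_to M x = v} = (\<lambda>y. y v* M) ` ((\<lambda>y. a + y) ` ?H)" if "a \<in> int_vecs" "v = a v* M" for a v
  proof -
    have "round_to M x = v \<longleftrightarrow> (\<forall>i. of_int \<lfloor>(x v* matrix_inv M) $ i\<rfloor> = a $ i)" for x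
      unfolding round_to_def that(2) inj_eq[OF inj_vector_matrix[OF dM]] by (simp add: vec_eq_iff)
    also have "\<dots> x \<longleftrightarrow> (x v* matrix_inv M) - a \<in> ?H" for x
    proof -
      have "(of_int \<lfloor>(x v* matrix_inv M) $ i\<rfloor> = a $ i) \<longleftrightarrow> (0 \<le> ((x v* matrix_inv M) - a) $ i \<and> ((x v* matrix_inv M) - a) $ i < 1)" for i
      proof -
        have "a $ i \<in> \<int>" using that(1) by (simp add: int_vecs_def)
        then obtain z where z: "a $ i = of_int z" by (rule Ints_cases)
        show ?thesis unfolding z vector_minus_component of_int_eq_iff floor_eq_iff by auto
      qed
      then show ?thesis by simp
    qed
    also have "\<dots> x \<longleftrightarrow> x \<in> (\<lambda>y. y v* M) ` ((\<lambda>y. a + y) ` ?H)" for x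
    proof
      assume "(x v* matrix_inv M) - a \<in> ?H"
      then show "x \<in> (\<lambda>y. y v* M) ` ((\<lambda>y. a + y) ` ?H)"
        using vector_matrix_inv(2)[OF dM, of x] image_eqI[OF refl, of "(x v* matrix_inv M) - a" ?H "\<lambda>y. (a + y) v* M"]
        by (simp add: image_image)
    qed (use vector_matrix_inv(1)[OF dM] in auto)
    finally show ?thesis by auto
  qed
  have H: "?H \<in> lmeasurable" "measure lebesgue ?H = 1"
  proof -
    \<comment> \<open>The half-open cube is caught between the open and the closed cube, both of
      volume 1.\<close>
    have sub: "box 0 1 \<subseteq> ?H" "?H \<subseteq> cbox 0 1" by (auto simp: mem_box_cart less_imp_le)
    have "{y :: real ^ 'n. 0 \<le> y $ i \<and> y $ i < 1} \<in> sets borel" for i by measurable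
    then have "(\<Inter>i. {y :: real ^ 'n. 0 \<le> y $ i \<and> y $ i < 1}) \<in> sets borel" by (intro sets.finite_INT) auto
    moreover have "(\<Inter>i. {y :: real ^ 'n. 0 \<le> y $ i \<and> y $ i < 1}) = ?H" by auto
    ultimately have "?H \<in> sets borel" by simp
    then have "?H \<in> sets lebesgue" by simp
    then show lm: "?H \<in> lmeasurable"
      by (rule bounded_set_imp_lmeasurable[OF bounded_subset[OF bounded_cbox sub(2)]])
    have one: "\<forall>b\<in>Basis. 0 \<le> (1 :: real ^ 'n) \<bullet> b" by (auto simp: Basis_vec_def inner_axis)
    have "measure lebesgue (cbox 0 (1 :: real ^ 'n)) = 1" "measure lebesgue (box 0 (1 :: real ^ 'n)) = 1"
      by (simp_all add: one measure_lborel_box_eq measure_lborel_cbox_eq measure_completion inner_Basis prod_Basis_cart)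
    then show "measure lebesgue ?H = 1"
      using measure_mono_fmeasurable[OF sub(1) _ lm] measure_mono_fmeasurable[OF sub(2) fmeasurableD[OF lm]] by simp
  qed
  have em: "emeasure lborel {x. round_to M x = v} = ennreal \<bar>det M\<bar>" if v: "v \<in> ?L" for v
  proof -
    obtain a where a: "a \<in> int_vecs" "v = a v* M" using v by (auto simp: lattice_act_def)
    have t: "(\<lambda>y. a + y) ` ?H \<in> lmeasurable" "measure lebesgue ((\<lambda>y. a + y) ` ?H) = 1"
      using H by (simp_all add: measurable_translation measure_translation)
    have "{x. round_to M x = v} \<in> sets borel" by measurable
    then have "emeasure lborel {x. round_to M x = v} = emeasure lebesgue {x. round_to M x = v}"
      by (simp add: emeasure_completion)
    also have "\<dots> = ennreal \<bar>det M\<bar>"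
    proof -
      have im: "(\<lambda>y. y v* M) ` (\<lambda>y. a + y) ` ?H \<in> lmeasurable"
        "measure lebesgue ((\<lambda>y. y v* M) ` (\<lambda>y. a + y) ` ?H) = \<bar>det M\<bar>"
        using measure_vector_matrix_image[OF t(1), of M] t(2) by simp_all
      show ?thesis
        unfolding cell[OF a] using emeasure_eq_ennreal_measure[OF fmeasurableD2[OF im(1)]] im(2) by (simp only:)
    qed
    finally show ?thesis .
  qed
  interpret C: sigma_finite_measure "count_space ?L" by (rule sigma_finite_measure_count_space_countable[OF cnt])
  interpret pair_sigma_finite "count_space ?L" "lborel :: (real ^ 'n) measure" ..
  have "(\<integral>\<^sup>+x. f (round_to M x) \<partial>lborel) =
     (\<integral>\<^sup>+x. (\<integral>\<^sup>+v. f v * indicator {x. round_to M x = v} x \<partial>count_space ?L) \<partial>lborel)"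
  \<comment> \<open>For each x exactly one lattice vector contributes, namely
    \<open>round_to M x\<close>.\<close>
  proof (rule nn_integral_cong)
    fix x :: "real ^ 'n"
    have "(\<integral>\<^sup>+v. f v * indicator {x. round_to M x = v} x \<partial>count_space ?L) =
       (\<Sum>v\<in>{round_to M x}. f v * indicator {x. round_to M x = v} x)"
      by (rule nn_integral_count_space') (use in_L in \<open>auto simp: indicator_def\<close>)
    then show "f (round_to M x) = (\<integral>\<^sup>+v. f v * indicator {x. round_to M x = v} x \<partial>count_space ?L)" by simp
  qed
  also have "\<dots> = (\<integral>\<^sup>+v. (\<integral>\<^sup>+x. f v * indicator {x. round_to M x = v} x \<partial>lborel) \<partial>count_space ?L)"
    by (rule Fubini') (rule measurable_pair_measure_countable1[OF cnt], measurable)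
  also have "\<dots> = (\<integral>\<^sup>+v. f v * ennreal \<bar>det M\<bar> \<partial>count_space ?L)"
    by (intro nn_integral_cong) (simp add: nn_integral_cmult_indicator em)
  also have "\<dots> = ennreal \<bar>det M\<bar> * (\<integral>\<^sup>+v. f v \<partial>count_space ?L)"
    by (simp add: nn_integral_multc mult.commute)
  finally show ?thesis .
qed

text \<open>In lattice coordinates the error has entries of absolute value at most 1, whatever x is;
  the matrix g/T shrinks it uniformly.\<close>

lemma norm_round_to_le:
  fixes g :: "real ^ 'n::finite ^ 'n"
  assumes "det g \<noteq> 0"
  obtains D where "D > 0" "\<And>T x. T > 0 \<Longrightarrow> norm (round_to ((1 / T) *\<^sub>R g) x - x) \<le> D / T"
proof -
  obtain C where C: "C > 0" "\<And>a. norm (a v* g) \<le> C * norm a" using norm_vector_matrix_le by blast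
  show ?thesis
  proof (rule that[of "C * real CARD('n)"])
    show "C * real CARD('n) > 0" using C by simp
    fix T :: real and x :: "real ^ 'n" assume T: "T > 0"
    let ?M = "(1 / T) *\<^sub>R g"
    have dM: "det ?M \<noteq> 0"
      using assms T by (simp add: det_scaleR)
    define y where "y = x v* matrix_inv ?M"
    have x: "x = y v* ?M" by (simp add: y_def vector_matrix_inv(2)[OF dM])
    define z where "z = (\<chi> i. real_of_int \<lfloor>y $ i\<rfloor>) - y"
    have "norm z \<le> (\<Sum>i\<in>UNIV. \<bar>z $ i\<bar>)" by (rule norm_le_l1_cart)
    also have "\<dots> \<le> (\<Sum>i\<in>(UNIV :: 'n set). 1)"
    proof (rule sum_mono)
      fix i
      show "\<bar>z $ i\<bar> \<le> 1" unfolding z_def by (simp add: abs_le_iff) linarith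
    qed
    finally have z: "norm z \<le> real CARD('n)" by simp
    have "round_to ?M x - x = (\<chi> i. of_int \<lfloor>y $ i\<rfloor>) v* ?M - y v* ?M"
      by (simp only: round_to_def y_def[symmetric] x[symmetric])
    also have "\<dots> = z v* ?M"
      by (simp only: vector_matrix_mult_diff_distrib z_def)
    also have "\<dots> = (1 / T) *\<^sub>R (z v* g)"
      by (simp only: vector_scaleR_matrix_ac)
    finally have "norm (round_to ?M x - x) = (1 / T) * norm (z v* g)" using T by simp
    also have "\<dots> \<le> (1 / T) * (C * norm z)" using C T by (intro mult_left_mono) auto
    also have "\<dots> \<le> (1 / T) * (C * real CARD('n))" using C T z by (intro mult_left_mono) auto
    finally show "norm (round_to ?M x - x) \<le> C * real CARD('n) / T" by simp
  qed
qed

section \<open>The zeta series and counts in dilated sets\<close>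

lemma zeta_eq: "zeta (real n) = (\<Sum>m. 1 / real (Suc m) ^ n)"
  by (simp add: zeta_def powr_realpow)

text \<open>The bound 1/2 on the tail is what the inversion in
  \<open>tendsto_of_weighted_dilates\<close> requires. It comes from j^-3 <= (1/(j-1) - 1/j)/2 for j
  >= 2, which telescopes.\<close>

lemma zeta_terms:
  assumes "n \<ge> 3"
  shows "summable (\<lambda>m. 1 / real (Suc m) ^ n)" and "(\<Sum>m. 1 / real (Suc (Suc m)) ^ n) \<le> 1 / 2"
    and "zeta (real n) = 1 + (\<Sum>m. 1 / real (Suc (Suc m)) ^ n)"
    and "1 < zeta (real n)"
proof -
  have tel: "(\<lambda>m. 1 / real (Suc m) - 1 / real (Suc (Suc m))) sums (1 / real (Suc 0) - 0)"
    by (rule telescope_sums') (use LIMSEQ_inverse_real_of_nat in \<open>simp add: inverse_eq_divide\<close>)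
  then have tel: "(\<lambda>m. 1 / 2 * (1 / real (Suc m) - 1 / real (Suc (Suc m)))) sums (1 / 2)"
    using sums_mult[of _ _ "1 / 2 :: real"] by fastforce
  have le: "1 / real (Suc (Suc m)) ^ n \<le> 1 / 2 * (1 / real (Suc m) - 1 / real (Suc (Suc m)))" for m
  proof -
    have "1 / real (Suc (Suc m)) ^ n \<le> 1 / real (Suc (Suc m)) ^ 3"
      using assms by (intro divide_left_mono power_increasing) auto
    also have "\<dots> \<le> 1 / (2 * real (Suc m) * real (Suc (Suc m)))"
    proof (rule frac_le)
      show "2 * real (Suc m) * real (Suc (Suc m)) \<le> real (Suc (Suc m)) ^ 3"
        by (simp add: power3_eq_cube algebra_simps)
    qed simp_all
    also have "\<dots> = 1 / 2 * (1 / real (Suc m) - 1 / real (Suc (Suc m)))"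
      by (simp add: field_simps)
    finally show ?thesis .
  qed
  have s: "summable (\<lambda>m. 1 / real (Suc (Suc m)) ^ n)"
    by (rule summable_comparison_test'[OF sums_summable[OF tel], of 0]) (use le in auto)
  then show sm: "summable (\<lambda>m. 1 / real (Suc m) ^ n)"
    by (subst (asm) summable_Suc_iff)
  show "(\<Sum>m. 1 / real (Suc (Suc m)) ^ n) \<le> 1 / 2"
    using suminf_le[OF le s sums_summable[OF tel]] sums_unique[OF tel] by simp
  show z: "zeta (real n) = 1 + (\<Sum>m. 1 / real (Suc (Suc m)) ^ n)"
    unfolding zeta_eq by (subst suminf_split_head[OF sm]) simp
  have "0 < (\<Sum>m. 1 / real (Suc (Suc m)) ^ n)" by (rule suminf_pos[OF s]) auto
  then show "1 < zeta (real n)" using z by simp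
qed

text \<open>Here \<open>c m = (m + 1)\<^sup>-\<^sup>n\<close>: the weighted sum over dilates counts all nonzero vectors if \<open>a\<close> counts primitive ones.
  As the weights with \<open>m \<ge> 1\<close> add up to at most \<open>1 / 2\<close>, inverting the sum is a contraction.\<close>

lemma tendsto_of_weighted_dilates:
  fixes a :: "real \<Rightarrow> real" and c :: "nat \<Rightarrow> real"
  assumes c: "\<And>m. c m \<ge> 0" "c 0 = 1" "summable c" "(\<Sum>m. c (Suc m)) \<le> 1 / 2"
    and K: "\<And>T. T > 0 \<Longrightarrow> \<bar>a T\<bar> \<le> K"
    and lim: "((\<lambda>T. \<Sum>m. c m * a (T / real (Suc m))) \<longlongrightarrow> l * (\<Sum>m. c m)) at_top"
  shows "(a \<longlongrightarrow> l) at_top"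
proof -
  define e where "e T = \<bar>a T - l\<bar>" for T
  define K' where "K' = K + \<bar>l\<bar> + 1"
  have K0: "K \<ge> 0" using K[of 1] by simp
  have e0: "e T \<ge> 0" for T by (simp add: e_def)
  have eK: "e T \<le> K'" if "T > 0" for T using K[OF that] by (auto simp: e_def K'_def)
  have K'pos: "K' > 0" using K0 by (simp add: K'_def)
  have cS: "summable (\<lambda>m. c (Suc m))" using c(3) by (simp add: summable_Suc_iff)
  have sm_a: "summable (\<lambda>m. c m * a (T / real (Suc m)))" if "T > 0" for T
    by (rule summable_comparison_test'[OF summable_mult2[OF c(3), of K], of 0])
      (use K[of "T / real (Suc _)"] that c(1) in \<open>auto simp: abs_mult intro!: mult_left_mono\<close>)
  have sm_e: "summable (\<lambda>m. c (Suc m) * e (T / real (Suc (Suc m))))" if "T > 0" for T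
    by (rule summable_comparison_test'[OF summable_mult2[OF cS, of K'], of 0])
      (use eK[of "T / real (Suc (Suc _))"] that c(1) e0 in \<open>auto simp: abs_mult intro!: mult_left_mono\<close>)
  define b where "b T = (\<Sum>m. c m * a (T / real (Suc m))) - l * (\<Sum>m. c m)" for T
  have b0: "(b \<longlongrightarrow> 0) at_top" using tendsto_diff[OF lim tendsto_const[of "l * (\<Sum>m. c m)"]] by (simp add: b_def[abs_def])
  have main: "e T \<le> \<bar>b T\<bar> + (\<Sum>m. c (Suc m) * e (T / real (Suc (Suc m))))" if T: "T > 0" for T
  proof -
    have sd: "summable (\<lambda>m. c m * (a (T / real (Suc m)) - l))"
      using summable_diff[OF sm_a[OF T] summable_mult2[OF c(3), of l]] by (simp add: algebra_simps)
    have "b T = (\<Sum>m. c m * (a (T / real (Suc m)) - l))"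
      unfolding b_def using suminf_diff[OF sm_a[OF T] summable_mult2[OF c(3), of l]] suminf_mult2[OF c(3), of l]
      by (simp add: algebra_simps)
    also have "\<dots> = (a T - l) + (\<Sum>m. c (Suc m) * (a (T / real (Suc (Suc m))) - l))"
      by (subst suminf_split_head[OF sd]) (simp add: c)
    finally have "a T - l = b T - (\<Sum>m. c (Suc m) * (a (T / real (Suc (Suc m))) - l))" by simp
    moreover have "\<bar>\<Sum>m. c (Suc m) * (a (T / real (Suc (Suc m))) - l)\<bar> \<le> (\<Sum>m. \<bar>c (Suc m) * (a (T / real (Suc (Suc m))) - l)\<bar>)"
      by (rule summable_rabs) (use sm_e[OF T] c(1) in \<open>simp add: abs_mult e_def\<close>)
    ultimately show ?thesis using c(1) by (simp add: abs_mult e_def)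
  qed
  \<comment> \<open>The eventual upper bounds of the error; their infimum serves as a limsup, and
    the step from \<delta> to \<delta>/2 + \<epsilon> forces it to be 0.\<close>
  define \<Delta> where "\<Delta> = {\<delta>. \<delta> \<ge> 0 \<and> (\<forall>\<^sub>F T in at_top. e T \<le> \<delta>)}"
  have step: "\<delta> / 2 + \<epsilon> \<in> \<Delta>" if \<delta>: "\<delta> \<in> \<Delta>" and \<epsilon>: "\<epsilon> > 0" for \<delta> \<epsilon>
  proof -
    have \<delta>0: "\<delta> \<ge> 0" using \<delta> by (simp add: \<Delta>_def)
    \<comment> \<open>Beyond N the weights are so small that the crude bound K' suffices; before N
      the arguments T/(m+2) are large enough for the bound \<delta>.\<close>
    have "(\<lambda>N. \<Sum>m. c (Suc (m + N))) \<longlonglongrightarrow> 0" using suminf_exist_split2[OF cS] by simp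
    then have "\<forall>\<^sub>F N in sequentially. (\<Sum>m. c (Suc (m + N))) < \<epsilon> / (2 * K')"
      using K'pos \<epsilon> by (intro order_tendstoD) auto
    then obtain N where N: "(\<Sum>m. c (Suc (m + N))) < \<epsilon> / (2 * K')" by (auto simp: eventually_sequentially)
    from \<delta> obtain T0 where T0: "\<And>T. T \<ge> T0 \<Longrightarrow> e T \<le> \<delta>" by (auto simp: \<Delta>_def eventually_at_top_linorder)
    have "\<forall>\<^sub>F T in at_top. \<bar>b T\<bar> < \<epsilon> / 2" using tendsto_rabs_zero[OF b0] \<epsilon> by (intro order_tendstoD) auto
    moreover have "\<forall>\<^sub>F T in at_top. T \<ge> max 1 (\<bar>T0\<bar> * real (Suc N))" by (rule eventually_ge_at_top)
    ultimately have "\<forall>\<^sub>F T in at_top. e T \<le> \<delta> / 2 + \<epsilon>"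
    proof eventually_elim
      case (elim T)
      then have T: "T > 0" by simp
      let ?f = "\<lambda>m. c (Suc m) * e (T / real (Suc (Suc m)))"
      have "(\<Sum>m. ?f m) = (\<Sum>m. ?f (m + N)) + (\<Sum>m<N. ?f m)" by (rule suminf_split_initial_segment[OF sm_e[OF T]])
      also have "(\<Sum>m<N. ?f m) \<le> (\<Sum>m<N. c (Suc m) * \<delta>)"
      proof (intro sum_mono mult_left_mono T0)
        fix m assume "m \<in> {..<N}"
        then have "\<bar>T0\<bar> * real (Suc (Suc m)) \<le> \<bar>T0\<bar> * real (Suc N)" by (intro mult_left_mono) auto
        also have "\<dots> \<le> T" using elim by simp
        finally have "\<bar>T0\<bar> \<le> T / real (Suc (Suc m))" by (simp add: pos_le_divide_eq)
        then show "T0 \<le> T / real (Suc (Suc m))" by simp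
      qed (rule c)
      also have "\<dots> \<le> (\<Sum>m. c (Suc m)) * \<delta>"
        unfolding sum_distrib_right[symmetric] by (intro mult_right_mono sum_le_suminf cS \<delta>0) (auto simp: c)
      also have "\<dots> \<le> 1 / 2 * \<delta>" using c \<delta>0 by (intro mult_right_mono)
      also have "(\<Sum>m. ?f (m + N)) \<le> (\<Sum>m. c (Suc (m + N)) * K')"
      proof (rule suminf_le)
        show "c (Suc (m + N)) * e (T / real (Suc (Suc (m + N)))) \<le> c (Suc (m + N)) * K'" for m
          using c T by (intro mult_left_mono eK) auto
      qed (use summable_ignore_initial_segment[OF sm_e[OF T], of N] summable_ignore_initial_segment[OF cS, of N]
          in \<open>auto intro!: summable_mult2\<close>)
      also have "\<dots> = (\<Sum>m. c (Suc (m + N))) * K'"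
        by (rule suminf_mult2[symmetric]) (use cS in \<open>simp add: summable_iff_shift[of "\<lambda>m. c (Suc m)"]\<close>)
      also have "\<dots> \<le> \<epsilon> / 2" using mult_right_mono[OF less_imp_le[OF N], of K'] K'pos by (simp add: field_simps)
      finally have "(\<Sum>m. ?f m) \<le> \<epsilon> / 2 + \<delta> / 2" by simp
      then show ?case using main[OF T] elim by linarith
    qed
    then show ?thesis using \<delta>0 \<epsilon> by (simp add: \<Delta>_def)
  qed
  have K'\<Delta>: "K' \<in> \<Delta>"
    using K'pos by (auto simp: \<Delta>_def intro!: eventually_mono[OF eventually_gt_at_top[of 0]] eK)
  have bdd: "bdd_below \<Delta>" by (auto simp: \<Delta>_def bdd_below_def)
  define \<delta>0 where "\<delta>0 = Inf \<Delta>"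
  have "\<delta>0 \<ge> 0" unfolding \<delta>0_def using K'\<Delta> by (intro cInf_greatest) (auto simp: \<Delta>_def)
  moreover have "\<not> \<delta>0 > 0"
  proof
    assume pos: "\<delta>0 > 0"
    \<comment> \<open>With \<delta> below 5/4 of the infimum and \<epsilon> equal to 1/8 of it, the
      improved bound is below 3/4 of the infimum.\<close>
    then obtain \<delta> where \<delta>: "\<delta> \<in> \<Delta>" "\<delta> < 5 / 4 * \<delta>0"
      using cInf_lessD[of \<Delta> "5 / 4 * \<delta>0"] K'\<Delta> by (auto simp: \<delta>0_def)
    have "\<delta>0 \<le> \<delta> / 2 + \<delta>0 / 8"
      unfolding \<delta>0_def by (rule cInf_lower[OF _ bdd]) (use step[OF \<delta>(1), of "\<delta>0 / 8"] pos in \<open>simp add: \<delta>0_def\<close>)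
    then show False using \<delta> pos by simp
  qed
  ultimately have zero: "\<delta>0 = 0" by simp
  show ?thesis
  proof (rule tendstoI)
    fix r :: real assume "r > 0"
    then obtain \<delta> where "\<delta> \<in> \<Delta>" "\<delta> < r"
      using cInf_lessD[of \<Delta> r] K'\<Delta> zero by (auto simp: \<delta>0_def)
    then show "\<forall>\<^sub>F T in at_top. dist (a T) l < r"
      by (auto simp: \<Delta>_def dist_real_def e_def elim!: eventually_mono)
  qed
qed

text \<open>By \<open>nn_integral_round_to\<close> the normalised count is the integral of the
  indicator of S at the point rounded to the lattice of g/T. Rounding tends to the identity, so the
  integrand converges off the frontier of S.\<close>

lemma lattice_count_tendsto:
  fixes S :: "(real ^ 'n::finite) set"
  assumes L: "L \<in> unimodular_lattices" and bS: "bounded S" and [measurable]: "S \<in> sets borel"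
    and fr: "negligible (frontier S)"
  shows "((\<lambda>T. real (card {v \<in> L. (1 / T) *\<^sub>R v \<in> S}) / T ^ CARD('n)) \<longlongrightarrow> measure lborel S) at_top"
proof -
  obtain g where g: "g \<in> SL_real" and Lg: "L = lattice_of g" using L by (rule unimodular_latticesE)
  have dg: "det g = 1" using g by (simp add: SL_real_def)
  obtain D where D: "D > 0" "\<And>T x. T > 0 \<Longrightarrow> norm (round_to ((1 / T) *\<^sub>R g) x - x) \<le> D / T"
    using norm_round_to_le[of g] dg by auto
  obtain r where r: "\<And>x. x \<in> S \<Longrightarrow> norm x \<le> r" using bS by (auto simp: bounded_iff)
  let ?s = "\<lambda>T x. indicator S (round_to ((1 / T) *\<^sub>R g) x) :: real"
  have eq: "integral\<^sup>L lborel (?s T) = real (card {v \<in> L. (1 / T) *\<^sub>R v \<in> S}) / T ^ CARD('n)" if T: "T > 0" for T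
  proof -
    have LT: "lattice_act int_vecs ((1 / T) *\<^sub>R g) = (\<lambda>v. (1 / T) *\<^sub>R v) ` L"
      by (auto simp: Lg lattice_of_eq lattice_act_def image_image vector_scaleR_matrix_ac scaleR_vector_matrix_assoc)
    interpret discrete_subgroup L by (rule discrete_subgroup_unimodular[OF L])
    have fin: "finite {v \<in> L. (1 / T) *\<^sub>R v \<in> S}"
    proof (rule finite_subset)
      show "{v \<in> L. (1 / T) *\<^sub>R v \<in> S} \<subseteq> L \<inter> cball 0 (r * T)" using r T by (force simp: field_simps)
    qed (rule finite_bounded, simp)
    have "(\<integral>\<^sup>+x. ennreal (?s T x) \<partial>lborel) = (\<integral>\<^sup>+x. indicator S (round_to ((1 / T) *\<^sub>R g) x) \<partial>lborel)"
      by (intro nn_integral_cong) (simp add: indicator_def)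
    also have "\<dots> = ennreal \<bar>det ((1 / T) *\<^sub>R g)\<bar> * (\<integral>\<^sup>+v. indicator S v \<partial>count_space ((\<lambda>v. (1 / T) *\<^sub>R v) ` L))"
      by (subst nn_integral_round_to) (use T in \<open>auto simp: det_scaleR dg LT\<close>)
    also have "(\<integral>\<^sup>+v. indicator S v \<partial>count_space ((\<lambda>v. (1 / T) *\<^sub>R v) ` L)) = (\<integral>\<^sup>+v. indicator S ((1 / T) *\<^sub>R v) \<partial>count_space L)"
      by (rule nn_integral_bij_count_space[symmetric]) (use T in \<open>auto intro!: inj_on_imp_bij_betw simp: inj_on_def\<close>)
    also have "\<dots> = (\<integral>\<^sup>+v. indicator {v \<in> L. (1 / T) *\<^sub>R v \<in> S} v \<partial>count_space L)"
      by (intro nn_integral_cong) (simp add: indicator_def)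
    also have "\<dots> = ennreal (card {v \<in> L. (1 / T) *\<^sub>R v \<in> S})"
      by (subst nn_integral_indicator) (use fin in \<open>auto simp: emeasure_count_space_finite ennreal_of_nat_eq_real_of_nat\<close>)
    finally have "(\<integral>\<^sup>+x. ennreal (?s T x) \<partial>lborel) = ennreal (real (card {v \<in> L. (1 / T) *\<^sub>R v \<in> S}) / T ^ CARD('n))"
      using T by (simp add: det_scaleR dg power_one_over flip: ennreal_mult)
    then show ?thesis
      using T by (subst integral_eq_nn_integral) auto
  qed
  have "((\<lambda>T. integral\<^sup>L lborel (?s T)) \<longlongrightarrow> integral\<^sup>L lborel (indicator S)) at_top"
  \<comment> \<open>For T >= 1 rounding moves a point by at most D, so all integrands live in one
    ball.\<close>
  proof (rule integral_dominated_convergence_at_top[where w = "indicator (cball 0 (r + D))"])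
    show "AE x in lborel. ((\<lambda>T. ?s T x) \<longlongrightarrow> indicator S x) at_top"
    proof -
      have "AE x in lborel. x \<notin> frontier S"
      proof (rule AE_I')
        show "frontier S \<in> null_sets lborel"
          using fr by (simp add: negligible_iff_null_sets null_sets_completion_iff)
      qed auto
      then show ?thesis
      proof eventually_elim
        fix x assume "x \<notin> frontier S"
        then consider "x \<in> interior S" | "x \<in> - closure S" by (auto simp: frontier_def)
        then have "\<exists>e>0. (ball x e \<subseteq> S \<and> x \<in> S) \<or> (ball x e \<subseteq> - S \<and> x \<notin> S)"
        proof cases
          case 1 then show ?thesis by (metis centre_in_ball mem_interior subsetD)
        next
          case 2
          then obtain e where "e > 0" "ball x e \<subseteq> - closure S" using open_contains_ball[of "- closure S"] by auto
          then show ?thesis using closure_subset[of S] by (metis (no_types, lifting) Compl_subset_Compl_iff ComplD centre_in_ball subset_iff)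
        qed
        then obtain e where e: "e > 0" "(ball x e \<subseteq> S \<and> x \<in> S) \<or> (ball x e \<subseteq> - S \<and> x \<notin> S)" by blast
        have "\<forall>\<^sub>F T in at_top. T > max 1 (D / e)" by (rule eventually_gt_at_top)
        then have "\<forall>\<^sub>F T in at_top. ?s T x = indicator S x"
        proof eventually_elim
          case (elim T)
          then have "D / T < e" using e D by (simp add: field_simps)
          then have "round_to ((1 / T) *\<^sub>R g) x \<in> ball x e"
            using D(2)[of T x] elim by (simp add: dist_norm norm_minus_commute)
          then show ?case using e(2) by (auto simp: indicator_def)
        qed
        then show "((\<lambda>T. ?s T x) \<longlongrightarrow> indicator S x) at_top" by (rule tendsto_eventually)
      qed
    qed
    show "\<forall>\<^sub>F T in at_top. AE x in lborel. norm (?s T x) \<le> indicator (cball 0 (r + D)) x"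
    proof (rule eventually_mono[OF eventually_ge_at_top[of 1]], rule AE_I2)
      fix T :: real and x :: "real ^ 'n" assume T: "1 \<le> T"
      have "norm x \<le> r + D" if "round_to ((1 / T) *\<^sub>R g) x \<in> S"
      proof -
        have "norm x \<le> norm (round_to ((1 / T) *\<^sub>R g) x) + norm (round_to ((1 / T) *\<^sub>R g) x - x)"
          by (metis norm_triangle_sub norm_minus_commute)
        also have "D / T \<le> D" using T D by (simp add: divide_le_eq mult_le_cancel_left1)
        then have "norm (round_to ((1 / T) *\<^sub>R g) x) + norm (round_to ((1 / T) *\<^sub>R g) x - x) \<le> r + D"
          using r[OF that] D(2)[of T x] T by linarith
        finally show ?thesis .
      qed
      then show "norm (?s T x) \<le> indicator (cball 0 (r + D)) x" by (auto simp: indicator_def)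
    qed
    show "integrable lborel (indicator (cball 0 (r + D)) :: real ^ 'n \<Rightarrow> real)"
      by (rule integrable_real_indicator) (use emeasure_bounded_finite[of "cball (0 :: real ^ 'n) (r + D)"] in auto)
  qed auto
  moreover have "integral\<^sup>L lborel (indicator S) = measure lborel S" by simp
  ultimately show ?thesis
    using eq by (auto elim!: Lim_transform_eventually intro!: eventually_mono[OF eventually_gt_at_top[of 0]])
qed

lemma bij_betw_Collect_image:
  assumes "bij_betw h A B"
  shows "bij_betw h {p \<in> A. P (h p)} {v \<in> B. P v}"
proof -
  have "inj_on h {p \<in> A. P (h p)}" using assms by (auto simp: bij_betw_def intro: inj_on_subset)
  moreover have "h ` {p \<in> A. P (h p)} = {v \<in> B. P v}" using assms by (auto simp: bij_betw_def)
  ultimately show ?thesis by (simp add: bij_betw_def)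
qed

text \<open>A nonzero vector is a unique multiple of a primitive one, so the count of nonzero
  vectors at T is the sum of the primitive counts at T/(m+1). After normalisation the weights are
  (m+1)^-n, with sum zeta(n), and the relation is inverted.\<close>

lemma primitive_count_tendsto:
  fixes S :: "(real ^ 'n::finite) set"
  assumes L: "L \<in> unimodular_lattices" and n: "CARD('n) \<ge> 3" and bS: "bounded S" and [measurable]: "S \<in> sets borel"
    and fr: "negligible (frontier S)"
  shows "((\<lambda>T. real (card {w \<in> primitives L. (1 / T) *\<^sub>R w \<in> S}) / T ^ CARD('n))
    \<longlongrightarrow> measure lborel S / zeta (real CARD('n))) at_top"
proof -
  interpret discrete_subgroup L by (rule discrete_subgroup_unimodular[OF L])
  let ?n = "CARD('n)"
  note z = zeta_terms[OF n]
  obtain r where r: "r > 0" "\<And>x. x \<in> S \<Longrightarrow> norm x \<le> r" using bS by (auto simp: bounded_pos)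
  define A where "A t = card {w \<in> primitives L. (1 / t) *\<^sub>R w \<in> S}" for t
  define a where "a t = real (A t) / t ^ ?n" for t
  define c where "c m = 1 / real (Suc m) ^ ?n" for m
  have scale: "(1 / t) *\<^sub>R v \<in> cball 0 \<rho> \<longleftrightarrow> v \<in> cball 0 (t * \<rho>)" if "t > 0" for t \<rho> :: real and v :: "real ^ 'n"
    using that by (simp add: field_simps)
  have rS: "norm x \<le> t * r" if "t > 0" "(1 / t) *\<^sub>R x \<in> S" for t x
    using r(2)[OF that(2)] that(1) by (simp add: field_simps)
  have finL: "finite {v \<in> L. (1 / t) *\<^sub>R v \<in> S}" if "t > 0" for t
  proof (rule finite_subset)
    show "{v \<in> L. (1 / t) *\<^sub>R v \<in> S} \<subseteq> L \<inter> cball 0 (t * r)"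
      using rS that by auto
  qed (rule finite_bounded, simp)
  have nonzero_count: "real (card {v \<in> L - {0}. (1 / T) *\<^sub>R v \<in> S}) / T ^ ?n = (\<Sum>m. c m * a (T / real (Suc m)))"
    if T: "T > 0" for T
  proof -
    let ?h = "\<lambda>(m, w). real (Suc m) *\<^sub>R w"
    define X where "X = {p \<in> UNIV \<times> primitives L. (1 / T) *\<^sub>R ?h p \<in> S}"
    have bij: "bij_betw ?h X {v \<in> L - {0}. (1 / T) *\<^sub>R v \<in> S}"
      unfolding X_def by (rule bij_betw_Collect_image[OF bij_betw_nonzero_vectors])
    have "finite {v \<in> L - {0}. (1 / T) *\<^sub>R v \<in> S}" by (rule finite_subset[OF _ finL[OF T]]) auto
    then have finX: "finite X" using bij_betw_finite[OF bij] by simp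
    \<comment> \<open>For fixed T only finitely many multiples occur, so the series is a finite
      sum.\<close>
    obtain N where "fst ` X \<subseteq> {..<N}" using finite_nat_bounded[OF finite_imageI[OF finX, of fst]] by blast
    then have N: "m < N" if "m \<in> fst ` X" for m using that by blast
    have Xs: "(m, w) \<in> X \<longleftrightarrow> w \<in> primitives L \<and> (1 / (T / real (Suc m))) *\<^sub>R w \<in> S" for m w
      by (simp add: X_def)
    have Xeq: "X = Sigma {..<N} (\<lambda>m. {w \<in> primitives L. (1 / (T / real (Suc m))) *\<^sub>R w \<in> S})"
    proof (rule set_eqI)
      fix p :: "nat \<times> (real ^ 'n)"
      obtain m w where p: "p = (m, w)" by (cases p)
      have "m < N" if "(m, w) \<in> X" by (rule N, rule image_eqI[OF _ that]) simp
      then show "p \<in> X \<longleftrightarrow> p \<in> Sigma {..<N} (\<lambda>m. {w \<in> primitives L. (1 / (T / real (Suc m))) *\<^sub>R w \<in> S})"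
        unfolding p mem_Sigma_iff using Xs[of m w] by blast
    qed
    have zero: "A (T / real (Suc m)) = 0" if "m \<notin> {..<N}" for m
    proof -
      have "{w \<in> primitives L. (1 / (T / real (Suc m))) *\<^sub>R w \<in> S} = {}"
      proof (rule equals0I)
        fix w assume "w \<in> {w \<in> primitives L. (1 / (T / real (Suc m))) *\<^sub>R w \<in> S}"
        then have "(m, w) \<in> X" using Xs[of m w] by blast
        then have "m < N" by (intro N image_eqI[of m fst "(m, w)"]) simp_all
        then show False using that by simp
      qed
      then show ?thesis unfolding A_def by (simp only: card.empty)
    qed
    have "card {v \<in> L - {0}. (1 / T) *\<^sub>R v \<in> S} = card X" using bij_betw_same_card[OF bij] by simp
    also have "\<dots> = (\<Sum>m<N. A (T / real (Suc m)))"
      unfolding Xeq A_def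
    proof (rule card_SigmaI)
      show "\<forall>m\<in>{..<N}. finite {w \<in> primitives L. (1 / (T / real (Suc m))) *\<^sub>R w \<in> S}"
      proof
        fix m
        have "T / real (Suc m) > 0" using T by simp
        from finL[OF this] show "finite {w \<in> primitives L. (1 / (T / real (Suc m))) *\<^sub>R w \<in> S}"
          by (rule finite_subset[rotated]) (use primitives_subset in blast)
      qed
    qed simp
    finally have "real (card {v \<in> L - {0}. (1 / T) *\<^sub>R v \<in> S}) / T ^ ?n = (\<Sum>m<N. real (A (T / real (Suc m))) / T ^ ?n)"
      by (simp add: sum_divide_distrib)
    also have "\<dots> = (\<Sum>m<N. c m * a (T / real (Suc m)))"
      by (intro sum.cong refl) (simp add: c_def a_def power_divide field_simps del: of_nat_Suc)
    also have "\<dots> = (\<Sum>m. c m * a (T / real (Suc m)))"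
    proof (rule suminf_finite[symmetric])
      show "c m * a (T / real (Suc m)) = 0" if "m \<notin> {..<N}" for m unfolding a_def zero[OF that] by simp
    qed simp
    finally show ?thesis .
  qed
  have lim: "((\<lambda>T. \<Sum>m. c m * a (T / real (Suc m))) \<longlongrightarrow> measure lborel S / zeta (real ?n) * (\<Sum>m. c m)) at_top"
  proof -
    have "zeta (real ?n) = (\<Sum>m. c m)" by (simp add: zeta_eq c_def)
    then have lv: "measure lborel S / zeta (real ?n) * (\<Sum>m. c m) = measure lborel S - 0" using z(4) by simp
    have inf: "filterlim (\<lambda>T::real. T ^ ?n) at_top at_top"
      by (rule filterlim_pow_at_top[OF _ filterlim_ident]) auto
    \<comment> \<open>The zero vector contributes at most 1 to the count, which disappears in the
      limit.\<close>
    have "((\<lambda>T. real (card {v \<in> L. (1 / T) *\<^sub>R v \<in> S}) / T ^ ?n - of_bool (0 \<in> S) / T ^ ?n) \<longlongrightarrow>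
       measure lborel S - 0) at_top"
      by (intro tendsto_diff lattice_count_tendsto L bS fr real_tendsto_divide_at_top[OF tendsto_const inf]) simp
    moreover have "\<forall>\<^sub>F T in at_top. real (card {v \<in> L. (1 / T) *\<^sub>R v \<in> S}) / T ^ ?n - of_bool (0 \<in> S) / T ^ ?n =
       (\<Sum>m. c m * a (T / real (Suc m)))"
    proof (rule eventually_mono[OF eventually_gt_at_top[of 0]])
      fix T :: real assume T: "0 < T"
      have "{v \<in> L. (1 / T) *\<^sub>R v \<in> S} = {v \<in> L - {0}. (1 / T) *\<^sub>R v \<in> S} \<union> (if 0 \<in> S then {0} else {})"
        using zero_closed by auto
      moreover have "finite {v \<in> L - {0}. (1 / T) *\<^sub>R v \<in> S}" by (rule finite_subset[OF _ finL[OF T]]) auto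
      ultimately have "card {v \<in> L. (1 / T) *\<^sub>R v \<in> S} = card {v \<in> L - {0}. (1 / T) *\<^sub>R v \<in> S} + of_bool (0 \<in> S)"
        by (cases "0 \<in> S") simp_all
      then show "real (card {v \<in> L. (1 / T) *\<^sub>R v \<in> S}) / T ^ ?n - of_bool (0 \<in> S) / T ^ ?n =
         (\<Sum>m. c m * a (T / real (Suc m)))"
        unfolding nonzero_count[OF T, symmetric] by (simp add: diff_divide_distrib[symmetric])
    qed
    ultimately show ?thesis unfolding lv by (rule Lim_transform_eventually)
  qed
  \<comment> \<open>The bound must cover all T > 0, since the inversion evaluates T/(m+1) for every
    m. Large T is handled by convergence; below \<open>lambda1 L / r\<close> nothing is counted; in
    between a fixed finite set contains all counted vectors.\<close>
  have "\<exists>K. \<forall>T>0. \<bar>a T\<bar> \<le> K"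
  proof -
    define f where "f T = real (card {v \<in> L. (1 / T) *\<^sub>R v \<in> cball 0 r}) / T ^ ?n" for T
    have "(f \<longlongrightarrow> measure lborel (cball (0 :: real ^ 'n) r)) at_top"
      unfolding f_def
      by (rule lattice_count_tendsto[OF L bounded_cball _ negligible_convex_frontier[OF convex_cball]]) simp
    then have "\<forall>\<^sub>F T in at_top. f T < measure lborel (cball (0 :: real ^ 'n) r) + 1"
      by (rule order_tendstoD) simp
    then obtain T0 where T0: "\<And>T. T \<ge> T0 \<Longrightarrow> f T < measure lborel (cball (0 :: real ^ 'n) r) + 1"
      by (auto simp: eventually_at_top_linorder)
    define t1 where "t1 = lambda1 L / r"
    have t1: "t1 > 0" using lambda1_pos r by (simp add: t1_def)
    define K where "K = max (measure lborel (cball (0 :: real ^ 'n) r) + 1) (real (card (L \<inter> cball 0 (T0 * r))) / t1 ^ ?n)"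
    have K: "K \<ge> 0" by (simp add: K_def le_max_iff_disj)
    have af: "a T \<le> f T" if "T > 0" for T
      unfolding a_def f_def A_def
    proof (intro divide_right_mono of_nat_mono card_mono)
      show "finite {v \<in> L. (1 / T) *\<^sub>R v \<in> cball 0 r}"
        by (rule finite_subset[OF _ finite_bounded[of "cball 0 (T * r)"]]) (use scale[OF that] in auto)
      show "{w \<in> primitives L. (1 / T) *\<^sub>R w \<in> S} \<subseteq> {v \<in> L. (1 / T) *\<^sub>R v \<in> cball 0 r}"
      proof
        fix w assume w: "w \<in> {w \<in> primitives L. (1 / T) *\<^sub>R w \<in> S}"
        then show "w \<in> {v \<in> L. (1 / T) *\<^sub>R v \<in> cball 0 r}"
          using primitives_subset r(2)[of "(1 / T) *\<^sub>R w"] by auto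
      qed
    qed (use that in auto)
    have "a T \<le> K" if T: "T > 0" for T
    proof -
      consider "T \<ge> T0" | "T < t1" | "t1 \<le> T" "T < T0" by linarith
      then show ?thesis
      proof cases
        case 1 then show ?thesis using T0[of T] af[OF T] by (simp add: K_def)
      next
        case 2
        have "{w \<in> primitives L. (1 / T) *\<^sub>R w \<in> S} = {}"
        proof (rule ccontr)
          assume "\<not> ?thesis"
          then obtain w where w: "w \<in> primitives L" "(1 / T) *\<^sub>R w \<in> S" by auto
          then have "norm w \<le> T * r" using rS T by auto
          moreover have "lambda1 L \<le> norm w"
            using w lambda1_le[of w] primitive_nonzero[of w] by (auto simp: primitives_def primitive_in_def)
          ultimately show False using 2 r(1) by (simp add: t1_def field_simps)
        qed
        then have "A T = 0" unfolding A_def by (simp only: card.empty)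
        then show ?thesis using K by (simp add: a_def)
      next
        case 3
        have "A T \<le> card (L \<inter> cball 0 (T0 * r))"
          unfolding A_def
        proof (intro card_mono finite_bounded)
          have "T * r \<le> T0 * r" using 3 r by simp
          then show "{w \<in> primitives L. (1 / T) *\<^sub>R w \<in> S} \<subseteq> L \<inter> cball 0 (T0 * r)"
            using primitives_subset rS[OF T] by force
        qed simp
        then have "a T \<le> real (card (L \<inter> cball 0 (T0 * r))) / t1 ^ ?n"
          unfolding a_def using t1 3 T by (intro frac_le power_mono) auto
        then show ?thesis by (simp add: K_def)
      qed
    qed
    then show ?thesis by (intro exI[of _ K]) (auto simp: a_def abs_of_nonneg)
  qed
  then obtain K where K: "\<And>T. T > 0 \<Longrightarrow> \<bar>a T\<bar> \<le> K" by blast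
  have "(a \<longlongrightarrow> measure lborel S / zeta (real ?n)) at_top"
    by (rule tendsto_of_weighted_dilates[of c, OF _ _ _ _ K lim]) (use z(1,2) in \<open>simp_all add: c_def[abs_def]\<close>)
  then show ?thesis by (simp only: a_def[abs_def] A_def)
qed

text \<open>Limits can be added only over finitely many boxes. So the countably many closed boxes
  given by outer measure are enlarged slightly to open ones, and compactness selects a finite
  subfamily.\<close>

lemma count_box_cover:
  fixes C :: "'a::euclidean_space set"
  assumes "compact C" "\<epsilon> > 0"
  obtains \<B> where "finite \<B>" "\<And>B. B \<in> \<B> \<Longrightarrow> \<exists>l u. B = box l u" "C \<subseteq> \<Union>\<B>"
    "(\<Sum>B\<in>\<B>. measure lborel B) \<le> measure lborel C + \<epsilon>"
proof -
  have enlarge: "\<exists>l u. cbox a b \<subseteq> box l u \<and> measure lborel (box l u) \<le> measure lborel (cbox a b) + d"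
    if "cbox a b \<noteq> {}" "d > 0" for a b :: 'a and d
  proof -
    have ab: "\<forall>i\<in>Basis. a \<bullet> i \<le> b \<bullet> i" using that by (simp add: box_ne_empty)
    define f where "f t = (\<Prod>i\<in>Basis. (b - a) \<bullet> i + 2 * t)" for t
    have "(f \<longlongrightarrow> f 0) (at_right 0)" unfolding f_def by (intro tendsto_intros)
    then have "\<forall>\<^sub>F t in at_right 0. f t < f 0 + d" using that(2) by (intro order_tendstoD) auto
    moreover have "\<forall>\<^sub>F t in at_right 0. t > (0::real)" by (rule eventually_at_right_less)
    ultimately have "\<forall>\<^sub>F t in at_right 0. f t < f 0 + d \<and> t > 0" by (rule eventually_conj)
    then obtain t where t: "f t < f 0 + d" "t > 0"
      by (metis (no_types, lifting) eventually_happens trivial_limit_at_right_real)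
    let ?l = "a - t *\<^sub>R One" and ?u = "b + t *\<^sub>R One"
    have le: "\<forall>i\<in>Basis. ?l \<bullet> i \<le> ?u \<bullet> i" using ab t by (auto simp: inner_simps)
    have "measure lborel (box ?l ?u) = f t"
      using le unfolding f_def measure_lborel_box_eq by (auto simp: inner_simps intro!: prod.cong)
    moreover have "measure lborel (cbox a b) = f 0"
      using ab unfolding f_def measure_lborel_cbox_eq by (auto simp: inner_simps)
    moreover have "cbox a b \<subseteq> box ?l ?u" using t by (fastforce simp: mem_box inner_simps)
    ultimately show ?thesis using t by (intro exI[of _ ?l] exI[of _ ?u]) auto
  qed
  obtain a b where ab: "C \<subseteq> cbox a b" using compact_imp_bounded[OF assms(1)] bounded_subset_cbox_symmetric by blast
  obtain \<D> where \<D>: "countable \<D>" "\<And>K. K \<in> \<D> \<Longrightarrow> K \<subseteq> cbox a b \<and> K \<noteq> {} \<and> (\<exists>c d. K = cbox c d)"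
        "pairwise (\<lambda>A B. interior A \<inter> interior B = {}) \<D>"
        "C \<subseteq> \<Union>\<D>" "\<Union>\<D> \<in> lmeasurable" "measure lebesgue (\<Union>\<D>) \<le> measure lebesgue C + \<epsilon> / 2"
    using measurable_outer_intervals_bounded[OF lmeasurable_compact[OF assms(1)] ab, of "\<epsilon> / 2"] assms(2)
    by (metis half_gt_zero)
  \<comment> \<open>The enlargements may cost \<epsilon>/2 in total, hence geometric weights along
    an enumeration of the boxes.\<close>
  define w where "w K = \<epsilon> / 2 * (1 / 2) ^ Suc (to_nat_on \<D> K)" for K
  have wpos: "w K > 0" for K using assms(2) by (simp add: w_def)
  have "\<forall>K\<in>\<D>. \<exists>B. (\<exists>l u. B = box l u) \<and> K \<subseteq> B \<and> measure lborel B \<le> measure lborel K + w K"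
    using \<D>(2) enlarge wpos by (metis (no_types, opaque_lifting))
  then obtain e where e: "\<And>K. K \<in> \<D> \<Longrightarrow> (\<exists>l u. e K = box l u) \<and> K \<subseteq> e K \<and> measure lborel (e K) \<le> measure lborel K + w K"
    by metis
  have "C \<subseteq> (\<Union>K\<in>\<D>. e K)" using \<D>(4) e by blast
  moreover have "open (e K)" if "K \<in> \<D>" for K using e[OF that] open_box by metis
  ultimately obtain \<D>' where \<D>': "\<D>' \<subseteq> \<D>" "finite \<D>'" "C \<subseteq> (\<Union>K\<in>\<D>'. e K)"
    using compactE_image[OF assms(1)] by metis
  have "(\<Sum>B\<in>e ` \<D>'. measure lborel B) \<le> (\<Sum>K\<in>\<D>'. measure lborel (e K))"
    by (rule sum_image_le[unfolded comp_def]) (use \<D>' in auto)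
  also have "\<dots> \<le> (\<Sum>K\<in>\<D>'. measure lborel K + w K)" using \<D>' e by (intro sum_mono) auto
  also have "\<dots> = (\<Sum>K\<in>\<D>'. measure lebesgue K) + (\<Sum>K\<in>\<D>'. w K)"
  proof -
    have "measure lborel K = measure lebesgue K" if "K \<in> \<D>'" for K
      using \<D>(2)[of K] \<D>'(1) that measure_lebesgue_compact compact_cbox by (metis subsetD)
    then show ?thesis by (simp add: sum.distrib)
  qed
  also have "(\<Sum>K\<in>\<D>'. measure lebesgue K) = measure lebesgue (\<Union>\<D>')"
  proof (rule measure_negligible_finite_Union[OF \<D>'(2), symmetric])
    show "K \<in> lmeasurable" if "K \<in> \<D>'" for K using \<D>(2)[of K] \<D>' that by auto
    \<comment> \<open>Boxes with disjoint interiors meet only in their frontiers, which are null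
      sets.\<close>
    show "pairwise (\<lambda>A B. negligible (A \<inter> B)) \<D>'"
    proof (rule pairwiseI)
      fix A B assume AB: "A \<in> \<D>'" "B \<in> \<D>'" "A \<noteq> B"
      then have "interior A \<inter> interior B = {}" using \<D>(3) \<D>'(1) by (auto simp: pairwise_def)
      then have "A \<inter> B \<subseteq> frontier A \<union> frontier B"
        using closure_subset[of A] closure_subset[of B] unfolding frontier_def by blast
      moreover have "negligible (frontier A)" "negligible (frontier B)"
        using \<D>(2)[of A] \<D>(2)[of B] \<D>'(1) AB by (metis convex_box(1) negligible_convex_frontier subsetD)+
      ultimately show "negligible (A \<inter> B)" using negligible_Un negligible_subset by blast
    qed
  qed
  also have "\<dots> \<le> measure lebesgue (\<Union>\<D>)"
  proof (rule measure_mono_fmeasurable)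
    show "\<Union>\<D>' \<in> sets lebesgue"
    proof (rule sets.finite_Union[OF \<D>'(2)], rule subsetI)
      fix K assume "K \<in> \<D>'"
      then obtain c d where "K = cbox c d" using \<D>(2) \<D>'(1) by blast
      then show "K \<in> sets lebesgue" by simp
    qed
  qed (use \<D>' \<D> in auto)
  also have "\<dots> \<le> measure lebesgue C + \<epsilon> / 2" by (rule \<D>(6))
  also have "(\<Sum>K\<in>\<D>'. w K) \<le> \<epsilon> / 2"
  proof -
    have inj: "inj_on (to_nat_on \<D>) \<D>'" using inj_on_to_nat_on[OF \<D>(1)] \<D>'(1) inj_on_subset by blast
    have "(\<Sum>K\<in>\<D>'. w K) = \<epsilon> / 2 * (\<Sum>m\<in>to_nat_on \<D> ` \<D>'. (1 / 2) ^ Suc m)"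
      by (simp add: w_def sum_distrib_left sum.reindex[OF inj])
    also have "(\<Sum>m\<in>to_nat_on \<D> ` \<D>'. (1 / 2) ^ Suc m) \<le> (\<Sum>m. (1 / 2 :: real) ^ Suc m)"
      by (rule sum_le_suminf) (use \<D>'(2) power_half_series sums_summable in auto)
    also have "\<dots> = 1" using power_half_series sums_unique by metis
    finally show ?thesis using assms(2) by simp
  qed
  finally have "(\<Sum>B\<in>e ` \<D>'. measure lborel B) \<le> measure lebesgue C + \<epsilon>" by simp
  moreover have "measure lebesgue C = measure lborel C" by (rule measure_lebesgue_compact[OF assms(1)])
  ultimately show ?thesis
    using that[of "e ` \<D>'"] \<D>' e by (metis (no_types, lifting) finite_imageI imageE subsetD)
qed

lemma measure_lebesgue_borel: "S \<in> sets borel \<Longrightarrow> measure lebesgue S = measure lborel S"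
  by (rule measure_completion) simp

text \<open>Finite box covers bound the count on compact sets from above. For S the upper bound
  comes from its closure; the lower bound comes from the remainder of a large box, because the count
  for the whole box is known.\<close>

lemma count_tendsto_from_boxes:
  fixes X S :: "'a::euclidean_space set"
  assumes fin: "\<And>T B. T > 0 \<Longrightarrow> bounded B \<Longrightarrow> finite {x \<in> X. (1 / T) *\<^sub>R x \<in> B}"
    and box: "\<And>l u. ((\<lambda>T. real (card {x \<in> X. (1 / T) *\<^sub>R x \<in> box l u}) / T ^ d) \<longlongrightarrow> K * measure lborel (box l u)) at_top"
    and K: "K \<ge> 0"
    and S: "bounded S" "S \<in> sets borel" "negligible (frontier S)"
  shows "((\<lambda>T. real (card {x \<in> X. (1 / T) *\<^sub>R x \<in> S}) / T ^ d) \<longlongrightarrow> K * measure lborel S) at_top"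
proof -
  define N where "N T B = real (card {x \<in> X. (1 / T) *\<^sub>R x \<in> B}) / T ^ d" for T B
  have mono: "N T A \<le> N T B" if "T > 0" "A \<subseteq> B" "bounded B" for T A B
    unfolding N_def using that fin[of T B] by (intro divide_right_mono of_nat_mono card_mono) auto
  have upper: "\<forall>\<^sub>F T in at_top. N T C \<le> K * measure lborel C + \<epsilon>" if C: "compact C" and \<epsilon>: "\<epsilon> > 0" for C \<epsilon>
  proof -
    obtain \<B> where \<B>: "finite \<B>" "\<And>B. B \<in> \<B> \<Longrightarrow> \<exists>l u. B = box l u" "C \<subseteq> \<Union>\<B>"
      "(\<Sum>B\<in>\<B>. measure lborel B) \<le> measure lborel C + \<epsilon> / (2 * (K + 1))"
      using count_box_cover[OF C, of "\<epsilon> / (2 * (K + 1))"] \<epsilon> K by auto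
    have "((\<lambda>T. N T B) \<longlongrightarrow> K * measure lborel B) at_top" if "B \<in> \<B>" for B
      using \<B>(2)[OF that] box unfolding N_def by auto
    then have "((\<lambda>T. \<Sum>B\<in>\<B>. N T B) \<longlongrightarrow> (\<Sum>B\<in>\<B>. K * measure lborel B)) at_top" by (rule tendsto_sum)
    then have "\<forall>\<^sub>F T in at_top. (\<Sum>B\<in>\<B>. N T B) < (\<Sum>B\<in>\<B>. K * measure lborel B) + \<epsilon> / 2"
      using \<epsilon> by (intro order_tendstoD) auto
    then show ?thesis
    proof (rule eventually_elim2[OF _ eventually_gt_at_top[of 0]])
      fix T :: real assume *: "(\<Sum>B\<in>\<B>. N T B) < (\<Sum>B\<in>\<B>. K * measure lborel B) + \<epsilon> / 2" and T: "0 < T"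
      have finB: "finite {x \<in> X. (1 / T) *\<^sub>R x \<in> B}" if "B \<in> \<B>" for B
        using \<B>(2)[OF that] fin[OF T] by auto
      have "{x \<in> X. (1 / T) *\<^sub>R x \<in> C} \<subseteq> (\<Union>B\<in>\<B>. {x \<in> X. (1 / T) *\<^sub>R x \<in> B})" using \<B>(3) by auto
      then have "card {x \<in> X. (1 / T) *\<^sub>R x \<in> C} \<le> card (\<Union>B\<in>\<B>. {x \<in> X. (1 / T) *\<^sub>R x \<in> B})"
        using finB \<B>(1) by (intro card_mono) auto
      also have "\<dots> \<le> (\<Sum>B\<in>\<B>. card {x \<in> X. (1 / T) *\<^sub>R x \<in> B})" by (rule card_UN_le[OF \<B>(1)])
      finally have "real (card {x \<in> X. (1 / T) *\<^sub>R x \<in> C}) \<le> (\<Sum>B\<in>\<B>. real (card {x \<in> X. (1 / T) *\<^sub>R x \<in> B}))"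
        by (simp flip: of_nat_sum)
      then have "N T C \<le> (\<Sum>B\<in>\<B>. N T B)"
        unfolding N_def sum_divide_distrib[symmetric] using T by (intro divide_right_mono) auto
      also have "\<dots> \<le> K * (\<Sum>B\<in>\<B>. measure lborel B) + \<epsilon> / 2" using * by (simp add: sum_distrib_left)
      also have "\<dots> \<le> K * (measure lborel C + \<epsilon> / (2 * (K + 1))) + \<epsilon> / 2"
        using \<B>(4) K by (intro add_right_mono mult_left_mono)
      also have "\<dots> \<le> K * measure lborel C + \<epsilon>"
      proof -
        have "K * (\<epsilon> / (2 * (K + 1))) \<le> \<epsilon> / 2" using K \<epsilon> by (simp add: field_simps)
        then show ?thesis unfolding distrib_left by linarith
      qed
      finally show "N T C \<le> K * measure lborel C + \<epsilon>" .
    qed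
  qed
  have clS: "closure S \<in> sets borel" "interior S \<in> sets borel" by auto
  have eqm: "measure lborel (closure S) = measure lborel S"
  proof -
    have "measure lebesgue (closure S) = measure lebesgue S"
      using S(3) by (metis closure_Un_frontier measure_Un_null_set S(2) sets_completionI_sets negligible_iff_null_sets sets_lborel)
    then show ?thesis using measure_lebesgue_borel S(2) clS by metis
  qed
  obtain l u where lu: "closure S \<subseteq> box l u"
    using bounded_subset_box_symmetric[OF bounded_closure[OF S(1)]] by blast
  \<comment> \<open>Removing the interior rather than S keeps this set compact; together with S it
    still covers the box.\<close>
  let ?C = "cbox l u - interior S"
  have C: "compact ?C" by (rule compact_diff) auto
  have Cm: "measure lborel ?C = measure lborel (box l u) - measure lborel S"
  proof -
    have sub: "interior S \<subseteq> cbox l u" using interior_subset closure_subset lu box_subset_cbox by blast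
    have "measure lborel ?C = measure lborel (cbox l u) - measure lborel (interior S)"
      by (rule measure_Diff) (use sub emeasure_lborel_cbox_finite in \<open>auto simp: less_top\<close>)
    also have "measure lborel (interior S) = measure lborel (closure S)"
    proof -
      have "closure S = interior S \<union> frontier S" using interior_subset closure_subset by (auto simp: frontier_def)
      then have "measure lebesgue (closure S) = measure lebesgue (interior S)"
        using S(3) by (metis measure_Un_null_set clS(2) sets_completionI_sets negligible_iff_null_sets sets_lborel)
      then show ?thesis using measure_lebesgue_borel clS by metis
    qed
    also have "measure lborel (cbox l u) = measure lborel (box l u)"
      by (simp add: measure_lborel_cbox_eq measure_lborel_box_eq)
    finally show ?thesis by (simp add: eqm)
  qed
  show ?thesis
    unfolding N_def[symmetric]
  proof (rule tendstoI)
    fix \<epsilon> :: real assume \<epsilon>: "\<epsilon> > 0"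
    have "\<forall>\<^sub>F T in at_top. N T (closure S) \<le> K * measure lborel (closure S) + \<epsilon> / 4"
      using upper[of "closure S" "\<epsilon> / 4"] S(1) \<epsilon> by simp
    moreover have "\<forall>\<^sub>F T in at_top. N T ?C \<le> K * measure lborel ?C + \<epsilon> / 4"
      using upper[OF C, of "\<epsilon> / 4"] \<epsilon> by simp
    moreover have "\<forall>\<^sub>F T in at_top. N T (box l u) > K * measure lborel (box l u) - \<epsilon> / 4"
      using box \<epsilon> unfolding N_def by (intro order_tendstoD) auto
    ultimately show "\<forall>\<^sub>F T in at_top. dist (N T S) (K * measure lborel S) < \<epsilon>"
      using eventually_gt_at_top[of 0]
    proof eventually_elim
      case (elim T)
      have 1: "N T S \<le> N T (closure S)" using elim S(1) closure_subset by (intro mono) auto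
      have "{x \<in> X. (1 / T) *\<^sub>R x \<in> box l u} \<subseteq> {x \<in> X. (1 / T) *\<^sub>R x \<in> S} \<union> {x \<in> X. (1 / T) *\<^sub>R x \<in> ?C}"
        using box_subset_cbox interior_subset[of S] by blast
      then have "card {x \<in> X. (1 / T) *\<^sub>R x \<in> box l u} \<le> card ({x \<in> X. (1 / T) *\<^sub>R x \<in> S} \<union> {x \<in> X. (1 / T) *\<^sub>R x \<in> ?C})"
        by (intro card_mono finite_UnI fin elim(4) S(1) compact_imp_bounded[OF C])
      also have "\<dots> \<le> card {x \<in> X. (1 / T) *\<^sub>R x \<in> S} + card {x \<in> X. (1 / T) *\<^sub>R x \<in> ?C}" by (rule card_Un_le)
      finally have "N T (box l u) \<le> N T S + N T ?C"
        unfolding N_def add_divide_distrib[symmetric] using elim by (intro divide_right_mono) (auto simp flip: of_nat_add)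
      then show ?case using 1 elim Cm eqm by (simp add: dist_real_def abs_less_iff right_diff_distrib)
    qed
  qed
qed

section \<open>Siegel transforms and their averages\<close>

definition primitive_tuples :: "(real ^ 'n::finite) set \<Rightarrow> (real ^ 'n ^ 'k::finite) set" where
  "primitive_tuples L = {x. \<forall>a. x $ a \<in> primitives L}"

lemma vec_set_bij: "bij_betw vec_lambda (PiE UNIV A) {x :: 'a ^ 'k::finite. \<forall>a. x $ a \<in> A a}"
  by (rule bij_betwI[where g = vec_nth]) (auto simp: vec_lambda_inverse)

lemma finite_vec_set: "(\<And>a. finite (A a)) \<Longrightarrow> finite {x :: 'a ^ 'k::finite. \<forall>a. x $ a \<in> A a}"
  using bij_betw_finite[OF vec_set_bij[of A]] by (simp add: finite_PiE)

lemma card_vec_set: "card {x :: 'a ^ 'k::finite. \<forall>a. x $ a \<in> A a} = (\<Prod>a\<in>UNIV. card (A a))"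
  using bij_betw_same_card[OF vec_set_bij[of A]] by (simp add: card_PiE)

lemma mem_box_vec: "x \<in> box l u \<longleftrightarrow> (\<forall>a. x $ a \<in> box (l $ a) (u $ a))" for x :: "('a::euclidean_space) ^ 'k::finite"
  by (auto simp: mem_box Basis_vec_def inner_axis)

lemma mem_cbox_vec: "x \<in> cbox l u \<longleftrightarrow> (\<forall>a. x $ a \<in> cbox (l $ a) (u $ a))" for x :: "('a::euclidean_space) ^ 'k::finite"
  by (auto simp: mem_box Basis_vec_def inner_axis)

lemma measure_box_vec: "measure lborel (box l u) = (\<Prod>a\<in>UNIV. measure lborel (box (l $ a) (u $ a)))"
  for l :: "('a::euclidean_space) ^ 'k::finite"
proof (cases "\<forall>b\<in>Basis. l \<bullet> b \<le> u \<bullet> b")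
  case True
  have B: "(Basis :: ('a ^ 'k) set) = (\<lambda>(a, b). axis a b) ` (UNIV \<times> Basis)" by (auto simp: Basis_vec_def)
  have inj: "inj_on (\<lambda>(a, b). axis a b :: 'a ^ 'k) (UNIV \<times> Basis)"
    by (auto simp: inj_on_def axis_eq_axis)
  have "measure lborel (box l u) = (\<Prod>b\<in>Basis. (u - l) \<bullet> b)" using True by (simp add: measure_lborel_box_eq)
  also have "\<dots> = (\<Prod>(a, b)\<in>UNIV \<times> Basis. (u $ a - l $ a) \<bullet> b)"
    unfolding B prod.reindex[OF inj] by (intro prod.cong) (auto simp: inner_axis)
  also have "\<dots> = (\<Prod>a\<in>UNIV. \<Prod>b\<in>Basis. (u $ a - l $ a) \<bullet> b)"
    by (rule prod.cartesian_product[symmetric])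
  also have "\<dots> = (\<Prod>a\<in>UNIV. measure lborel (box (l $ a) (u $ a)))"
  proof (rule prod.cong[OF refl])
    fix a
    have "\<forall>b\<in>Basis. l $ a \<bullet> b \<le> u $ a \<bullet> b" using True by (auto simp: Basis_vec_def inner_axis)
    then show "(\<Prod>b\<in>Basis. (u $ a - l $ a) \<bullet> b) = measure lborel (box (l $ a) (u $ a))"
      by (simp add: measure_lborel_box_eq)
  qed
  finally show ?thesis .
next
  case False
  then obtain a b where ab: "b \<in> Basis" "\<not> l $ a \<bullet> b \<le> u $ a \<bullet> b" by (auto simp: Basis_vec_def inner_axis)
  then have "measure lborel (box (l $ a) (u $ a)) = 0" by (auto simp: measure_lborel_box_eq)
  then have "(\<Prod>a\<in>UNIV. measure lborel (box (l $ a) (u $ a))) = 0" by (intro prod_zero) auto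
  moreover have "measure lborel (box l u) = 0" unfolding measure_lborel_box_eq using False by (rule if_not_P)
  ultimately show ?thesis by simp
qed

lemma bounded_vec_components: "bounded B \<Longrightarrow> bounded ((\<lambda>x. x $ a) ` B)" for B :: "('a::euclidean_space ^ 'k::finite) set"
  by (rule bounded_linear_image) (auto simp: bounded_linear_vec_nth)

lemma (in discrete_subgroup) finite_primitive_tuples:
  fixes B :: "(real ^ 'n ^ 'k::finite) set"
  assumes "T > 0" "bounded B"
  shows "finite {x \<in> primitive_tuples L. (1 / T) *\<^sub>R x \<in> B}"
proof (rule finite_subset)
  have "bounded ((\<lambda>x. T *\<^sub>R x) ` B)" using assms by (intro bounded_scaling)
  note bd = bounded_vec_components[OF this]
  show "{x \<in> primitive_tuples L. (1 / T) *\<^sub>R x \<in> B} \<subseteq> {x. \<forall>a. x $ a \<in> L \<inter> (\<lambda>x. x $ a) ` (\<lambda>x. T *\<^sub>R x) ` B}"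
  proof (intro subsetI CollectI allI)
    fix x a assume x: "x \<in> {x \<in> primitive_tuples L. (1 / T) *\<^sub>R x \<in> B}"
    have "x = T *\<^sub>R ((1 / T) *\<^sub>R x)" using assms by simp
    then have "x \<in> (\<lambda>x. T *\<^sub>R x) ` B" using x by blast
    then show "x $ a \<in> L \<inter> (\<lambda>x. x $ a) ` (\<lambda>x. T *\<^sub>R x) ` B"
      using x primitives_subset by (auto simp: primitive_tuples_def)
  qed
  show "finite {x. \<forall>a. x $ a \<in> L \<inter> (\<lambda>x. x $ a) ` (\<lambda>x. T *\<^sub>R x) ` B}"
    by (intro finite_vec_set finite_bounded bd)
qed

text \<open>A box of tuples is a product of boxes, so both count and volume factor over the entries;
  boxes then determine the limit for general S.\<close>

lemma primitive_tuples_count_tendsto: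
  fixes S :: "(real ^ 'n::finite ^ 'k::finite) set"
  assumes L: "L \<in> unimodular_lattices" and n: "CARD('n) \<ge> 3" and S: "bounded S" "S \<in> sets borel" "negligible (frontier S)"
  shows "((\<lambda>T. real (card {x \<in> primitive_tuples L. (1 / T) *\<^sub>R x \<in> S}) / T ^ (CARD('n) * CARD('k)))
    \<longlongrightarrow> measure lborel S / zeta (real CARD('n)) ^ CARD('k)) at_top"
proof -
  interpret discrete_subgroup L by (rule discrete_subgroup_unimodular[OF L])
  let ?z = "zeta (real CARD('n))"
  have zpos: "?z > 0" using zeta_terms(4)[OF n] by simp
  have "((\<lambda>T. real (card {x \<in> primitive_tuples L. (1 / T) *\<^sub>R x \<in> S}) / T ^ (CARD('n) * CARD('k)))
    \<longlongrightarrow> (1 / ?z ^ CARD('k)) * measure lborel S) at_top"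
  proof (rule count_tendsto_from_boxes)
    fix l u :: "real ^ 'n ^ 'k"
    have "((\<lambda>T. \<Prod>a\<in>UNIV. real (card {w \<in> primitives L. (1 / T) *\<^sub>R w \<in> box (l $ a) (u $ a)}) / T ^ CARD('n)) \<longlongrightarrow>
       (\<Prod>a\<in>UNIV. measure lborel (box (l $ a) (u $ a)) / ?z)) at_top"
      by (intro tendsto_prod primitive_count_tendsto L n) (auto simp: negligible_convex_frontier)
    moreover have "(\<Prod>a\<in>UNIV. measure lborel (box (l $ a) (u $ a)) / ?z) = 1 / ?z ^ CARD('k) * measure lborel (box l u)"
      by (simp add: measure_box_vec prod_dividef)
    moreover have "(\<Prod>a\<in>UNIV. real (card {w \<in> primitives L. (1 / T) *\<^sub>R w \<in> box (l $ a) (u $ a)}) / T ^ CARD('n)) =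
       real (card {x \<in> primitive_tuples L. (1 / T) *\<^sub>R x \<in> box l u}) / T ^ (CARD('n) * CARD('k))" for T
    proof -
      have "{x \<in> primitive_tuples L. (1 / T) *\<^sub>R x \<in> box l u} =
        {x. \<forall>a. x $ a \<in> {w \<in> primitives L. (1 / T) *\<^sub>R w \<in> box (l $ a) (u $ a)}}"
        by (auto simp: primitive_tuples_def mem_box_vec)
      then have "card {x \<in> primitive_tuples L. (1 / T) *\<^sub>R x \<in> box l u} =
        (\<Prod>a\<in>UNIV. card {w \<in> primitives L. (1 / T) *\<^sub>R w \<in> box (l $ a) (u $ a)})"
        by (simp only: card_vec_set)
      then show ?thesis by (simp add: prod_dividef power_mult)
    qed
    ultimately show "((\<lambda>T. real (card {x \<in> primitive_tuples L. (1 / T) *\<^sub>R x \<in> box l u}) / T ^ (CARD('n) * CARD('k)))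
       \<longlongrightarrow> 1 / ?z ^ CARD('k) * measure lborel (box l u)) at_top" by simp
  qed (use S finite_primitive_tuples zpos in auto)
  then show ?thesis by simp
qed

section \<open>The Siegel transform: action of matrices and measurability\<close>

definition tuple_act :: "real ^ 'n ^ 'k \<Rightarrow> real ^ 'n::finite ^ 'n \<Rightarrow> real ^ 'n ^ 'k::finite" where
  "tuple_act x g = (\<chi> a. x $ a v* g)"

text \<open>Values in \<open>ennreal\<close> make the transform total, without summability
  conditions on f.\<close>

definition siegel :: "(real ^ 'n ^ 'k \<Rightarrow> ennreal) \<Rightarrow> (real ^ 'n::finite) set \<Rightarrow> ennreal" where
  "siegel f L = (\<integral>\<^sup>+x. f x \<partial>count_space (primitive_tuples L :: (real ^ 'n ^ 'k::finite) set))"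

lemma primitive_tuples_act:
  fixes g :: "real ^ 'n::finite ^ 'n"
  assumes "det g \<noteq> 0"
  shows "bij_betw (\<lambda>x. tuple_act x g) (primitive_tuples L) (primitive_tuples (lattice_act L g) :: (real ^ 'n ^ 'k::finite) set)"
proof (rule bij_betw_imageI)
  show "inj_on (\<lambda>x. tuple_act x g) (primitive_tuples L :: (real ^ 'n ^ 'k) set)"
  proof (rule inj_onI)
    fix x y :: "real ^ 'n ^ 'k" assume eq: "tuple_act x g = tuple_act y g"
    have "x $ a v* g = y $ a v* g" for a using arg_cong[OF eq, of "\<lambda>z. z $ a"] by (simp add: tuple_act_def)
    then have "x $ a = y $ a" for a using injD[OF inj_vector_matrix[OF assms]] by blast
    then show "x = y" by (simp add: vec_eq_iff)
  qed
  show "(\<lambda>x. tuple_act x g) ` primitive_tuples L = (primitive_tuples (lattice_act L g) :: (real ^ 'n ^ 'k) set)"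
  proof (intro equalityI subsetI)
    fix y :: "real ^ 'n ^ 'k" assume "y \<in> primitive_tuples (lattice_act L g)"
    then have "\<forall>a. \<exists>v \<in> primitives L. y $ a = v v* g" by (auto simp: primitive_tuples_def primitives_act[OF assms])
    then obtain v where v: "\<And>a. v a \<in> primitives L" "\<And>a. y $ a = v a v* g" by metis
    then have "y = tuple_act (\<chi> a. v a) g" "(\<chi> a. v a) \<in> primitive_tuples L"
      by (simp_all add: tuple_act_def vec_eq_iff primitive_tuples_def)
    then show "y \<in> (\<lambda>x. tuple_act x g) ` primitive_tuples L" by blast
  qed (auto simp: primitive_tuples_def tuple_act_def primitives_act[OF assms])
qed

lemma siegel_act:
  fixes g :: "real ^ 'n::finite ^ 'n"
  assumes "g \<in> SL_real"
  shows "siegel f (lattice_act L g) = siegel (\<lambda>x. f (tuple_act x g)) L"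
  unfolding siegel_def
  by (rule nn_integral_bij_count_space[symmetric, OF primitive_tuples_act]) (use assms in \<open>simp add: SL_real_def\<close>)

lemma space_lattice_borel [simp]: "space lattice_borel = unimodular_lattices"
  unfolding lattice_borel_def by (rule space_measure_of) auto

lemma open_in_lattice_borel:
  assumes "A \<subseteq> unimodular_lattices" "openin (top_of_set SL_real) {g \<in> SL_real. lattice_of g \<in> A}"
  shows "A \<in> sets lattice_borel"
  unfolding lattice_borel_def using assms by (subst sets_measure_of) auto

lemma continuous_on_tuple_act: "continuous_on UNIV (\<lambda>g. tuple_act x g)"
  unfolding tuple_act_def by (intro continuous_intros)

text \<open>Writes a cardinality, possibly infinite, as a countable supremum over the events that at
  least N points are present. Only these events are accessible topologically.\<close>

lemma finite_card_emeasure_count_space: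
  "emeasure (count_space P) (P \<inter> U) = (SUP N. of_nat N * indicator {N. \<exists>F \<subseteq> P \<inter> U. finite F \<and> card F = N} (N::nat))"
proof (cases "finite (P \<inter> U)")
  case True
  have "(SUP N. of_nat N * indicator {N. \<exists>F \<subseteq> P \<inter> U. finite F \<and> card F = N} (N::nat)) = (of_nat (card (P \<inter> U)) :: ennreal)"
  proof (rule SUP_eqI)
    fix N :: nat
    have "N \<le> card (P \<inter> U)" if "F \<subseteq> P \<inter> U" "card F = N" for F using card_mono[OF True that(1)] that by simp
    then show "of_nat N * indicator {N. \<exists>F \<subseteq> P \<inter> U. finite F \<and> card F = N} N \<le> (of_nat (card (P \<inter> U)) :: ennreal)"
      by (auto simp: indicator_def)
  next
    fix y :: ennreal
    assume "\<And>N. N \<in> UNIV \<Longrightarrow> of_nat N * indicator {N. \<exists>F \<subseteq> P \<inter> U. finite F \<and> card F = N} (N::nat) \<le> y"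
    moreover have "card (P \<inter> U) \<in> {N. \<exists>F \<subseteq> P \<inter> U. finite F \<and> card F = N}" using True by blast
    ultimately show "of_nat (card (P \<inter> U)) \<le> y"
      by (metis (no_types, lifting) UNIV_I indicator_simps(1) mult_1_right)
  qed
  then show ?thesis using True by (simp add: emeasure_count_space_finite)
next
  case False
  have "indicator {N. \<exists>F \<subseteq> P \<inter> U. finite F \<and> card F = N} N = (1 :: ennreal)" for N
    using infinite_arbitrarily_large[OF False, of N] by (auto simp: indicator_def)
  then show ?thesis using False by (simp add: emeasure_count_space_infinite ennreal_SUP_of_nat_eq_top)
qed

lemma siegel_indicator: "siegel (indicator C) L = emeasure (count_space (primitive_tuples L)) (primitive_tuples L \<inter> C)"
proof -
  have "siegel (indicator C) L = (\<integral>\<^sup>+x. indicator (primitive_tuples L \<inter> C) x \<partial>count_space (primitive_tuples L))"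
    unfolding siegel_def by (intro nn_integral_cong) (auto simp: indicator_def)
  then show ?thesis by simp
qed

text \<open>Finitely many tuples in an open set stay in it under a small change of g, so having at
  least N primitive tuples there is an open condition on g.\<close>

lemma siegel_indicator_open_measurable:
  fixes U :: "(real ^ 'n::finite ^ 'k::finite) set"
  assumes "open U"
  shows "siegel (indicator U) \<in> borel_measurable lattice_borel"
proof -
  define A where "A N = {L \<in> unimodular_lattices. \<exists>F \<subseteq> primitive_tuples L \<inter> U. finite F \<and> card F = N}" for N
  have "A N \<in> sets lattice_borel" for N
  proof (rule open_in_lattice_borel)
    define \<F> where "\<F> = {F. F \<subseteq> (primitive_tuples int_vecs :: (real ^ 'n ^ 'k) set) \<and> finite F \<and> card F = N}"
    have "{g \<in> SL_real. lattice_of g \<in> A N} = SL_real \<inter> (\<Union>F\<in>\<F>. \<Inter>x\<in>F. {g. tuple_act x g \<in> U})"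
    proof (rule set_eqI)
      fix g :: "real ^ 'n ^ 'n"
      show "g \<in> {g \<in> SL_real. lattice_of g \<in> A N} \<longleftrightarrow> g \<in> SL_real \<inter> (\<Union>F\<in>\<F>. \<Inter>x\<in>F. {g. tuple_act x g \<in> U})"
      proof (cases "g \<in> SL_real")
        case True
        have "det g \<noteq> 0" using True by (simp add: SL_real_def)
        note bij = primitive_tuples_act[OF this, of int_vecs, where 'k = 'k, folded lattice_of_eq]
        have "lattice_of g \<in> A N \<longleftrightarrow> (\<exists>F \<subseteq> primitive_tuples (lattice_of g) \<inter> U. finite F \<and> card F = N)"
          using True by (auto simp: A_def unimodular_lattices_def)
        also have "\<dots> \<longleftrightarrow> (\<exists>F \<in> \<F>. \<forall>x\<in>F. tuple_act x g \<in> U)"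
        proof
          assume "\<exists>F \<subseteq> primitive_tuples (lattice_of g) \<inter> U. finite F \<and> card F = N"
          then obtain F where F: "F \<subseteq> primitive_tuples (lattice_of g) \<inter> U" "finite F" "card F = N" by blast
          then obtain F' where F': "F' \<subseteq> primitive_tuples int_vecs" "F = (\<lambda>x. tuple_act x g) ` F'"
            using subset_imageE[of F "\<lambda>x. tuple_act x g" "primitive_tuples int_vecs"] bij_betw_imp_surj_on[OF bij] by auto
          have inj: "inj_on (\<lambda>x. tuple_act x g) F'" using bij F' by (meson bij_betw_imp_inj_on inj_on_subset)
          then have "F' \<in> \<F>" using F F' card_image[OF inj] finite_imageD[OF _ inj] by (auto simp: \<F>_def)
          then show "\<exists>F \<in> \<F>. \<forall>x\<in>F. tuple_act x g \<in> U" using F F' by (intro bexI[of _ F']) auto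
        next
          assume "\<exists>F \<in> \<F>. \<forall>x\<in>F. tuple_act x g \<in> U"
          then obtain F where F: "F \<in> \<F>" "\<forall>x\<in>F. tuple_act x g \<in> U" by blast
          have inj: "inj_on (\<lambda>x. tuple_act x g) F" using bij F by (auto simp: \<F>_def intro: inj_on_subset bij_betw_imp_inj_on)
          show "\<exists>F \<subseteq> primitive_tuples (lattice_of g) \<inter> U. finite F \<and> card F = N"
            using F bij_betw_imp_surj_on[OF bij] card_image[OF inj]
            by (intro exI[of _ "(\<lambda>x. tuple_act x g) ` F"]) (auto simp: \<F>_def)
        qed
        finally show ?thesis using True by auto
      qed auto
    qed
    moreover have "open (\<Union>F\<in>\<F>. \<Inter>x\<in>F. {g. tuple_act x g \<in> U})"
    proof (intro open_UN ballI open_INT)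
      show "open {g. tuple_act x g \<in> U}" for x
        using open_vimage[OF assms continuous_on_tuple_act[of x]] by (simp add: vimage_def)
    qed (auto simp: \<F>_def)
    ultimately show "openin (top_of_set SL_real) {g \<in> SL_real. lattice_of g \<in> A N}"
      by (simp add: openin_open_Int)
  qed (auto simp: A_def)
  then have "(\<lambda>L. SUP N. of_nat N * indicator (A N) L :: ennreal) \<in> borel_measurable lattice_borel" by measurable
  moreover have "siegel (indicator U) L = (SUP N. of_nat N * indicator (A N) L)" if "L \<in> space lattice_borel" for L
    using that unfolding siegel_indicator finite_card_emeasure_count_space
    by (intro SUP_cong refl arg_cong2[where f = "(*)"]) (auto simp: A_def indicator_def)
  ultimately show ?thesis by (subst measurable_cong) auto
qed

lemma siegel_add:
  "siegel (\<lambda>x. f x + g x) L = siegel f L + siegel g L"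
  unfolding siegel_def by (rule nn_integral_add) auto

lemma siegel_suminf:
  "siegel (\<lambda>x. \<Sum>i. f i x) L = (\<Sum>i. siegel (f i) L)"
  unfolding siegel_def by (rule nn_integral_suminf) auto

lemma siegel_mono: "(\<And>x. f x \<le> g x) \<Longrightarrow> siegel f L \<le> siegel g L"
  unfolding siegel_def by (rule nn_integral_mono)

lemma siegel_SUP: "incseq F \<Longrightarrow> siegel (\<lambda>x. SUP i. F i x) L = (SUP i. siegel (F i) L)"
  unfolding siegel_def by (rule nn_integral_monotone_convergence_SUP) auto

lemma siegel_bounded_finite:
  assumes "L \<in> unimodular_lattices" "bounded B"
  shows "siegel (indicator B) L < \<infinity>"
proof -
  interpret discrete_subgroup L by (rule discrete_subgroup_unimodular[OF assms(1)])
  have "primitive_tuples L \<inter> B = {x \<in> primitive_tuples L. (1 / 1) *\<^sub>R x \<in> B}" by auto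
  then have "finite (primitive_tuples L \<inter> B)" using finite_primitive_tuples[of 1, OF _ assms(2)] by simp
  then show ?thesis unfolding siegel_indicator by (simp add: emeasure_count_space_finite of_nat_less_top)
qed

text \<open>Dynkin's lemma leads from open to Borel sets. Its complement step subtracts, so it is
  carried out inside a ball, where the transform is finite; monotone limits then remove the ball and
  pass from indicators to f.\<close>

lemma siegel_measurable [measurable]:
  fixes f :: "real ^ 'n::finite ^ 'k::finite \<Rightarrow> ennreal"
  assumes "f \<in> borel_measurable borel"
  shows "siegel f \<in> borel_measurable lattice_borel"
proof -
  have ball: "siegel (indicator (C \<inter> ball 0 r)) \<in> borel_measurable lattice_borel"
    if "C \<in> sets borel" for C :: "(real ^ 'n ^ 'k) set" and r
  proof -
    have "Int_stable {S :: (real ^ 'n ^ 'k) set. open S}" "{S :: (real ^ 'n ^ 'k) set. open S} \<subseteq> Pow UNIV"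
      by (auto simp: Int_stable_def)
    moreover have "C \<in> sigma_sets UNIV {S. open S}" using that by (simp add: borel_def)
    ultimately show ?thesis
    proof (induction rule: sigma_sets_induct_disjoint)
      case (basic A)
      then show ?case by (intro siegel_indicator_open_measurable) auto
    next
      case empty
      then show ?case by (simp add: siegel_def[abs_def])
    next
      case (compl A)
      have "siegel (indicator ((UNIV - A) \<inter> ball 0 r)) L =
        siegel (indicator (ball (0 :: real ^ 'n ^ 'k) r)) L - siegel (indicator (A \<inter> ball 0 r)) L" if "L \<in> space lattice_borel" for L
      proof -
        have "siegel (indicator (ball (0 :: real ^ 'n ^ 'k) r)) L =
          siegel (\<lambda>x. indicator ((UNIV - A) \<inter> ball 0 r) x + indicator (A \<inter> ball 0 r) x) L"
          by (rule arg_cong[where f = "\<lambda>h. siegel h L"]) (auto simp: indicator_def fun_eq_iff)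
        also have "\<dots> = siegel (indicator ((UNIV - A) \<inter> ball 0 r)) L + siegel (indicator (A \<inter> ball 0 r)) L"
          by (rule siegel_add)
        finally show ?thesis
          using siegel_bounded_finite[of L "A \<inter> ball 0 r"] that by (simp add: less_top bounded_Int)
      qed
      moreover have "(\<lambda>L. siegel (indicator (ball 0 r :: (real ^ 'n ^ 'k) set)) L - siegel (indicator (A \<inter> ball 0 r)) L) \<in> borel_measurable lattice_borel"
        using compl siegel_indicator_open_measurable[of "ball 0 r :: (real ^ 'n ^ 'k) set"] by measurable
      ultimately show ?case by (subst measurable_cong) auto
    next
      case (union A)
      have "siegel (indicator ((\<Union>i. A i) \<inter> ball 0 r)) L = (\<Sum>i. siegel (indicator (A i \<inter> ball 0 r)) L)" for L
      proof -
        have "disjoint_family (\<lambda>i. A i \<inter> ball 0 r)" using union(1) by (auto simp: disjoint_family_on_def)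
        from suminf_indicator[OF this]
        have "indicator ((\<Union>i. A i) \<inter> ball 0 r) = (\<lambda>x. \<Sum>i. indicator (A i \<inter> ball 0 r) x :: ennreal)"
          by (simp add: fun_eq_iff)
        then show ?thesis by (simp only: siegel_suminf)
      qed
      moreover have "(\<lambda>L. \<Sum>i. siegel (indicator (A i \<inter> ball 0 r)) L) \<in> borel_measurable lattice_borel"
        using union by measurable
      ultimately show ?case by simp
    qed
  qed
  show ?thesis
    using assms
  proof (induction rule: borel_measurable_induct)
    case (cong f g)
    then have "f = g" by auto
    then show ?case using cong by simp
  next
    case (set C)
    have "siegel (indicator C) L = (SUP r. siegel (indicator (C \<inter> ball 0 (real r))) L)" for L
    proof -
      have "indicator C x = (SUP r. indicator (C \<inter> ball 0 (real r)) x :: ennreal)" for x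
      proof (rule SUP_eqI[symmetric])
        show "indicator (C \<inter> ball 0 (real i)) x \<le> (indicator C x :: ennreal)" for i by (auto simp: indicator_def)
        fix y :: ennreal assume y: "\<And>i. i \<in> UNIV \<Longrightarrow> indicator (C \<inter> ball 0 (real i)) x \<le> y"
        obtain r where "norm x < real r" using reals_Archimedean2 by blast
        then show "indicator C x \<le> y" using y[of r] by (auto simp: indicator_def split: if_splits)
      qed
      then have "indicator C = (\<lambda>x. SUP r. indicator (C \<inter> ball 0 (real r)) x :: ennreal)" by (rule ext)
      then have "siegel (indicator C) L = siegel (\<lambda>x. SUP r. indicator (C \<inter> ball 0 (real r)) x) L" by (rule arg_cong)
      also have "\<dots> = (SUP r. siegel (indicator (C \<inter> ball 0 (real r))) L)"
        by (rule siegel_SUP) (auto simp: incseq_def le_fun_def indicator_def)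
      finally show ?thesis .
    qed
    then show ?case using ball[OF set] by simp
  next
    case (mult u c)
    have "siegel (\<lambda>x. c * u x) = (\<lambda>L. c * siegel u L)"
      by (auto simp: siegel_def fun_eq_iff intro!: nn_integral_cmult)
    then show ?case using mult by simp
  next
    case (add u v)
    then show ?case by (simp add: siegel_add[abs_def])
  next
    case (seq U)
    have "siegel (SUP i. U i) L = (SUP i. siegel (U i) L)" for L
      using siegel_SUP[OF seq(3), of L] by (simp add: SUP_apply[abs_def] image_comp)
    then have "siegel (SUP i. U i) = (\<lambda>L. SUP i. siegel (U i) L)" by (rule ext)
    moreover have "(\<lambda>L. SUP i. siegel (U i) L) \<in> borel_measurable lattice_borel" using seq by measurable
    ultimately show ?case by (simp only:)
  qed
qed

section \<open>Invariance of the measure under the action\<close>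

lemma lattice_act_measurable:
  fixes g :: "real ^ 'n::finite ^ 'n"
  assumes g: "g \<in> SL_real"
  shows "(\<lambda>L. lattice_act L g) \<in> measurable lattice_borel lattice_borel"
  unfolding lattice_borel_def[where 'n = 'n]
proof (rule measurable_measure_of, fold lattice_borel_def)
  show "(\<lambda>L. lattice_act L g) \<in> space lattice_borel \<rightarrow> unimodular_lattices"
    using unimodular_lattice_act[OF _ g] by simp
  fix A :: "(real ^ 'n) set set" assume A: "A \<in> {A. A \<subseteq> unimodular_lattices \<and> openin (top_of_set SL_real) {g \<in> SL_real. lattice_of g \<in> A}}"
  show "(\<lambda>L. lattice_act L g) -` A \<inter> space lattice_borel \<in> sets lattice_borel"
  proof (rule open_in_lattice_borel)
    have "openin (top_of_set SL_real) (SL_real \<inter> (\<lambda>h. h ** g) -` {g \<in> SL_real. lattice_of g \<in> A})"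
    proof (rule continuous_openin_preimage[OF _ _])
      show "continuous_on SL_real (\<lambda>h. h ** g)"
        unfolding matrix_matrix_mult_def by (intro continuous_intros)
      show "(\<lambda>h. h ** g) \<in> SL_real \<rightarrow> SL_real" using g SL_real_mult by auto
    qed (use A in auto)
    moreover have "SL_real \<inter> (\<lambda>h. h ** g) -` {g \<in> SL_real. lattice_of g \<in> A} =
      {h \<in> SL_real. lattice_of h \<in> (\<lambda>L. lattice_act L g) -` A \<inter> space lattice_borel}"
      using g SL_real_mult by (auto simp: lattice_of_eq lattice_act_act unimodular_lattices_def)
    ultimately show "openin (top_of_set SL_real) {h \<in> SL_real. lattice_of h \<in> (\<lambda>L. lattice_act L g) -` A \<inter> space lattice_borel}"
      by simp
  qed auto
qed auto

lemma invariant_space: "invariant_lattice_measure \<mu> \<Longrightarrow> space \<mu> = unimodular_lattices"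
  using sets_eq_imp_space_eq[of \<mu> lattice_borel] by (simp add: invariant_lattice_measure_def)

text \<open>Invariance is defined through images, a push-forward through preimages; the preimage
  under g is the image under its inverse.\<close>

lemma invariant_distr:
  fixes g :: "real ^ 'n::finite ^ 'n"
  assumes mu: "invariant_lattice_measure \<mu>" and g: "g \<in> SL_real"
  shows "distr \<mu> \<mu> (\<lambda>L. lattice_act L g) = \<mu>"
proof (rule measure_eqI)
  have sets: "sets \<mu> = sets lattice_borel" and sp: "space \<mu> = unimodular_lattices"
    using mu invariant_space by (auto simp: invariant_lattice_measure_def)
  have meas: "(\<lambda>L. lattice_act L g) \<in> measurable \<mu> \<mu>"
    using lattice_act_measurable[OF g] by (simp cong: measurable_cong_sets add: sets)
  fix A assume "A \<in> sets (distr \<mu> \<mu> (\<lambda>L. lattice_act L g))"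
  then have A: "A \<in> sets \<mu>" by simp
  note i = SL_real_inv[OF g]
  have "(\<lambda>L. lattice_act L g) -` A \<inter> space \<mu> = (\<lambda>L. lattice_act L (matrix_inv g)) ` A"
  proof (intro equalityI subsetI)
    fix L assume L: "L \<in> (\<lambda>L. lattice_act L g) -` A \<inter> space \<mu>"
    then have "L = lattice_act (lattice_act L g) (matrix_inv g)" by (simp add: lattice_act_act i)
    then show "L \<in> (\<lambda>L. lattice_act L (matrix_inv g)) ` A" using L by blast
  next
    fix L assume "L \<in> (\<lambda>L. lattice_act L (matrix_inv g)) ` A"
    then show "L \<in> (\<lambda>L. lattice_act L g) -` A \<inter> space \<mu>"
      using sets.sets_into_space[OF A] sp i unimodular_lattice_act[of _ "matrix_inv g"] by (auto simp: lattice_act_act)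
  qed
  then show "emeasure (distr \<mu> \<mu> (\<lambda>L. lattice_act L g)) A = emeasure \<mu> A"
    using mu i(1) A by (simp add: emeasure_distr[OF meas] invariant_lattice_measure_def)
qed simp

lemma nn_integral_invariant:
  assumes mu: "invariant_lattice_measure \<mu>" and g: "g \<in> SL_real" and f: "f \<in> borel_measurable \<mu>"
  shows "(\<integral>\<^sup>+L. f (lattice_act L g) \<partial>\<mu>) = (\<integral>\<^sup>+L. f L \<partial>\<mu>)"
proof -
  have "sets \<mu> = sets lattice_borel" using mu by (simp add: invariant_lattice_measure_def)
  then have "(\<lambda>L. lattice_act L g) \<in> measurable \<mu> \<mu>"
    using lattice_act_measurable[OF g] by (simp cong: measurable_cong_sets)
  then show ?thesis
    using nn_integral_distr[of "\<lambda>L. lattice_act L g" \<mu> \<mu> f] invariant_distr[OF mu g] f by simp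
qed

text \<open>Upper bound: truncation at \<open>M\<close> commutes with averaging up to an inequality, so bounded
  convergence applies although \<open>Y\<close> is not known to be integrable in advance.\<close>

lemma (in prob_space) nn_integral_eq_limit_of_averages:
  fixes Y :: "'a \<Rightarrow> ennreal" and \<phi> :: "nat \<Rightarrow> 'i \<Rightarrow> 'a \<Rightarrow> 'a"
  assumes Y [measurable]: "Y \<in> borel_measurable M"
    and I: "\<And>D. finite (I D)" "\<And>D. I D \<noteq> {}"
    and \<phi> [measurable]: "\<And>D i. i \<in> I D \<Longrightarrow> \<phi> D i \<in> measurable M M"
    and inv: "\<And>D i f. i \<in> I D \<Longrightarrow> f \<in> borel_measurable M \<Longrightarrow> (\<integral>\<^sup>+x. f (\<phi> D i x) \<partial>M) = (\<integral>\<^sup>+x. f x \<partial>M)"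
    and lim: "\<And>x. x \<in> space M \<Longrightarrow> (\<lambda>D. (\<Sum>i\<in>I D. Y (\<phi> D i x)) / of_nat (card (I D))) \<longlonglongrightarrow> c"
  shows "(\<integral>\<^sup>+x. Y x \<partial>M) = c"
proof (rule antisym)
  define Z where "Z D x = (\<Sum>i\<in>I D. Y (\<phi> D i x)) / of_nat (card (I D))" for D x
  have card0: "card (I D) \<noteq> 0" for D using I[of D] by simp
  have Z [measurable]: "Z D \<in> borel_measurable M" for D
    unfolding Z_def by (intro borel_measurable_divide_ennreal borel_measurable_sum) (auto intro: measurable_compose[OF \<phi> Y])
  have avg: "(\<integral>\<^sup>+x. (\<Sum>i\<in>I D. f (\<phi> D i x)) / of_nat (card (I D)) \<partial>M) = (\<integral>\<^sup>+x. f x \<partial>M)"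
    if f: "f \<in> borel_measurable M" for f D
  proof -
    have m: "(\<lambda>x. f (\<phi> D i x)) \<in> borel_measurable M" if "i \<in> I D" for i by (rule measurable_compose[OF \<phi>[OF that] f])
    have "(\<integral>\<^sup>+x. (\<Sum>i\<in>I D. f (\<phi> D i x)) / of_nat (card (I D)) \<partial>M) = (\<integral>\<^sup>+x. (\<Sum>i\<in>I D. f (\<phi> D i x)) \<partial>M) / of_nat (card (I D))"
      by (rule nn_integral_divide) (intro borel_measurable_sum m)
    also have "(\<integral>\<^sup>+x. (\<Sum>i\<in>I D. f (\<phi> D i x)) \<partial>M) = (\<Sum>i\<in>I D. \<integral>\<^sup>+x. f (\<phi> D i x) \<partial>M)"
      by (rule nn_integral_sum) (rule m)
    also have "\<dots> = of_nat (card (I D)) * (\<integral>\<^sup>+x. f x \<partial>M)" by (simp add: inv[OF _ f])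
    also have "\<dots> / of_nat (card (I D)) = (\<integral>\<^sup>+x. f x \<partial>M)"
      using card0[of D] by (simp add: ennreal_mult_divide_eq mult.commute)
    finally show ?thesis .
  qed
  \<comment> \<open>Lower bound: Fatou's lemma for the averages, which all have the same integral as
    \<open>Y\<close> and converge to c pointwise.\<close>
  have "c = (\<integral>\<^sup>+x. liminf (\<lambda>D. Z D x) \<partial>M)"
  proof -
    have "liminf (\<lambda>D. Z D x) = c" if "x \<in> space M" for x
      using lim[OF that] lim_imp_Liminf[OF sequentially_bot] by (auto simp: Z_def)
    then have "(\<integral>\<^sup>+x. liminf (\<lambda>D. Z D x) \<partial>M) = (\<integral>\<^sup>+x. c \<partial>M)" by (intro nn_integral_cong) auto
    then show ?thesis by (simp add: emeasure_space_1)
  qed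
  also have "\<dots> \<le> liminf (\<lambda>D. \<integral>\<^sup>+x. Z D x \<partial>M)" by (rule nn_integral_liminf) measurable
  also have "(\<lambda>D. \<integral>\<^sup>+x. Z D x \<partial>M) = (\<lambda>D. \<integral>\<^sup>+x. Y x \<partial>M)" unfolding Z_def using avg[OF Y] by simp
  finally show "c \<le> (\<integral>\<^sup>+x. Y x \<partial>M)" by (simp add: Liminf_const)
  have trunc: "(\<integral>\<^sup>+x. min (Y x) (of_nat m) \<partial>M) \<le> c" for m :: nat
  proof -
    have "(\<integral>\<^sup>+x. min (Y x) (of_nat m) \<partial>M) \<le> (\<integral>\<^sup>+x. min (Z D x) (of_nat m) \<partial>M)" for D
    proof -
      have "(\<integral>\<^sup>+x. min (Y x) (of_nat m) \<partial>M) =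
        (\<integral>\<^sup>+x. (\<Sum>i\<in>I D. min (Y (\<phi> D i x)) (of_nat m)) / of_nat (card (I D)) \<partial>M)"
        using avg[of "\<lambda>x. min (Y x) (of_nat m)" D] by simp
      also have "\<dots> \<le> (\<integral>\<^sup>+x. min (Z D x) (of_nat m) \<partial>M)"
      proof (rule nn_integral_mono, rule min.boundedI)
        fix x
        show "(\<Sum>i\<in>I D. min (Y (\<phi> D i x)) (of_nat m)) / of_nat (card (I D)) \<le> Z D x"
          unfolding Z_def by (intro divide_right_mono_ennreal sum_mono) simp
        have "(\<Sum>i\<in>I D. min (Y (\<phi> D i x)) (of_nat m)) / of_nat (card (I D)) \<le> (\<Sum>i\<in>I D. of_nat m) / of_nat (card (I D))"
          by (intro divide_right_mono_ennreal sum_mono) simp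
        also have "\<dots> = of_nat m"
          using card0[of D] by (simp add: ennreal_mult_divide_eq mult.commute)
        finally show "(\<Sum>i\<in>I D. min (Y (\<phi> D i x)) (of_nat m)) / of_nat (card (I D)) \<le> of_nat m" .
      qed
      finally show ?thesis .
    qed
    moreover have "(\<lambda>D. \<integral>\<^sup>+x. min (Z D x) (of_nat m) \<partial>M) \<longlonglongrightarrow> (\<integral>\<^sup>+x. min c (of_nat m) \<partial>M)"
    proof (rule nn_integral_dominated_convergence[where w = "\<lambda>_. of_nat m"])
      show "AE x in M. (\<lambda>D. min (Z D x) (of_nat m)) \<longlonglongrightarrow> min c (of_nat m)"
      proof (rule AE_I2)
        fix x assume "x \<in> space M"
        then have "(\<lambda>D. Z D x) \<longlonglongrightarrow> c" using lim by (simp add: Z_def)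
        then show "(\<lambda>D. min (Z D x) (of_nat m)) \<longlonglongrightarrow> min c (of_nat m)" by (intro tendsto_min tendsto_const)
      qed
    qed (auto simp: emeasure_space_1 of_nat_less_top)
    ultimately have "(\<integral>\<^sup>+x. min (Y x) (of_nat m) \<partial>M) \<le> (\<integral>\<^sup>+x. min c (of_nat m) \<partial>M)"
      by (intro LIMSEQ_le_const) auto
    then show ?thesis by (simp add: emeasure_space_1)
  qed
  have sup: "Y x = (SUP m. min (Y x) (of_nat m))" for x
  proof (cases "Y x = \<top>")
    case True
    then show ?thesis by (simp add: ennreal_SUP_of_nat_eq_top)
  next
    case False
    then obtain m :: nat where "Y x < of_nat m" using ennreal_Ex_less_of_nat[of "Y x"] by (auto simp: less_top)
    then have "Y x = min (Y x) (of_nat m)" by simp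
    then show ?thesis by (intro antisym SUP_least) (metis SUP_upper UNIV_I, simp)
  qed
  have "(\<integral>\<^sup>+x. Y x \<partial>M) = (\<integral>\<^sup>+x. (SUP m. min (Y x) (of_nat m)) \<partial>M)" by (rule nn_integral_cong) (rule sup)
  also have "\<dots> = (SUP m. \<integral>\<^sup>+x. min (Y x) (of_nat m) \<partial>M)"
    by (rule nn_integral_monotone_convergence_SUP) (auto simp: incseq_def le_fun_def min_def intro: order_trans)
  also have "\<dots> \<le> c" by (rule SUP_least) (rule trunc)
  finally show "(\<integral>\<^sup>+x. Y x \<partial>M) \<le> c" .
qed

section \<open>The mean value formula\<close>

lemma matrix_add_rdistrib: "(A + B) ** C = A ** C + B ** C" for A B :: "real ^ 'm::finite ^ 'n::finite"
  by (simp add: matrix_matrix_mult_def vec_eq_iff sum.distrib distrib_right)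

lemma matrix_diff_ldistrib: "A ** (B - C) = A ** B - A ** C" for A :: "real ^ 'm::finite ^ 'n::finite"
  by (simp add: matrix_matrix_mult_def vec_eq_iff sum_subtractf right_diff_distrib)

text \<open>The sign change of the rows and columns in \<open>R\<close> conjugates \<open>1 + N\<close> to \<open>1 - N\<close>, and
  \<open>(1 + N)(1 - N) = 1\<close>; hence the determinant is \<open>\<plusminus>1\<close>, and it is the square of that of \<open>1 + N / 2\<close>.\<close>

lemma det_one_plus_nilpotent:
  fixes N :: "real ^ 'n::finite ^ 'n"
  assumes N: "\<And>i j. \<not> (i \<in> R \<and> j \<notin> R) \<Longrightarrow> N $ i $ j = 0"
  shows "det (mat 1 + N) = 1"
proof -
  have sq: "(det (mat 1 + N'))\<^sup>2 = 1" if N': "\<And>i j. \<not> (i \<in> R \<and> j \<notin> R) \<Longrightarrow> N' $ i $ j = 0" for N' :: "real ^ 'n ^ 'n"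
  proof -
    define \<sigma> :: "real ^ 'n ^ 'n" where "\<sigma> = (\<chi> i j. if i = j then (if i \<in> R then -1 else 1) else 0)"
    have zero: "N' ** N' = 0"
    proof -
      have "N' $ i $ m * N' $ m $ j = 0" for i j m using N'[of i m] N'[of m j] by (cases "m \<in> R") auto
      then have "(\<Sum>m\<in>UNIV. N' $ i $ m * N' $ m $ j) = 0" for i j by (intro sum.neutral) blast
      then show ?thesis by (simp only: matrix_matrix_mult_def vec_eq_iff vec_lambda_beta zero_index) simp
    qed
    have "(mat 1 + N') ** (mat 1 - N') = mat 1 - N' ** N'"
      by (simp add: matrix_add_ldistrib matrix_add_rdistrib matrix_diff_ldistrib algebra_simps)
    then have 1: "det (mat 1 + N') * det (mat 1 - N') = 1" by (simp add: zero flip: det_mul)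
    have l: "(\<sigma> ** A) $ i $ j = (if i \<in> R then -1 else 1) * A $ i $ j"
      and r: "(A ** \<sigma>) $ i $ j = A $ i $ j * (if j \<in> R then -1 else 1)" for A :: "real ^ 'n ^ 'n" and i j
      by (simp_all add: matrix_matrix_mult_def \<sigma>_def if_distrib[of "\<lambda>x. x * _"] if_distrib[of "\<lambda>x. _ * x"] sum.delta cong: if_cong)
    have "\<sigma> ** (mat 1 + N') ** \<sigma> = mat 1 - N'"
      using N' by (auto simp: vec_eq_iff l r mat_def)
    moreover have "(\<sigma> ** \<sigma>) $ i $ j = mat 1 $ i $ j" for i j unfolding l by (simp add: \<sigma>_def mat_def)
    then have "\<sigma> ** \<sigma> = mat 1" by (simp add: vec_eq_iff)
    then have "det \<sigma> * det \<sigma> = 1" by (metis det_mul det_I)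
    ultimately have "det (mat 1 - N') = det (mat 1 + N')"
      by (metis (no_types, lifting) det_mul mult.assoc mult.commute mult.right_neutral)
    then show ?thesis using 1 by (simp add: power2_eq_square)
  qed
  define N2 where "N2 = (1 / 2 :: real) *\<^sub>R N"
  have N2: "N2 $ i $ j = 0" if "\<not> (i \<in> R \<and> j \<notin> R)" for i j using N[OF that] by (simp add: N2_def)
  have "N2 $ i $ m * N2 $ m $ j = 0" for i j m using N2[of i m] N2[of m j] by (cases "m \<in> R") auto
  then have "(\<Sum>m\<in>UNIV. N2 $ i $ m * N2 $ m $ j) = 0" for i j by (intro sum.neutral) blast
  then have "N2 ** N2 = 0" by (simp only: matrix_matrix_mult_def vec_eq_iff vec_lambda_beta zero_index) simp
  then have "(mat 1 + N2) ** (mat 1 + N2) = mat 1 + (N2 + N2)"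
    by (simp add: matrix_add_ldistrib matrix_add_rdistrib)
  also have "N2 + N2 = N" by (simp add: N2_def flip: scaleR_left_distrib)
  finally have "det (mat 1 + N) = (det (mat 1 + N2))\<^sup>2" by (simp add: power2_eq_square flip: det_mul)
  then show ?thesis using sq[OF N2] by simp
qed

section \<open>Coordinates of regular tuples and the tiling of dilated cells\<close>

definition half_open :: "real ^ 'n ^ 'k \<Rightarrow> real ^ 'n ^ 'k \<Rightarrow> (real ^ 'n::finite ^ 'k::finite) set" where
  "half_open l u = {z. \<forall>a j. l $ a $ j \<le> z $ a $ j \<and> z $ a $ j < u $ a $ j}"

text \<open>\<iota> selects the columns of the invertible block B. The strict inequality leaves
  columns to be translated and lets the dilation factor tend to infinity.\<close>

locale column_minor =
  fixes \<iota> :: "'k::finite \<Rightarrow> 'n::finite"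
  assumes inj: "inj \<iota>" and less: "CARD('k) < CARD('n)"
begin

definition minor :: "real ^ 'n ^ 'k \<Rightarrow> real ^ 'k ^ 'k" where
  "minor x = (\<chi> a b. x $ a $ \<iota> b)"

definition regular :: "(real ^ 'n ^ 'k) set" where
  "regular = {x. det (minor x) \<noteq> 0}"

text \<open>By Cramer's rule, the columns of \<open>coords x\<close> outside the range of \<open>\<iota>\<close> are those of \<open>B\<^sup>-\<^sup>1 x\<close>, where
  \<open>B = minor x\<close>. In these coordinates a unipotent column operation is a translation.\<close>

definition coords :: "real ^ 'n ^ 'k \<Rightarrow> real ^ 'n ^ 'k" where
  "coords x = (\<chi> a j. if j \<in> range \<iota> then x $ a $ j
     else det (\<chi> c b. if b = a then x $ c $ j else x $ c $ \<iota> b) / det (minor x))"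

text \<open>Inverse to \<open>coords\<close> on \<open>regular\<close>, but polynomial, hence
  continuous and differentiable everywhere.\<close>

definition of_coords :: "real ^ 'n ^ 'k \<Rightarrow> real ^ 'n ^ 'k" where
  "of_coords z = (\<chi> a j. if j \<in> range \<iota> then z $ a $ j else (\<Sum>b\<in>UNIV. z $ a $ \<iota> b * z $ b $ j))"

text \<open>The box is half-open so that it can be subdivided exactly, without overlaps, and so that
  intersections of cells are cells.\<close>

definition cell :: "real ^ 'n ^ 'k \<Rightarrow> real ^ 'n ^ 'k \<Rightarrow> (real ^ 'n ^ 'k) set" where
  "cell l u = {x \<in> regular. coords x \<in> half_open l u}"

lemma minor_of_coords [simp]: "minor (of_coords z) = minor z"
  by (simp add: minor_def of_coords_def vec_eq_iff)

lemma minor_coords [simp]: "minor (coords x) = minor x"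
  by (simp add: minor_def coords_def vec_eq_iff)

lemma coords_regular [simp]: "coords x \<in> regular \<longleftrightarrow> x \<in> regular"
  by (simp add: regular_def)

lemma of_coords_regular [simp]: "of_coords x \<in> regular \<longleftrightarrow> x \<in> regular"
  by (simp add: regular_def)

lemma cramer_coords:
  assumes "x \<in> regular" "j \<notin> range \<iota>"
  shows "minor x *v z = (\<chi> a. x $ a $ j) \<longleftrightarrow> (\<forall>a. z $ a = coords x $ a $ j)"
  using assms cramer[of "minor x" z "\<chi> a. x $ a $ j"]
  by (simp add: regular_def coords_def minor_def vec_eq_iff cong: if_cong)

lemma sum_coords:
  assumes "x \<in> regular" "j \<notin> range \<iota>"
  shows "(\<Sum>b\<in>UNIV. x $ a $ \<iota> b * coords x $ b $ j) = x $ a $ j"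
proof -
  have "minor x *v (\<chi> a. coords x $ a $ j) = (\<chi> a. x $ a $ j)" using cramer_coords[OF assms] by simp
  then have "(minor x *v (\<chi> a. coords x $ a $ j)) $ a = x $ a $ j" by simp
  then show ?thesis by (simp add: matrix_vector_mult_def minor_def)
qed

lemma of_coords_coords: "x \<in> regular \<Longrightarrow> of_coords (coords x) = x"
  using sum_coords[of x] by (auto simp: of_coords_def vec_eq_iff) (simp_all add: coords_def)

lemma coords_of_coords:
  assumes "z \<in> regular"
  shows "coords (of_coords z) = z"
proof -
  have "coords (of_coords z) $ a $ j = z $ a $ j" for a j
  proof (cases "j \<in> range \<iota>")
    case True
    then show ?thesis by (simp add: coords_def of_coords_def)
  next
    case False
    have "minor (of_coords z) *v (\<chi> a. z $ a $ j) = (\<chi> a. of_coords z $ a $ j)"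
      using False by (simp add: matrix_vector_mult_def of_coords_def minor_def vec_eq_iff)
    then show ?thesis using cramer_coords[of "of_coords z" j] False assms by simp
  qed
  then show ?thesis by (simp add: vec_eq_iff)
qed

lemma continuous_on_det: "continuous_on S f \<Longrightarrow> continuous_on S (\<lambda>x. det (f x :: real ^ 'k ^ 'k))"
  unfolding det_def by (intro continuous_intros)

lemma continuous_on_minor: "continuous_on S minor"
  unfolding minor_def[abs_def] by (intro continuous_intros)

lemma open_regular: "open regular"
proof -
  have "open ((\<lambda>x. det (minor x)) -` (- {0}))"
    by (intro open_vimage continuous_on_det continuous_on_minor) auto
  then show ?thesis by (simp add: regular_def vimage_def)
qed

lemma continuous_on_coords: "continuous_on regular coords"
proof -
  have "continuous_on regular (\<lambda>x. if j \<in> range \<iota> then x $ a $ j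
     else det (\<chi> c b. if b = a then x $ c $ j else x $ c $ \<iota> b) / det (minor x))" for a j
  proof (cases "j \<in> range \<iota>")
    case False
    have "continuous_on regular (\<lambda>x :: real ^ 'n ^ 'k. if b = a then x $ c $ j else x $ c $ \<iota> b)" for b c
      by (cases "b = a") (auto intro!: continuous_intros)
    then have "continuous_on regular (\<lambda>x. det (\<chi> c b. if b = a then x $ c $ j else x $ c $ \<iota> b) / det (minor x))"
      by (intro continuous_on_divide continuous_on_det continuous_on_minor continuous_on_vec_lambda) (auto simp: regular_def)
    then show ?thesis using False by simp
  qed (auto intro!: continuous_intros)
  then show ?thesis unfolding coords_def[abs_def] by (intro continuous_on_vec_lambda)
qed

lemma continuous_on_of_coords: "continuous_on S of_coords"
proof -
  have "continuous_on S (\<lambda>z. if j \<in> range \<iota> then z $ a $ j else (\<Sum>b\<in>UNIV. z $ a $ \<iota> b * z $ b $ j))" for a j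
    by (cases "j \<in> range \<iota>") (auto intro!: continuous_intros)
  then show ?thesis unfolding of_coords_def[abs_def] by (intro continuous_on_vec_lambda)
qed

lemma differentiable_on_of_coords: "of_coords differentiable_on S"
proof -
  have comp: "(\<lambda>z :: real ^ 'n ^ 'k. z $ a $ j) differentiable (at x within S)" for a j x
    by (intro bounded_linear_imp_differentiable bounded_linear_compose[OF bounded_linear_vec_nth bounded_linear_vec_nth])
  have "(\<lambda>z. of_coords z $ a $ j) differentiable (at x within S)" for a j x
    by (cases "j \<in> range \<iota>") (auto simp: of_coords_def intro!: comp differentiable_sum differentiable_mult)
  then show ?thesis
    unfolding differentiable_on_def by (subst differentiable_componentwise_within) (auto simp: Basis_vec_def inner_axis)
qed

lemma half_open_subset_cbox: "half_open l u \<subseteq> cbox l u"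
  by (auto simp: half_open_def mem_cbox_vec mem_box_cart less_imp_le)

lemma box_subset_half_open: "box l u \<subseteq> half_open l u"
  by (auto simp: half_open_def mem_box_vec mem_box_cart less_imp_le)

lemma half_open_borel: "half_open l u \<in> sets borel" for l u :: "real ^ 'n ^ 'k"
proof -
  have "half_open l u = (\<Inter>a. \<Inter>j. {z. l $ a $ j \<le> z $ a $ j \<and> z $ a $ j < u $ a $ j})"
    by (auto simp: half_open_def)
  also have "\<dots> \<in> sets borel"
  proof (intro sets.finite_INT)
    fix a j
    have "closed {z :: real ^ 'n ^ 'k. l $ a $ j \<le> z $ a $ j}" by (intro closed_Collect_le continuous_intros)
    moreover have "open {z :: real ^ 'n ^ 'k. z $ a $ j < u $ a $ j}" by (intro open_Collect_less continuous_intros)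
    ultimately have "{z :: real ^ 'n ^ 'k. l $ a $ j \<le> z $ a $ j} \<inter> {z. z $ a $ j < u $ a $ j} \<in> sets borel" by auto
    then show "{z. l $ a $ j \<le> z $ a $ j \<and> z $ a $ j < u $ a $ j} \<in> sets borel" by (simp add: Collect_conj_eq)
  qed auto
  finally show ?thesis .
qed

lemma coords_borel: "S \<in> sets borel \<Longrightarrow> regular \<inter> coords -` S \<in> sets borel"
  using borel_measurable_continuous_on_restrict[OF continuous_on_coords] open_regular
  by (auto simp: measurable_def sets_restrict_space_iff space_restrict_space Int_commute)

lemma cell_borel: "cell l u \<in> sets borel"
proof -
  have "cell l u = regular \<inter> coords -` half_open l u" by (auto simp: cell_def)
  then show ?thesis using coords_borel[OF half_open_borel] by simp
qed

lemma cell_subset_image: "cell l u \<subseteq> of_coords ` cbox l u"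
  using half_open_subset_cbox of_coords_coords by (force simp: cell_def)

lemma bounded_cell: "bounded (cell l u)"
  by (rule bounded_subset[OF compact_imp_bounded cell_subset_image])
    (intro compact_continuous_image continuous_on_of_coords compact_cbox)

text \<open>The frontier lies in the image of the frontier of the box under the differentiable map
  \<open>of_coords\<close>. That the closed box is regular ensures that boundary points of the cell
  do not come from the interior of the box.\<close>

lemma negligible_frontier_cell:
  assumes "cbox l u \<subseteq> regular"
  shows "negligible (frontier (cell l u))"
proof (rule negligible_subset)
  have "closed (of_coords ` cbox l u)"
    by (intro compact_imp_closed compact_continuous_image continuous_on_of_coords compact_cbox)
  then have cl: "closure (cell l u) \<subseteq> of_coords ` cbox l u" using cell_subset_image by (rule closure_minimal[rotated])
  have "open (regular \<inter> coords -` box l u)"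
    using continuous_open_preimage[OF continuous_on_coords open_regular open_box] .
  moreover have "regular \<inter> coords -` box l u \<subseteq> cell l u" using box_subset_half_open by (auto simp: cell_def)
  ultimately have int: "regular \<inter> coords -` box l u \<subseteq> interior (cell l u)" by (rule interior_maximal[rotated])
  show "frontier (cell l u) \<subseteq> of_coords ` (cbox l u - box l u)"
  proof
    fix x assume x: "x \<in> frontier (cell l u)"
    then obtain z where z: "z \<in> cbox l u" "x = of_coords z" using cl by (auto simp: frontier_def)
    then have "z \<in> regular" using assms by auto
    then have "x \<in> regular \<inter> coords -` box l u" if "z \<in> box l u" using that z coords_of_coords by simp
    then have "z \<notin> box l u" using x int by (auto simp: frontier_def)
    then show "x \<in> of_coords ` (cbox l u - box l u)" using z by auto
  qed
  show "negligible (of_coords ` (cbox l u - box l u))"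
    by (rule negligible_differentiable_image_negligible[OF order_refl _ differentiable_on_of_coords])
      (use negligible_frontier_interval[of l u] in simp)
qed

text \<open>In the coordinates of a tuple it acts by B to s B and B^-1 Y to (t B^-1 Y + h) / s, so h
  is a translation.\<close>

definition dilate_shear :: "real \<Rightarrow> real \<Rightarrow> ('k \<Rightarrow> 'n \<Rightarrow> real) \<Rightarrow> real ^ 'n ^ 'n" where
  "dilate_shear s t h = (\<chi> i j. if j \<in> range \<iota> then (if i = j then s else 0)
     else if i \<in> range \<iota> then h (inv \<iota> i) j else if i = j then t else 0)"

lemma dilate_shear_apply:
  "(v v* dilate_shear s t h) $ j =
    (if j \<in> range \<iota> then s * v $ j else t * v $ j + (\<Sum>b\<in>UNIV. v $ \<iota> b * h b j))"
proof (cases "j \<in> range \<iota>")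
  case True
  then show ?thesis
    by (simp add: vector_matrix_mult_def dilate_shear_def if_distrib[of "\<lambda>x. x * _"] if_distrib[of "\<lambda>x. _ * x"] sum.delta cong: if_cong)
next
  case False
  have "(v v* dilate_shear s t h) $ j =
      (\<Sum>i\<in>UNIV. if i \<in> range \<iota> then v $ i * h (inv \<iota> i) j else if i = j then t * v $ j else 0)"
    using False by (auto simp: vector_matrix_mult_def dilate_shear_def intro!: sum.cong)
  also have "\<dots> = (\<Sum>i\<in>range \<iota>. v $ i * h (inv \<iota> i) j) + (\<Sum>i\<in>- range \<iota>. if i = j then t * v $ j else 0)"
    by (subst sum.If_cases) (simp_all add: Collect_neg_eq)
  also have "(\<Sum>i\<in>- range \<iota>. if i = j then t * v $ j else 0) = t * v $ j" using False by simp
  also have "(\<Sum>i\<in>range \<iota>. v $ i * h (inv \<iota> i) j) = (\<Sum>b\<in>UNIV. v $ \<iota> b * h b j)"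
    by (subst sum.reindex[OF inj]) (simp add: inv_f_f[OF inj])
  finally show ?thesis using False by simp
qed

text \<open>Splitting off the diagonal part on the right leaves a unipotent factor; this needs
  division of h by t.\<close>

lemma det_dilate_shear:
  assumes "t \<noteq> 0"
  shows "det (dilate_shear s t h) = s ^ CARD('k) * t ^ (CARD('n) - CARD('k))"
proof -
  define \<delta> where "\<delta> j = (if j \<in> range \<iota> then s else t)" for j
  define N :: "real ^ 'n ^ 'n" where "N = (\<chi> i j. if i \<in> range \<iota> \<and> j \<notin> range \<iota> then h (inv \<iota> i) j / t else 0)"
  define \<Delta> :: "real ^ 'n ^ 'n" where "\<Delta> = (\<chi> i j. if i = j then \<delta> j else 0)"
  have "(A ** \<Delta>) $ i $ j = A $ i $ j * \<delta> j" for A :: "real ^ 'n ^ 'n" and i j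
    by (simp add: matrix_matrix_mult_def \<Delta>_def if_distrib[of "\<lambda>x. _ * x"] cong: if_cong)
  then have "dilate_shear s t h = (mat 1 + N) ** \<Delta>"
    using assms by (auto simp: vec_eq_iff dilate_shear_def N_def \<delta>_def mat_def)
  moreover have "det (mat 1 + N) = 1" by (rule det_one_plus_nilpotent[of "range \<iota>"]) (auto simp: N_def)
  moreover have "det \<Delta> = (\<Prod>j\<in>UNIV. \<delta> j)" by (subst det_diagonal) (auto simp: \<Delta>_def)
  moreover have "(\<Prod>j\<in>UNIV. \<delta> j) = s ^ card (range \<iota>) * t ^ card (- range \<iota>)"
    unfolding \<delta>_def by (subst prod.If_cases) (simp_all add: Collect_neg_eq)
  moreover have "card (- range \<iota>) = CARD('n) - CARD('k)" by (simp add: Compl_eq_Diff_UNIV card_Diff_subset card_image[OF inj])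
  ultimately show ?thesis by (simp add: det_mul card_image[OF inj])
qed

text \<open>\<open>coords\<close> and \<open>of_coords\<close> are inverse on
  \<open>regular\<close>, so it is enough that the proposed coordinates are regular and rebuild the
  tuple. This avoids computing with Cramer quotients.\<close>

lemma coords_tuple_act:
  assumes s: "s > 0"
  shows "tuple_act x (dilate_shear s t h) \<in> regular \<longleftrightarrow> x \<in> regular"
    and "x \<in> regular \<Longrightarrow> coords (tuple_act x (dilate_shear s t h)) =
      (\<chi> a j. if j \<in> range \<iota> then s * x $ a $ j else (t * coords x $ a $ j + h a j) / s)"
proof -
  let ?y = "tuple_act x (dilate_shear s t h)"
  let ?w = "\<chi> a j. if j \<in> range \<iota> then s * x $ a $ j else (t * coords x $ a $ j + h a j) / s"
  have "minor ?y = s *\<^sub>R minor x" by (simp add: minor_def tuple_act_def dilate_shear_apply vec_eq_iff)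
  then show "?y \<in> regular \<longleftrightarrow> x \<in> regular" using s by (simp add: regular_def det_scaleR)
  assume x: "x \<in> regular"
  then have y: "?y \<in> regular" using \<open>?y \<in> regular \<longleftrightarrow> x \<in> regular\<close> by simp
  have "minor ?w = minor ?y" by (simp add: minor_def tuple_act_def dilate_shear_apply vec_eq_iff)
  then have w: "?w \<in> regular" using y by (simp add: regular_def)
  have "of_coords ?w $ a $ j = ?y $ a $ j" for a j
  proof (cases "j \<in> range \<iota>")
    case True
    then show ?thesis by (simp add: of_coords_def tuple_act_def dilate_shear_apply)
  next
    case False
    have "of_coords ?w $ a $ j = (\<Sum>b\<in>UNIV. s * x $ a $ \<iota> b * ((t * coords x $ b $ j + h b j) / s))"
      using False by (simp add: of_coords_def)
    also have "\<dots> = (\<Sum>b\<in>UNIV. t * (x $ a $ \<iota> b * coords x $ b $ j) + x $ a $ \<iota> b * h b j)"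
      using s by (intro sum.cong refl) (simp add: field_simps)
    also have "\<dots> = t * x $ a $ j + (\<Sum>b\<in>UNIV. x $ a $ \<iota> b * h b j)"
      by (simp add: sum.distrib sum_coords[OF x False] flip: sum_distrib_left)
    finally show ?thesis using False by (simp add: tuple_act_def dilate_shear_apply)
  qed
  then have "?y = of_coords ?w" by (simp add: vec_eq_iff)
  then show "coords ?y = ?w" using coords_of_coords[OF w] by simp
qed

text \<open>Each side [l, u) outside the block is cut into D equal intervals. With s = 1/T and t =
  D/T a coordinate z becomes D (z - l) - c (u - l) + l, which stretches the interval number c onto
  [l, u); B is scaled by 1/T.\<close>

definition translation :: "real ^ 'n ^ 'k \<Rightarrow> real ^ 'n ^ 'k \<Rightarrow> nat \<Rightarrow> real \<Rightarrow> ('k \<times> 'n \<Rightarrow> nat) \<Rightarrow> real ^ 'n ^ 'n" where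
  "translation l u D T c = dilate_shear (1 / T) (real D / T)
     (\<lambda>a j. (l $ a $ j - real D * l $ a $ j - real (c (a, j)) * (u $ a $ j - l $ a $ j)) / T)"

text \<open>Entries of B are not subdivided; their dummy index 0 keeps the index set a product over
  all entries.\<close>

definition tiles :: "nat \<Rightarrow> ('k \<times> 'n \<Rightarrow> nat) set" where
  "tiles D = PiE UNIV (\<lambda>(a, j). if j \<in> range \<iota> then {0} else {..<D})"

lemma finite_tiles: "finite (tiles D)"
  unfolding tiles_def by (intro finite_PiE) (auto split: if_splits)

lemma card_tiles: "card (tiles D) = D ^ ((CARD('n) - CARD('k)) * CARD('k))"
proof -
  have "card (tiles D) = (\<Prod>p\<in>UNIV. card (case p of (a :: 'k, j) \<Rightarrow> if j \<in> range \<iota> then {0} else {..<D}))"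
    unfolding tiles_def by (rule card_PiE) simp
  also have "\<dots> = (\<Prod>(a, j)\<in>(UNIV :: 'k set) \<times> UNIV. if j \<in> range \<iota> then 1 else D)"
    by (intro prod.cong) (auto split: if_splits)
  also have "\<dots> = (\<Prod>a\<in>(UNIV :: 'k set). \<Prod>j\<in>UNIV. if j \<in> range \<iota> then 1 else D)"
    by (rule prod.cartesian_product[symmetric])
  also have "(\<Prod>j\<in>UNIV. if j \<in> range \<iota> then 1 else D) = D ^ (CARD('n) - CARD('k))"
    by (subst prod.If_cases) (simp_all add: Compl_eq_Diff_UNIV card_Diff_subset card_image[OF inj])
  finally show ?thesis by (simp add: power_mult)
qed

text \<open>Scaling x by 1/T leaves B^-1 Y unchanged and affects only B, exactly as every
  translation does. So the block conditions agree on both sides, and for the other entries the D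
  subintervals partition each side of the box.\<close>

lemma cell_tiling:
  assumes T: "T > 0" and D: "D \<ge> 1"
  shows "indicator (cell l u) ((1 / T) *\<^sub>R x) =
    (\<Sum>c\<in>tiles D. indicator (cell l u) (tuple_act x (translation l u D T c)) :: ennreal)"
proof (cases "x \<in> regular")
  case False
  have scale: "(1 / T) *\<^sub>R x = tuple_act x (dilate_shear (1 / T) (1 / T) (\<lambda>_ _. 0))"
    by (simp add: tuple_act_def dilate_shear_apply vec_eq_iff)
  have "(1 / T) *\<^sub>R x \<notin> regular" unfolding scale using False T by (simp add: coords_tuple_act)
  moreover have "tuple_act x (translation l u D T c) \<notin> regular" for c
    unfolding translation_def using False T by (simp add: coords_tuple_act)
  ultimately show ?thesis by (simp add: cell_def)
next
  case True
  have scale: "(1 / T) *\<^sub>R x = tuple_act x (dilate_shear (1 / T) (1 / T) (\<lambda>_ _. 0))"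
    by (simp add: tuple_act_def dilate_shear_apply vec_eq_iff)
  define z where "z = coords x"
  define d where "d a j = u $ a $ j - l $ a $ j" for a j
  define P where "P \<longleftrightarrow> (\<forall>a. \<forall>j\<in>range \<iota>. l $ a $ j \<le> x $ a $ j / T \<and> x $ a $ j / T < u $ a $ j)"
  have mem: "(1 / T) *\<^sub>R x \<in> cell l u \<longleftrightarrow> P \<and> (\<forall>a. \<forall>j\<in>- range \<iota>. l $ a $ j \<le> z $ a $ j \<and> z $ a $ j < u $ a $ j)"
    unfolding scale using True T by (auto simp: cell_def coords_tuple_act half_open_def P_def z_def)
  have tile: "tuple_act x (translation l u D T c) \<in> cell l u \<longleftrightarrow>
     P \<and> (\<forall>a. \<forall>j\<in>- range \<iota>. real (c (a, j)) * d a j \<le> real D * (z $ a $ j - l $ a $ j) \<and>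
        real D * (z $ a $ j - l $ a $ j) < (real (c (a, j)) + 1) * d a j)" for c
  proof -
    have "tuple_act x (translation l u D T c) \<in> cell l u \<longleftrightarrow>
      P \<and> (\<forall>a. \<forall>j\<in>- range \<iota>. l $ a $ j \<le> real D * z $ a $ j + (l $ a $ j - real D * l $ a $ j - real (c (a, j)) * d a j) \<and>
        real D * z $ a $ j + (l $ a $ j - real D * l $ a $ j - real (c (a, j)) * d a j) < u $ a $ j)"
    proof -
      have "(real D / T * w + v / T) / (1 / T) = real D * w + v" for w v using T by (simp add: field_simps)
      then show ?thesis
        unfolding translation_def using True T by (auto simp: cell_def coords_tuple_act half_open_def P_def z_def d_def)
    qed
    moreover have "l $ a $ j \<le> real D * z $ a $ j + (l $ a $ j - real D * l $ a $ j - real (c (a, j)) * d a j) \<longleftrightarrow>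
       real (c (a, j)) * d a j \<le> real D * (z $ a $ j - l $ a $ j)" for a j
      unfolding right_diff_distrib by linarith
    moreover have "real D * z $ a $ j + (l $ a $ j - real D * l $ a $ j - real (c (a, j)) * d a j) < u $ a $ j \<longleftrightarrow>
       real D * (z $ a $ j - l $ a $ j) < (real (c (a, j)) + 1) * d a j" for a j
      by (auto simp: d_def algebra_simps)
    ultimately show ?thesis by simp
  qed
  have unique: "c = c'" if c: "c \<in> tiles D" "c' \<in> tiles D"
    "tuple_act x (translation l u D T c) \<in> cell l u" "tuple_act x (translation l u D T c') \<in> cell l u" for c c'
  proof
    fix p :: "'k \<times> 'n"
    obtain a j where p: "p = (a, j)" by (cases p)
    show "c p = c' p"
    proof (cases "j \<in> range \<iota>")
      case True
      then show ?thesis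
        using PiE_mem[OF c(1)[unfolded tiles_def] UNIV_I, of "(a, j)"]
          PiE_mem[OF c(2)[unfolded tiles_def] UNIV_I, of "(a, j)"] by (simp add: p)
    next
      case False
      have "real (c p) * d a j \<le> real D * (z $ a $ j - l $ a $ j)" "real D * (z $ a $ j - l $ a $ j) < (real (c p) + 1) * d a j"
        using c(3) False unfolding tile p by auto
      moreover have "real (c' p) * d a j \<le> real D * (z $ a $ j - l $ a $ j)" "real D * (z $ a $ j - l $ a $ j) < (real (c' p) + 1) * d a j"
        using c(4) False unfolding tile p by auto
      ultimately have 1: "real (c p) * d a j < (real (c' p) + 1) * d a j" "real (c' p) * d a j < (real (c p) + 1) * d a j"
        "real (c p) * d a j < (real (c p) + 1) * d a j" by linarith+
      \<comment> \<open>A half-open interval that contains a point has positive length.\<close>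
      from 1(3) have "d a j > 0" by (simp add: algebra_simps)
      then have "real (c p) < real (c' p) + 1" "real (c' p) < real (c p) + 1"
        using 1(1,2) by (simp_all only: mult_less_cancel_right_pos)
      then show ?thesis by linarith
    qed
  qed
  have exists: "(1 / T) *\<^sub>R x \<in> cell l u \<longleftrightarrow> (\<exists>c\<in>tiles D. tuple_act x (translation l u D T c) \<in> cell l u)"
  proof
    assume x: "(1 / T) *\<^sub>R x \<in> cell l u"
    \<comment> \<open>The number of the subinterval containing z; \<open>nat\<close> is harmless
      because z >= l.\<close>
    define c where "c = (\<lambda>(a, j). if j \<in> range \<iota> then 0 else nat \<lfloor>real D * (z $ a $ j - l $ a $ j) / d a j\<rfloor>)"
    have *: "c (a, j) < D \<and> real (c (a, j)) * d a j \<le> real D * (z $ a $ j - l $ a $ j) \<and>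
        real D * (z $ a $ j - l $ a $ j) < (real (c (a, j)) + 1) * d a j" if j: "j \<notin> range \<iota>" for a j
    proof -
      have zl: "l $ a $ j \<le> z $ a $ j" "z $ a $ j < u $ a $ j" using x j unfolding mem by auto
      then have d: "d a j > 0" by (simp add: d_def)
      define q where "q = real D * (z $ a $ j - l $ a $ j) / d a j"
      have q0: "q \<ge> 0" using zl d by (simp add: q_def)
      have "z $ a $ j - l $ a $ j < d a j" using zl by (simp add: d_def)
      then have qD: "q < real D" using d D by (simp add: q_def pos_divide_less_eq)
      have cq: "real (c (a, j)) = of_int \<lfloor>q\<rfloor>" using j q0 by (simp add: c_def q_def)
      then have q: "real (c (a, j)) \<le> q" "q < real (c (a, j)) + 1" by linarith+
      have "real (c (a, j)) * d a j \<le> q * d a j" "q * d a j < (real (c (a, j)) + 1) * d a j"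
        using q d by (intro mult_right_mono mult_strict_right_mono; simp)+
      moreover have "q * d a j = real D * (z $ a $ j - l $ a $ j)" using d by (simp add: q_def)
      moreover have "real (c (a, j)) < real D" using q(1) qD by linarith
      ultimately show ?thesis by simp
    qed
    then have "c \<in> tiles D" by (auto simp: tiles_def c_def split: if_splits)
    moreover have "tuple_act x (translation l u D T c) \<in> cell l u" using * x unfolding tile mem by auto
    ultimately show "\<exists>c\<in>tiles D. tuple_act x (translation l u D T c) \<in> cell l u" by blast
  next
    assume "\<exists>c\<in>tiles D. tuple_act x (translation l u D T c) \<in> cell l u"
    then obtain c where c: "c \<in> tiles D" "tuple_act x (translation l u D T c) \<in> cell l u" by blast
    have "l $ a $ j \<le> z $ a $ j \<and> z $ a $ j < u $ a $ j" if j: "j \<notin> range \<iota>" for a j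
    proof -
      have "c (a, j) \<in> {..<D}" using PiE_mem[OF c(1)[unfolded tiles_def] UNIV_I, of "(a, j)"] j by simp
      then have cD: "real (c (a, j)) + 1 \<le> real D" by auto
      have b: "real (c (a, j)) * d a j \<le> real D * (z $ a $ j - l $ a $ j)" "real D * (z $ a $ j - l $ a $ j) < (real (c (a, j)) + 1) * d a j"
        using c(2) j unfolding tile by auto
      then have "real (c (a, j)) * d a j < (real (c (a, j)) + 1) * d a j" by simp
      then have d: "d a j > 0" by (simp add: algebra_simps)
      have "0 \<le> real (c (a, j)) * d a j" using d by simp
      then have "0 \<le> real D * (z $ a $ j - l $ a $ j)" using b by linarith
      then have 1: "l $ a $ j \<le> z $ a $ j" using D by (simp add: zero_le_mult_iff)
      have "(real (c (a, j)) + 1) * d a j \<le> real D * d a j" using cD d by (intro mult_right_mono) auto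
      then have "real D * (z $ a $ j - l $ a $ j) < real D * d a j" using b by linarith
      then show ?thesis using 1 D by (simp add: d_def)
    qed
    then show "(1 / T) *\<^sub>R x \<in> cell l u" using c(2) unfolding tile mem by auto
  qed
  show ?thesis
  proof (cases "(1 / T) *\<^sub>R x \<in> cell l u")
    case True
    then obtain c where c: "c \<in> tiles D" "tuple_act x (translation l u D T c) \<in> cell l u" using exists by blast
    have "(\<Sum>c'\<in>tiles D. indicator (cell l u) (tuple_act x (translation l u D T c')) :: ennreal) =
      (\<Sum>c'\<in>tiles D. if c' = c then 1 else 0)"
      using c unique by (intro sum.cong refl) (auto simp: indicator_def)
    then show ?thesis using True c finite_tiles by simp
  next
    case False
    then show ?thesis using exists by (auto simp: indicator_def intro!: sum.neutral)
  qed
qed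

lemma nn_integral_siegel_cell:
  fixes \<mu> :: "(real ^ 'n) set measure"
  assumes mu: "invariant_lattice_measure \<mu>" and n: "CARD('n) \<ge> 3" and lu: "cbox l u \<subseteq> regular"
  shows "(\<integral>\<^sup>+L. siegel (indicator (cell l u)) L \<partial>\<mu>) =
    ennreal (measure lborel (cell l u) / zeta (real CARD('n)) ^ CARD('k))"
proof -
  interpret prob_space \<mu> using mu by (simp add: invariant_lattice_measure_def)
  have sets: "sets \<mu> = sets lattice_borel" using mu by (simp add: invariant_lattice_measure_def)
  have sp: "space \<mu> = unimodular_lattices" by (rule invariant_space[OF mu])
  let ?n = "CARD('n)" and ?k = "CARD('k)"
  \<comment> \<open>The exponent gives T^n = (D+1)^(n-k). This makes the determinant (1/T)^k
    ((D+1)/T)^(n-k) equal to 1 and the number of tiles equal to T^(nk), the normalisation of the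
    count. The successor excludes an empty tiling.\<close>
  define T where "T D = real (Suc D) powr (real (?n - ?k) / real ?n)" for D
  have T0: "T D > 0" for D by (simp add: T_def)
  have Tn: "T D ^ ?n = real (Suc D) ^ (?n - ?k)" for D
  proof -
    have "T D ^ ?n = real (Suc D) powr (real (?n - ?k) / real ?n * real ?n)"
      unfolding T_def by (simp add: powr_powr flip: powr_realpow)
    also have "\<dots> = real (Suc D) powr real (?n - ?k)" by simp
    finally show ?thesis by (simp only: powr_realpow of_nat_0_less_iff zero_less_Suc)
  qed
  have Tinf: "filterlim T at_top sequentially"
  proof -
    have "filterlim (\<lambda>x::real. x powr (real (?n - ?k) / real ?n)) at_top at_top"
    proof -
      have "filterlim (\<lambda>x::real. exp (real (?n - ?k) / real ?n * ln x)) at_top at_top"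
        using less by (intro filterlim_compose[OF exp_at_top] filterlim_tendsto_pos_mult_at_top[OF tendsto_const _ ln_at_top]) auto
      moreover have "\<forall>\<^sub>F x::real in at_top. exp (real (?n - ?k) / real ?n * ln x) = x powr (real (?n - ?k) / real ?n)"
        by (rule eventually_mono[OF eventually_gt_at_top[of 0]]) (simp add: powr_def)
      ultimately show ?thesis by (rule filterlim_cong[THEN iffD1, OF refl refl, rotated])
    qed
    moreover have "filterlim (\<lambda>D. real (Suc D)) at_top sequentially"
      using filterlim_compose[OF filterlim_real_sequentially filterlim_Suc] by simp
    ultimately show ?thesis unfolding T_def[abs_def] by (rule filterlim_compose)
  qed
  define g where "g D c = translation l u (Suc D) (T D) c" for D c
  have g: "g D c \<in> SL_real" for D c
  proof -
    have "det (g D c) = (1 / T D) ^ ?k * (real (Suc D) / T D) ^ (?n - ?k)"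
      unfolding g_def translation_def using T0[of D] by (intro det_dilate_shear) simp
    also have "\<dots> = real (Suc D) ^ (?n - ?k) / (T D ^ ?k * T D ^ (?n - ?k))" by (simp add: power_divide)
    also have "T D ^ ?k * T D ^ (?n - ?k) = real (Suc D) ^ (?n - ?k)" using less by (simp add: Tn flip: power_add)
    finally show ?thesis by (simp add: SL_real_def)
  qed
  have cell: "cell l u \<in> sets borel" by (rule cell_borel)
  show ?thesis
  proof (rule nn_integral_eq_limit_of_averages[where I = "\<lambda>D. tiles (Suc D)" and \<phi> = "\<lambda>D c L. lattice_act L (g D c)"])
    show "siegel (indicator (cell l u)) \<in> borel_measurable \<mu>"
      using cell by (simp add: measurable_cong_sets[OF sets refl] siegel_measurable)
    show "tiles (Suc D) \<noteq> {}" for D using card_tiles[of "Suc D"] by auto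
    show "(\<lambda>L. lattice_act L (g D c)) \<in> measurable \<mu> \<mu>" for D c
      using lattice_act_measurable[OF g] by (simp add: measurable_cong_sets[OF sets sets])
    show "(\<integral>\<^sup>+L. f (lattice_act L (g D c)) \<partial>\<mu>) = (\<integral>\<^sup>+L. f L \<partial>\<mu>)" if "f \<in> borel_measurable \<mu>" for f D c
      by (rule nn_integral_invariant[OF mu g that])
    fix L assume "L \<in> space \<mu>"
    then have L: "L \<in> unimodular_lattices" by (simp add: sp)
    interpret discrete_subgroup L by (rule discrete_subgroup_unimodular[OF L])
    define q where "q t = real (card {x \<in> primitive_tuples L. (1 / t) *\<^sub>R x \<in> cell l u}) / t ^ (?n * ?k)" for t
    have "(q \<longlongrightarrow> measure lborel (cell l u) / zeta (real ?n) ^ ?k) at_top"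
      unfolding q_def by (rule primitive_tuples_count_tendsto[OF L n bounded_cell cell negligible_frontier_cell[OF lu]])
    then have "(\<lambda>D. ennreal (q (T D))) \<longlonglongrightarrow> ennreal (measure lborel (cell l u) / zeta (real ?n) ^ ?k)"
      by (intro tendsto_ennrealI filterlim_compose[OF _ Tinf])
    moreover have "ennreal (q (T D)) =
      (\<Sum>c\<in>tiles (Suc D). siegel (indicator (cell l u)) (lattice_act L (g D c))) / of_nat (card (tiles (Suc D)))" for D
    proof -
      have "(\<Sum>c\<in>tiles (Suc D). siegel (indicator (cell l u)) (lattice_act L (g D c))) =
        (\<Sum>c\<in>tiles (Suc D). siegel (\<lambda>x. indicator (cell l u) (tuple_act x (g D c))) L)"
        by (simp add: siegel_act[OF g])
      also have "\<dots> = siegel (\<lambda>x. \<Sum>c\<in>tiles (Suc D). indicator (cell l u) (tuple_act x (g D c))) L"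
        unfolding siegel_def by (rule nn_integral_sum[symmetric]) simp
      also have "\<dots> = siegel (\<lambda>x. indicator (cell l u) ((1 / T D) *\<^sub>R x)) L"
        unfolding g_def by (subst cell_tiling[OF T0, of "Suc D"]) simp_all
      also have "\<dots> = siegel (indicator {x. (1 / T D) *\<^sub>R x \<in> cell l u}) L"
        by (rule arg_cong[where f = "\<lambda>h. siegel h L"]) (auto simp: indicator_def fun_eq_iff)
      also have "\<dots> = of_nat (card {x \<in> primitive_tuples L. (1 / T D) *\<^sub>R x \<in> cell l u})"
        unfolding siegel_indicator using finite_primitive_tuples[OF T0 bounded_cell]
        by (subst emeasure_count_space_finite) (auto simp: Int_def)
      finally have "(\<Sum>c\<in>tiles (Suc D). siegel (indicator (cell l u)) (lattice_act L (g D c))) / of_nat (card (tiles (Suc D))) =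
        ennreal (real (card {x \<in> primitive_tuples L. (1 / T D) *\<^sub>R x \<in> cell l u})) / ennreal (real (card (tiles (Suc D))))"
        by (simp add: ennreal_of_nat_eq_real_of_nat)
      also have "real (card (tiles (Suc D))) = T D ^ (?n * ?k)"
        by (simp add: card_tiles power_mult Tn)
      finally show ?thesis using T0[of D] by (simp add: q_def divide_ennreal)
    qed
    ultimately show "(\<lambda>D. (\<Sum>c\<in>tiles (Suc D). siegel (indicator (cell l u)) (lattice_act L (g D c))) / of_nat (card (tiles (Suc D))))
      \<longlonglongrightarrow> ennreal (measure lborel (cell l u) / zeta (real ?n) ^ ?k)" by simp
  qed (rule finite_tiles)
qed

end

text \<open>The intensity measure of the random set of primitive tuples. As a measure it is
  determined near a regular tuple by its values on cells.\<close>

definition tuple_measure :: "(real ^ 'n::finite) set measure \<Rightarrow> (real ^ 'n ^ 'k::finite) measure" where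
  "tuple_measure \<mu> = measure_of UNIV (sets borel) (\<lambda>C. \<integral>\<^sup>+L. siegel (indicator C) L \<partial>\<mu>)"

lemma sets_tuple_measure [simp, measurable_cong]: "sets (tuple_measure \<mu>) = sets borel"
  unfolding tuple_measure_def by (metis sets.sigma_sets_eq sets_measure_of space_borel subset_UNIV Pow_UNIV)

lemma emeasure_tuple_measure:
  fixes C :: "(real ^ 'n::finite ^ 'k::finite) set"
  assumes sets: "sets \<mu> = sets lattice_borel" and C: "C \<in> sets borel"
  shows "emeasure (tuple_measure \<mu>) C = (\<integral>\<^sup>+L. siegel (indicator C) L \<partial>\<mu>)"
proof (rule emeasure_measure_of[OF tuple_measure_def])
  show "positive (sets (tuple_measure \<mu>)) (\<lambda>C :: (real ^ 'n ^ 'k) set. \<integral>\<^sup>+L. siegel (indicator C) L \<partial>\<mu>)"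
    by (simp add: positive_def siegel_def)
  show "countably_additive (sets (tuple_measure \<mu>)) (\<lambda>C :: (real ^ 'n ^ 'k) set. \<integral>\<^sup>+L. siegel (indicator C) L \<partial>\<mu>)"
  proof (rule countably_additiveI)
    fix A :: "nat \<Rightarrow> (real ^ 'n ^ 'k) set"
    assume A: "range A \<subseteq> sets (tuple_measure \<mu>)" "disjoint_family A"
    have "(\<lambda>x. \<Sum>i. indicator (A i) x :: ennreal) = indicator (\<Union>i. A i)"
      using suminf_indicator[OF A(2)] by (simp add: fun_eq_iff)
    then have sum: "(\<Sum>i. siegel (indicator (A i)) L) = siegel (indicator (\<Union>i. A i)) L" for L
      by (simp only: siegel_suminf[symmetric])
    have "(\<Sum>i. \<integral>\<^sup>+L. siegel (indicator (A i)) L \<partial>\<mu>) = (\<integral>\<^sup>+L. (\<Sum>i. siegel (indicator (A i)) L) \<partial>\<mu>)"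
      using A(1) by (intro nn_integral_suminf[symmetric]) (auto simp: measurable_cong_sets[OF sets refl])
    also have "\<dots> = (\<integral>\<^sup>+L. siegel (indicator (\<Union>i. A i)) L \<partial>\<mu>)" by (simp only: sum)
    finally show "(\<Sum>i. \<integral>\<^sup>+L. siegel (indicator (A i)) L \<partial>\<mu>) = (\<integral>\<^sup>+L. siegel (indicator (\<Union>i. A i)) L \<partial>\<mu>)" .
  qed
qed (use C in auto)

lemma nn_integral_tuple_measure:
  fixes f :: "real ^ 'n::finite ^ 'k::finite \<Rightarrow> ennreal"
  assumes sets: "sets \<mu> = sets lattice_borel" and f: "f \<in> borel_measurable borel"
  shows "(\<integral>\<^sup>+x. f x \<partial>tuple_measure \<mu>) = (\<integral>\<^sup>+L. siegel f L \<partial>\<mu>)"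
  using f
proof (induction rule: borel_measurable_induct)
  case (cong f g)
  then have "f = g" by auto
  then show ?case using cong by simp
next
  case (set A)
  then show ?case by (simp add: emeasure_tuple_measure[OF sets])
next
  case (mult u c)
  have "siegel (\<lambda>x. c * u x) L = c * siegel u L" for L
    by (simp add: siegel_def nn_integral_cmult)
  moreover have "siegel u \<in> borel_measurable \<mu>" using mult by (simp add: measurable_cong_sets[OF sets refl])
  ultimately show ?case using mult by (simp add: nn_integral_cmult)
next
  case (add u v)
  moreover have "siegel u \<in> borel_measurable \<mu>" "siegel v \<in> borel_measurable \<mu>"
    using add by (simp_all add: measurable_cong_sets[OF sets refl])
  ultimately show ?case by (simp add: siegel_add nn_integral_add)
next
  case (seq U)
  have "(\<integral>\<^sup>+x. (SUP i. U i) x \<partial>tuple_measure \<mu>) = (\<integral>\<^sup>+x. (SUP i. U i x) \<partial>tuple_measure \<mu>)"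
    by (simp add: image_comp)
  also have "\<dots> = (SUP i. \<integral>\<^sup>+x. U i x \<partial>tuple_measure \<mu>)"
    by (rule nn_integral_monotone_convergence_SUP) (use seq in auto)
  also have "\<dots> = (SUP i. \<integral>\<^sup>+L. siegel (U i) L \<partial>\<mu>)" using seq by simp
  also have "\<dots> = (\<integral>\<^sup>+L. (SUP i. siegel (U i) L) \<partial>\<mu>)"
  proof (rule nn_integral_monotone_convergence_SUP[symmetric])
    show "incseq (\<lambda>i L. siegel (U i) L)"
      using seq(3) by (auto simp: incseq_def le_fun_def intro!: siegel_mono)
    show "siegel (U i) \<in> borel_measurable \<mu>" for i using seq by (simp add: measurable_cong_sets[OF sets refl])
  qed
  also have "\<dots> = (\<integral>\<^sup>+L. siegel (SUP i. U i) L \<partial>\<mu>)"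
  proof (rule nn_integral_cong)
    show "(SUP i. siegel (U i) L) = siegel (SUP i. U i) L" for L
      using siegel_SUP[OF seq(3), of L] by (simp add: SUP_apply[abs_def] image_comp)
  qed
  finally show ?case .
qed

text \<open>Lindelof's theorem leaves countably many neighbourhoods; made disjoint, they cut A into
  pieces on which the measures agree.\<close>

lemma emeasure_eq_of_locally_eq:
  fixes M N :: "'a::second_countable_topology measure"
  assumes sets [simp]: "sets M = sets borel" "sets N = sets borel" and A: "A \<in> sets borel"
    and loc: "\<And>x. x \<in> A \<Longrightarrow> \<exists>V. open V \<and> x \<in> V \<and> (\<forall>B\<in>sets borel. B \<subseteq> V \<longrightarrow> emeasure M B = emeasure N B)"
  shows "emeasure M A = emeasure N A"
proof -
  define \<F> where "\<F> = {V. open V \<and> (\<forall>B\<in>sets borel. B \<subseteq> V \<longrightarrow> emeasure M B = emeasure N B)}"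
  obtain \<F>' where \<F>': "\<F>' \<subseteq> \<F>" "countable \<F>'" "\<Union>\<F>' = \<Union>\<F>"
    by (rule Lindelof[of \<F>]) (auto simp: \<F>_def)
  have cover: "A \<subseteq> \<Union>\<F>'" using loc unfolding \<F>'(3) \<F>_def by blast
  show ?thesis
  proof (cases "\<F>' = {}")
    case True
    then show ?thesis using cover by simp
  next
    case False
    define V where "V = from_nat_into \<F>'"
    have V: "V i \<in> \<F>" for i using from_nat_into[OF False] \<F>'(1) by (auto simp: V_def)
    have UV: "(\<Union>i. V i) = \<Union>\<F>'" using range_from_nat_into[OF False \<F>'(2)] by (simp add: V_def)
    define B where "B i = A \<inter> disjointed V i" for i
    have Vb: "V i \<in> sets borel" for i using V[of i] by (auto simp: \<F>_def)
    have B: "B i \<in> sets borel" "B i \<subseteq> V i" for i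
      using A sets.range_disjointed_sets'[of V borel] Vb disjointed_subset[of V i] unfolding B_def by (auto simp: image_subset_iff)
    have UB: "(\<Union>i. B i) = A" using cover UV UN_disjointed_eq[of V] by (auto simp: B_def)
    have dB: "disjoint_family B" using disjoint_family_disjointed[of V] by (auto simp: B_def disjoint_family_on_def)
    have "emeasure M A = (\<Sum>i. emeasure M (B i))"
      unfolding UB[symmetric] by (rule suminf_emeasure[symmetric]) (use B dB in auto)
    also have "\<dots> = (\<Sum>i. emeasure N (B i))"
    proof -
      have "emeasure M (B i) = emeasure N (B i)" for i using V[of i] B[of i] unfolding \<F>_def by blast
      then show ?thesis by simp
    qed
    also have "\<dots> = emeasure N A"
      unfolding UB[symmetric] by (rule suminf_emeasure) (use B dB in auto)
    finally show ?thesis .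
  qed
qed

text \<open>An open box is the union of half-open boxes whose lower corner approaches its own, so
  the half-open boxes generate as well.\<close>

lemma borel_eq_half_open: "sets (borel :: (real ^ 'n::finite ^ 'k::finite) measure) = sigma_sets UNIV (range (\<lambda>(l, u). half_open l u))"
proof
  interpret A: sigma_algebra UNIV "sigma_sets UNIV (range (\<lambda>(l, u). half_open l u :: (real ^ 'n ^ 'k) set))"
    by (rule sigma_algebra_sigma_sets) auto
  have "box l u \<in> sigma_sets UNIV (range (\<lambda>(l, u). half_open l u))" for l u :: "real ^ 'n ^ 'k"
  proof -
    have "box l u = (\<Union>m::nat. half_open (\<chi> a j. l $ a $ j + 1 / real (Suc m)) u)"
    proof (intro equalityI subsetI)
      fix x assume x: "x \<in> box l u"
      have "\<forall>\<^sub>F m in sequentially. \<forall>a j. 1 / real (Suc m) < x $ a $ j - l $ a $ j"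
        using x by (intro eventually_all_finite order_tendstoD(2)[OF LIMSEQ_inverse_real_of_nat[unfolded inverse_eq_divide]])
          (auto simp: mem_box_vec mem_box_cart)
      then obtain m where "\<forall>a j. 1 / real (Suc m) < x $ a $ j - l $ a $ j" by (auto simp: eventually_sequentially)
      then have "x \<in> half_open (\<chi> a j. l $ a $ j + 1 / real (Suc m)) u"
        using x by (auto simp: half_open_def mem_box_vec mem_box_cart less_imp_le add.commute less_diff_eq)
      then show "x \<in> (\<Union>m::nat. half_open (\<chi> a j. l $ a $ j + 1 / real (Suc m)) u)" by blast
    next
      fix x assume "x \<in> (\<Union>m::nat. half_open (\<chi> a j. l $ a $ j + 1 / real (Suc m)) u)"
      then obtain m :: nat where m: "\<And>a j. l $ a $ j + 1 / real (Suc m) \<le> x $ a $ j \<and> x $ a $ j < u $ a $ j"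
        by (auto simp: half_open_def)
      have "0 < 1 / real (Suc m)" by simp
      then have "l $ a $ j < x $ a $ j" for a j using m[of a j] by linarith
      then show "x \<in> box l u" using m by (auto simp: mem_box_vec mem_box_cart)
    qed
    also have "\<dots> \<in> sigma_sets UNIV (range (\<lambda>(l, u). half_open l u))"
      by (intro A.countable_UN) auto
    finally show ?thesis .
  qed
  then have "sigma_sets UNIV (range (\<lambda>(l, u). box l u)) \<subseteq> sigma_sets UNIV (range (\<lambda>(l, u). half_open l u :: (real ^ 'n ^ 'k) set))"
    by (intro A.sigma_sets_subset) auto
  then show "sets borel \<subseteq> sigma_sets UNIV (range (\<lambda>(l, u). half_open l u :: (real ^ 'n ^ 'k) set))"
    by (simp add: borel_eq_box)
  show "sigma_sets UNIV (range (\<lambda>(l, u). half_open l u)) \<subseteq> sets (borel :: (real ^ 'n ^ 'k) measure)"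
  proof (rule sets.sigma_sets_subset[where M = borel, unfolded space_borel])
    have "half_open l u \<in> sets borel" for l u :: "real ^ 'n ^ 'k"
    proof -
      have "{z :: real ^ 'n ^ 'k. l $ a $ j \<le> z $ a $ j} \<in> sets borel" for a j
        by (intro borel_closed closed_Collect_le continuous_intros)
      moreover have "{z :: real ^ 'n ^ 'k. z $ a $ j < u $ a $ j} \<in> sets borel" for a j
        by (intro borel_open open_Collect_less continuous_intros)
      ultimately have "(\<Inter>a. \<Inter>j. {z. l $ a $ j \<le> z $ a $ j} \<inter> {z. z $ a $ j < u $ a $ j}) \<in> sets borel"
        by (intro sets.finite_INT sets.Int) auto
      moreover have "(\<Inter>a. \<Inter>j. {z. l $ a $ j \<le> z $ a $ j} \<inter> {z. z $ a $ j < u $ a $ j}) = half_open l u"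
        by (auto simp: half_open_def)
      ultimately show ?thesis by simp
    qed
    then show "range (\<lambda>(l, u). half_open l u) \<subseteq> sets (borel :: (real ^ 'n ^ 'k) measure)" by auto
  qed
qed

context column_minor
begin

text \<open>Both measures, restricted to the cell, are pushed forward to coordinate space. There
  they agree on half-open boxes, which are stable under intersection, hence everywhere.\<close>

lemma tuple_measure_eq_on_cell:
  fixes \<mu> :: "(real ^ 'n) set measure"
  assumes mu: "invariant_lattice_measure \<mu>" and n: "CARD('n) \<ge> 3" and lu0: "cbox l0 u0 \<subseteq> regular"
    and A: "A \<in> sets borel" "A \<subseteq> cell l0 u0"
  shows "emeasure (tuple_measure \<mu>) A = emeasure (density lborel (\<lambda>_. ennreal (1 / zeta (real CARD('n)) ^ CARD('k)))) A"
proof -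
  have sets: "sets \<mu> = sets lattice_borel" using mu by (simp add: invariant_lattice_measure_def)
  let ?z = "zeta (real CARD('n)) ^ CARD('k)"
  have zpos: "?z > 0" using zeta_terms(4)[OF n] by simp
  let ?N = "density lborel (\<lambda>_. ennreal (1 / ?z)) :: (real ^ 'n ^ 'k) measure"
  let ?\<nu> = "tuple_measure \<mu> :: (real ^ 'n ^ 'k) measure"
  \<comment> \<open>\<open>coords\<close> is continuous only on \<open>regular\<close>; extension by
    0 makes it Borel on the whole space.\<close>
  define \<chi>' where "\<chi>' x = indicator regular x *\<^sub>R coords x" for x
  have meas [measurable]: "\<chi>' \<in> borel_measurable borel"
    unfolding \<chi>'_def using open_regular continuous_on_coords by (intro borel_measurable_continuous_on_indicator) auto
  have [measurable]: "cell l0 u0 \<in> sets borel" by (rule cell_borel)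
  have em: "emeasure (distr (density M (indicator (cell l0 u0))) borel \<chi>') S = emeasure M (cell l0 u0 \<inter> \<chi>' -` S)"
    if M: "sets M = sets borel" and S: "S \<in> sets borel" for M S
  proof -
    have m1: "\<chi>' \<in> measurable (density M (indicator (cell l0 u0))) borel"
    proof -
      have "sets (density M (indicator (cell l0 u0))) = sets borel" using M by simp
      from measurable_cong_sets[OF this refl] show ?thesis using meas by blast
    qed
    have sp: "space M = UNIV" using sets_eq_imp_space_eq[OF M] by simp
    have S': "\<chi>' -` S \<in> sets M" using measurable_sets[OF meas S] by (simp add: M)
    have cM: "cell l0 u0 \<in> sets M" by (simp add: M)
    have "emeasure (distr (density M (indicator (cell l0 u0))) borel \<chi>') S = emeasure (density M (indicator (cell l0 u0))) (\<chi>' -` S)"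
      using S by (subst emeasure_distr[OF m1]) (auto simp: sp)
    also have "\<dots> = (\<integral>\<^sup>+x. indicator (cell l0 u0) x * indicator (\<chi>' -` S) x \<partial>M)"
      by (rule emeasure_density) (use S' cM in auto)
    also have "\<dots> = (\<integral>\<^sup>+x. indicator (cell l0 u0 \<inter> \<chi>' -` S) x \<partial>M)"
      by (simp only: indicator_inter_arith)
    also have "\<dots> = emeasure M (cell l0 u0 \<inter> \<chi>' -` S)" using S' cM by simp
    finally show ?thesis .
  qed
  \<comment> \<open>Restriction to a box in coordinates yields another cell, to which the mean value
    formula for cells applies.\<close>
  have inter: "cell l0 u0 \<inter> \<chi>' -` half_open l u = cell (\<chi> a j. max (l0 $ a $ j) (l $ a $ j)) (\<chi> a j. min (u0 $ a $ j) (u $ a $ j))" for l u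
    by (auto simp: cell_def \<chi>'_def half_open_def)
  have cell_eq: "emeasure ?\<nu> (cell l0 u0 \<inter> \<chi>' -` half_open l u) = emeasure ?N (cell l0 u0 \<inter> \<chi>' -` half_open l u)"
    and cell_fin: "emeasure ?\<nu> (cell l0 u0 \<inter> \<chi>' -` half_open l u) \<noteq> \<infinity>" for l u
  proof -
    let ?l = "\<chi> a j. max (l0 $ a $ j) (l $ a $ j)" and ?u = "\<chi> a j. min (u0 $ a $ j) (u $ a $ j)"
    have sub: "cbox ?l ?u \<subseteq> regular" using lu0 by (auto simp: mem_cbox_vec mem_box_cart subset_iff)
    have 1: "emeasure ?\<nu> (cell ?l ?u) = ennreal (measure lborel (cell ?l ?u) / ?z)"
      using emeasure_tuple_measure[OF sets cell_borel] nn_integral_siegel_cell[OF mu n sub] by simp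
    have "emeasure lborel (cell ?l ?u) \<noteq> \<top>"
      using emeasure_bounded_finite[OF bounded_cell] by (simp add: less_top)
    then have "emeasure lborel (cell ?l ?u) = ennreal (measure lborel (cell ?l ?u))"
      by (rule emeasure_eq_ennreal_measure)
    then have "emeasure ?N (cell ?l ?u) = ennreal (measure lborel (cell ?l ?u) / ?z)"
      using cell_borel[of ?l ?u] zpos by (simp add: emeasure_density_const mult.commute flip: ennreal_mult)
    then show "emeasure ?\<nu> (cell l0 u0 \<inter> \<chi>' -` half_open l u) = emeasure ?N (cell l0 u0 \<inter> \<chi>' -` half_open l u)"
      "emeasure ?\<nu> (cell l0 u0 \<inter> \<chi>' -` half_open l u) \<noteq> \<infinity>"
      unfolding inter using 1 by auto
  qed
  have "distr (density ?\<nu> (indicator (cell l0 u0))) borel \<chi>' = distr (density ?N (indicator (cell l0 u0))) borel \<chi>'"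
  proof (rule measure_eqI_generator_eq[where E = "range (\<lambda>(l, u). half_open l u)" and \<Omega> = UNIV
      and A = "\<lambda>i. half_open (\<chi> a j. - real i) (\<chi> a j. real i)"])
    have "half_open l u \<inter> half_open l' u' = half_open (\<chi> a j. max (l $ a $ j) (l' $ a $ j)) (\<chi> a j. min (u $ a $ j) (u' $ a $ j))"
      for l u l' u' :: "real ^ 'n ^ 'k" by (auto simp: half_open_def)
    then show "Int_stable (range (\<lambda>(l, u). half_open l u :: (real ^ 'n ^ 'k) set))"
      unfolding Int_stable_def by (auto simp del: split_paired_Ex intro!: rev_image_eqI)
    fix X :: "(real ^ 'n ^ 'k) set" assume "X \<in> range (\<lambda>(l, u). half_open l u)"
    then obtain l u where "X = half_open l u" by auto
    then show "emeasure (distr (density ?\<nu> (indicator (cell l0 u0))) borel \<chi>') X =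
      emeasure (distr (density ?N (indicator (cell l0 u0))) borel \<chi>') X"
      using em[of ?\<nu>] em[of ?N] half_open_borel cell_eq by simp
  next
    show "(\<Union>i. half_open (\<chi> a j. - real i) (\<chi> a j. real i)) = (UNIV :: (real ^ 'n ^ 'k) set)"
    proof -
      have "\<exists>i::nat. x \<in> half_open (\<chi> a j. - real i) (\<chi> a j. real i)" for x :: "real ^ 'n ^ 'k"
      proof -
        obtain i :: nat where i: "norm x < real i" using reals_Archimedean2 by blast
        have "\<bar>x $ a $ j\<bar> \<le> norm x" for a j
          using component_le_norm_cart[of "x $ a" j] Finite_Cartesian_Product.norm_nth_le[where x = x and i = a] by linarith
        then have "- real i \<le> x $ a $ j \<and> x $ a $ j < real i" for a j using i by (smt (verit))
        then show ?thesis by (auto simp: half_open_def)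
      qed
      then show ?thesis by blast
    qed
    show "emeasure (distr (density ?\<nu> (indicator (cell l0 u0))) borel \<chi>') (half_open (\<chi> a j. - real i) (\<chi> a j. real i)) \<noteq> \<infinity>" for i
      using em[of ?\<nu>] half_open_borel cell_fin by simp
  qed (auto simp: borel_eq_half_open)
  moreover have oc: "of_coords -` A \<in> sets borel"
    using measurable_sets[OF borel_measurable_continuous_onI[OF continuous_on_of_coords] A(1)] by simp
  \<comment> \<open>On the cell \<open>of_coords\<close> undoes \<open>coords\<close>, which
    recovers A as a preimage.\<close>
  moreover have "cell l0 u0 \<inter> \<chi>' -` (of_coords -` A) = A"
    using A(2) by (auto simp: cell_def \<chi>'_def of_coords_coords subset_iff)
  ultimately show ?thesis
    using em[of ?\<nu>, OF _ oc] em[of ?N, OF _ oc] by simp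
qed

lemma tuple_measure_eq_locally:
  fixes \<mu> :: "(real ^ 'n) set measure"
  assumes mu: "invariant_lattice_measure \<mu>" and n: "CARD('n) \<ge> 3" and x: "x \<in> regular"
  shows "\<exists>V. open V \<and> x \<in> V \<and> (\<forall>B\<in>sets borel. B \<subseteq> V \<longrightarrow>
    emeasure (tuple_measure \<mu>) B = emeasure (density lborel (\<lambda>_. ennreal (1 / zeta (real CARD('n)) ^ CARD('k)))) B)"
proof -
  have "coords x \<in> regular" using x by simp
  then obtain l u where lu: "cbox l u \<subseteq> regular" "coords x \<in> box l u"
    by (rule open_contains_cbox[OF open_regular])
  have "open (regular \<inter> coords -` box l u)"
    using continuous_open_preimage[OF continuous_on_coords open_regular open_box] .
  moreover have "regular \<inter> coords -` box l u \<subseteq> cell l u" using box_subset_half_open by (auto simp: cell_def)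
  ultimately show ?thesis
    using x lu tuple_measure_eq_on_cell[OF mu n lu(1)] by (intro exI[of _ "regular \<inter> coords -` box l u"]) blast
qed

end

text \<open>The support condition says that f lives on linearly independent tuples: some maximal
  minor is nonzero, and its columns provide coordinates in which the intensity measure is locally a
  multiple of Lebesgue measure.\<close>

theorem nn_integral_siegel:
  fixes \<mu> :: "(real ^ 'n::finite) set measure" and f :: "real ^ 'n ^ 'k::finite \<Rightarrow> ennreal"
  assumes mu: "invariant_lattice_measure \<mu>" and n: "CARD('n) \<ge> 3" "CARD('k) < CARD('n)" and f: "f \<in> borel_measurable borel"
    and supp: "\<And>x. f x \<noteq> 0 \<Longrightarrow> \<exists>\<iota> :: 'k \<Rightarrow> 'n. det (\<chi> a b. x $ a $ \<iota> b) \<noteq> 0"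
  shows "(\<integral>\<^sup>+L. siegel f L \<partial>\<mu>) = ennreal (1 / zeta (real CARD('n)) ^ CARD('k)) * (\<integral>\<^sup>+x. f x \<partial>lborel)"
proof -
  have sets: "sets \<mu> = sets lattice_borel" using mu by (simp add: invariant_lattice_measure_def)
  let ?N = "density lborel (\<lambda>_. ennreal (1 / zeta (real CARD('n)) ^ CARD('k))) :: (real ^ 'n ^ 'k) measure"
  let ?\<nu> = "tuple_measure \<mu> :: (real ^ 'n ^ 'k) measure"
  have "density ?\<nu> f = density ?N f"
  proof (rule measure_eqI)
    fix A assume "A \<in> sets (density ?\<nu> f)"
    then have A: "A \<in> sets borel" by simp
    \<comment> \<open>Local agreement is available only at independent tuples, so both measures are
      first restricted to the set where f is nonzero.\<close>
    have "density ?\<nu> (indicator {x. f x \<noteq> 0}) = density ?N (indicator {x. f x \<noteq> 0})"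
    proof (rule measure_eqI)
      fix B assume "B \<in> sets (density ?\<nu> (indicator {x. f x \<noteq> 0}))"
      then have B: "B \<in> sets borel" by simp
      have ne: "{x. f x \<noteq> 0} \<in> sets borel" using f by measurable
      have "emeasure ?\<nu> ({x. f x \<noteq> 0} \<inter> B) = emeasure ?N ({x. f x \<noteq> 0} \<inter> B)"
      proof (rule emeasure_eq_of_locally_eq)
        fix x assume "x \<in> {x. f x \<noteq> 0} \<inter> B"
        then obtain \<iota> :: "'k \<Rightarrow> 'n" where \<iota>: "det (\<chi> a b. x $ a $ \<iota> b) \<noteq> 0" using supp by blast
        \<comment> \<open>Choosing a column twice would make the minor vanish.\<close>
        have "inj \<iota>"
        proof (rule injI, rule ccontr)
          fix b b' assume "\<iota> b = \<iota> b'" "b \<noteq> b'"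
          then have "det (\<chi> a b. x $ a $ \<iota> b) = 0"
            by (intro det_identical_columns[of b b']) (auto simp: column_def)
          then show False using \<iota> by simp
        qed
        then interpret column_minor \<iota> using n(2) by unfold_locales
        have "x \<in> regular" using \<iota> by (simp add: regular_def minor_def)
        then show "\<exists>V. open V \<and> x \<in> V \<and> (\<forall>B\<in>sets borel. B \<subseteq> V \<longrightarrow> emeasure ?\<nu> B = emeasure ?N B)"
          by (rule tuple_measure_eq_locally[OF mu n(1)])
      qed (use B ne in auto)
      then show "emeasure (density ?\<nu> (indicator {x. f x \<noteq> 0})) B = emeasure (density ?N (indicator {x. f x \<noteq> 0})) B"
        using B ne by (simp add: emeasure_density indicator_inter_arith[symmetric] del: nn_integral_density)
    qed simp
    then have "emeasure (density (density ?\<nu> (indicator {x. f x \<noteq> 0})) f) A = emeasure (density (density ?N (indicator {x. f x \<noteq> 0})) f) A"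
      by simp
    moreover have "density (density M (indicator {x. f x \<noteq> 0})) f = density M f" if M: "sets M = sets borel" for M
    proof -
      have "f \<in> borel_measurable M" "indicator {x. f x \<noteq> 0} \<in> (borel_measurable M :: (_ \<Rightarrow> ennreal) set)"
        using f M by (auto simp: measurable_cong_sets[OF M refl])
      then have "density (density M (indicator {x. f x \<noteq> 0})) f = density M (\<lambda>x. indicator {x. f x \<noteq> 0} x * f x)"
        by (rule density_density_eq[OF _ _ , rotated])
      also have "(\<lambda>x. indicator {x. f x \<noteq> 0} x * f x) = f" by (auto simp: indicator_def fun_eq_iff)
      finally show ?thesis .
    qed
    ultimately show "emeasure (density ?\<nu> f) A = emeasure (density ?N f) A" by simp
  qed simp
  then have "emeasure (density ?\<nu> f) UNIV = emeasure (density ?N f) UNIV" by simp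
  then have "(\<integral>\<^sup>+x. f x \<partial>?\<nu>) = (\<integral>\<^sup>+x. f x \<partial>?N)"
    using f by (simp add: emeasure_density)
  then show ?thesis
    using f by (simp add: nn_integral_tuple_measure[OF sets f] nn_integral_density nn_integral_cmult)
qed

section \<open>Moments of the number of primitive vectors in a set\<close>

lemma lborel_vec1: "distr (lborel :: (real ^ 'n::finite ^ 1) measure) borel (\<lambda>x. x $ 1) = lborel"
proof (rule lborel_eqI[symmetric])
  fix l u :: "real ^ 'n" assume lu: "\<And>b. b \<in> Basis \<Longrightarrow> l \<bullet> b \<le> u \<bullet> b"
  have [measurable]: "(\<lambda>x :: real ^ 'n ^ 1. x $ 1) \<in> borel_measurable borel"
    by (intro borel_measurable_continuous_onI continuous_intros)
  have vim: "(\<lambda>x :: real ^ 'n ^ 1. x $ 1) -` box l u = box (\<chi> _. l) (\<chi> _. u)"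
    by (auto simp: mem_box_vec forall_1)
  have "emeasure (distr (lborel :: (real ^ 'n ^ 1) measure) borel (\<lambda>x. x $ 1)) (box l u) =
    emeasure lborel (box (\<chi> _. l) (\<chi> _. u) :: (real ^ 'n ^ 1) set)"
    by (subst emeasure_distr) (auto simp: vim)
  also have "\<dots> = ennreal (measure lborel (box (\<chi> _. l) (\<chi> _. u) :: (real ^ 'n ^ 1) set))"
    by (rule emeasure_eq_ennreal_measure) (simp add: emeasure_lborel_box_eq)
  also have "\<dots> = ennreal (\<Prod>b\<in>Basis. (u - l) \<bullet> b)"
    by (subst measure_box_vec) (use lu in \<open>simp add: measure_lborel_box_eq\<close>)
  finally show "emeasure (distr (lborel :: (real ^ 'n ^ 1) measure) borel (\<lambda>x. x $ 1)) (box l u) = ennreal (\<Prod>b\<in>Basis. (u - l) \<bullet> b)" .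
qed simp

text \<open>The map \<open>p\<close> identifies pairs with 2-tuples and carries product measure to
  Lebesgue measure, since boxes correspond to products of boxes.\<close>

lemma emeasure_lborel_vec2:
  assumes A: "A \<in> sets borel"
  shows "emeasure lborel {x :: real ^ 'n::finite ^ 2. x $ 1 \<in> A \<and> x $ 2 \<in> A} = emeasure lborel A * emeasure lborel A"
proof -
  define p :: "(real ^ 'n) \<times> (real ^ 'n) \<Rightarrow> real ^ 'n ^ 2" where "p = (\<lambda>(v, w). \<chi> i. if i = 1 then v else w)"
  have p1: "p (v, w) $ 1 = v" and p2: "p (v, w) $ 2 = w" for v w by (simp_all add: p_def)
  have cont: "continuous_on UNIV p"
  proof -
    have "continuous_on UNIV (\<lambda>x :: (real ^ 'n) \<times> (real ^ 'n). if i = 1 then fst x else snd x)" for i :: 2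
      by (cases "i = 1") (auto intro!: continuous_intros)
    then show ?thesis unfolding p_def case_prod_beta by (intro continuous_on_vec_lambda)
  qed
  have pm: "p \<in> measurable (lborel \<Otimes>\<^sub>M lborel) borel"
    using borel_measurable_continuous_onI[OF cont] by (simp add: borel_prod[symmetric] measurable_cong_sets[OF sets_pair_measure_cong[OF sets_lborel sets_lborel] refl])
  have sp: "space (lborel \<Otimes>\<^sub>M (lborel :: (real ^ 'n) measure)) = (UNIV :: ((real ^ 'n) \<times> (real ^ 'n)) set)"
    by (simp add: space_pair_measure)
  have eq: "distr (lborel \<Otimes>\<^sub>M lborel) borel p = lborel"
  proof (rule lborel_eqI[symmetric])
    fix l u :: "real ^ 'n ^ 2" assume lu: "\<And>b. b \<in> Basis \<Longrightarrow> l \<bullet> b \<le> u \<bullet> b"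
    have le: "\<forall>b\<in>Basis. l $ i \<bullet> b \<le> u $ i \<bullet> b" for i
      using lu[of "axis i b" for b] by (auto simp: axis_in_Basis_iff inner_axis)
    have vim: "p -` box l u = box (l $ 1) (u $ 1) \<times> box (l $ 2) (u $ 2)"
      by (auto simp: mem_box_vec forall_2 p1 p2)
    have "emeasure (distr (lborel \<Otimes>\<^sub>M lborel) borel p) (box l u) = emeasure (lborel \<Otimes>\<^sub>M lborel) (box (l $ 1) (u $ 1) \<times> box (l $ 2) (u $ 2))"
      using pm by (subst emeasure_distr) (auto simp: vim sp)
    also have "\<dots> = emeasure lborel (box (l $ 1) (u $ 1)) * emeasure lborel (box (l $ 2) (u $ 2))"
      by (rule lborel.emeasure_pair_measure_Times) auto
    also have "\<dots> = ennreal (measure lborel (box (l $ 1) (u $ 1)) * measure lborel (box (l $ 2) (u $ 2)))"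
      by (simp add: emeasure_eq_ennreal_measure emeasure_lborel_box_eq measure_lborel_box_eq le inner_diff_left flip: ennreal_mult)
        (use le in \<open>auto simp: inner_diff_left ennreal_mult'[symmetric] intro!: ennreal_mult'[symmetric] prod_nonneg\<close>)
    also have "measure lborel (box (l $ 1) (u $ 1)) * measure lborel (box (l $ 2) (u $ 2)) = measure lborel (box l u)"
      by (simp add: measure_box_vec UNIV_2)
    also have "\<dots> = (\<Prod>b\<in>Basis. (u - l) \<bullet> b)" using lu by (simp add: measure_lborel_box_eq)
    finally show "emeasure (distr (lborel \<Otimes>\<^sub>M lborel) borel p) (box l u) = ennreal (\<Prod>b\<in>Basis. (u - l) \<bullet> b)" .
  qed simp
  have S: "{x :: real ^ 'n ^ 2. x $ 1 \<in> A \<and> x $ 2 \<in> A} \<in> sets borel"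
  proof -
    have "(\<lambda>x :: real ^ 'n ^ 2. x $ i) -` A \<in> sets borel" for i
      using measurable_sets[OF borel_measurable_continuous_onI A, of "\<lambda>x :: real ^ 'n ^ 2. x $ i"] by (simp add: continuous_intros)
    from sets.Int[OF this this, of 1 2] show ?thesis by (simp add: vimage_def Int_def)
  qed
  have "emeasure lborel {x :: real ^ 'n ^ 2. x $ 1 \<in> A \<and> x $ 2 \<in> A} = emeasure (lborel \<Otimes>\<^sub>M lborel) (A \<times> A)"
    unfolding eq[symmetric] using pm S by (subst emeasure_distr) (auto simp: sp p1 p2 intro!: arg_cong2[where f = emeasure])
  then show ?thesis using A by (simp add: lborel.emeasure_pair_measure_Times)
qed

definition primitive_sum :: "(real ^ 'n::finite \<Rightarrow> ennreal) \<Rightarrow> (real ^ 'n) set \<Rightarrow> ennreal" where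
  "primitive_sum f L = (\<integral>\<^sup>+w. f w \<partial>count_space (primitives L))"

lemma primitive_sum_eq_siegel: "primitive_sum f L = siegel (\<lambda>x :: real ^ 'n::finite ^ 1. f (x $ 1)) L"
proof -
  have "bij_betw (\<lambda>x :: real ^ 'n ^ 1. x $ 1) (primitive_tuples L) (primitives L)"
    by (rule bij_betwI[where g = "\<lambda>w. \<chi> _. w"]) (auto simp: primitive_tuples_def vec_eq_iff forall_1)
  then show ?thesis unfolding primitive_sum_def siegel_def by (rule nn_integral_bij_count_space[symmetric])
qed

lemma primitive_sum_measurable:
  fixes f :: "real ^ 'n::finite \<Rightarrow> ennreal"
  assumes "f \<in> borel_measurable borel"
  shows "primitive_sum f \<in> borel_measurable lattice_borel"
proof -
  have "(\<lambda>x :: real ^ 'n ^ 1. x $ 1) \<in> borel_measurable borel"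
    by (intro borel_measurable_continuous_onI continuous_intros)
  then have "(\<lambda>x :: real ^ 'n ^ 1. f (x $ 1)) \<in> borel_measurable borel" using assms by (rule measurable_compose)
  then show ?thesis unfolding primitive_sum_eq_siegel[abs_def] by (rule siegel_measurable)
qed

text \<open>For a single vector, independence means being nonzero. Cutting f off at 0 secures this
  and changes neither the sum over primitive vectors nor the integral.\<close>

theorem nn_integral_primitive_sum:
  fixes \<mu> :: "(real ^ 'n::finite) set measure"
  assumes mu: "invariant_lattice_measure \<mu>" and n: "CARD('n) \<ge> 3" and f: "f \<in> borel_measurable borel"
  shows "(\<integral>\<^sup>+L. primitive_sum f L \<partial>\<mu>) = ennreal (1 / zeta (real CARD('n))) * (\<integral>\<^sup>+x. f x \<partial>lborel)"
proof -
  let ?F = "\<lambda>x :: real ^ 'n ^ 1. f (x $ 1) * indicator (- {0}) (x $ 1)"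
  have m1 [measurable]: "(\<lambda>x :: real ^ 'n ^ 1. x $ 1) \<in> borel_measurable borel"
    by (intro borel_measurable_continuous_onI continuous_intros)
  note f [measurable]
  have F0: "(\<lambda>v. f v * indicator (- {0}) v) \<in> borel_measurable borel" by measurable
  have F: "?F \<in> borel_measurable borel" by (rule measurable_compose[OF m1 F0])
  have "siegel ?F L = primitive_sum f L" if "L \<in> space \<mu>" for L
  proof -
    interpret discrete_subgroup L using that invariant_space[OF mu] discrete_subgroup_unimodular by blast
    have "siegel ?F L = primitive_sum (\<lambda>v. f v * indicator (- {0}) v) L" by (simp add: primitive_sum_eq_siegel)
    also have "\<dots> = primitive_sum f L"
      unfolding primitive_sum_def using primitive_nonzero by (intro nn_integral_cong) (auto simp: primitives_def indicator_def)
    finally show ?thesis .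
  qed
  then have "(\<integral>\<^sup>+L. primitive_sum f L \<partial>\<mu>) = (\<integral>\<^sup>+L. siegel ?F L \<partial>\<mu>)" by (intro nn_integral_cong) simp
  also have "\<dots> = ennreal (1 / zeta (real CARD('n)) ^ CARD(1)) * (\<integral>\<^sup>+x. ?F x \<partial>lborel)"
  proof (rule nn_integral_siegel[OF mu n _ F])
    fix x assume "?F x \<noteq> 0"
    then have "x $ 1 \<noteq> 0" by (auto simp: indicator_def)
    then obtain i where "x $ 1 $ i \<noteq> 0" by (auto simp: vec_eq_iff)
    then show "\<exists>\<iota> :: 1 \<Rightarrow> 'n. det (\<chi> a b. x $ a $ \<iota> b) \<noteq> 0" by (intro exI[of _ "\<lambda>_. i"]) (simp add: det_1)
  qed (use n in auto)
  also have "(\<integral>\<^sup>+x. ?F x \<partial>lborel) = (\<integral>\<^sup>+v. f v * indicator (- {0}) v \<partial>distr (lborel :: (real ^ 'n ^ 1) measure) borel (\<lambda>x. x $ 1))"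
    using F0 by (subst nn_integral_distr) auto
  also have "\<dots> = (\<integral>\<^sup>+v. f v \<partial>lborel)"
    unfolding lborel_vec1
  proof (rule nn_integral_cong_AE)
    show "AE v in lborel. f v * indicator (- {0}) v = f v"
      using AE_lborel_singleton[of "0 :: real ^ 'n"] by eventually_elim simp
  qed
  finally show ?thesis by simp
qed

lemma collinear_minors:
  fixes v w :: "real ^ 'n::finite"
  assumes "\<And>i j. v $ i * w $ j = v $ j * w $ i" "v \<noteq> 0"
  shows "\<exists>t. w = t *\<^sub>R v"
proof -
  obtain i where i: "v $ i \<noteq> 0" using assms(2) by (auto simp: vec_eq_iff)
  define t where "t = w $ i / v $ i"
  have "w $ j = t * v $ j" for j using assms(1)[of i j] i by (simp add: t_def field_simps)
  then have "w = t *\<^sub>R v" by (simp add: vec_eq_iff)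
  then show ?thesis ..
qed

text \<open>A pair of dependent primitive vectors has the form \<open>(w, \<plusminus>w)\<close>; this is the term \<open>2 * m\<close>.\<close>

lemma second_moment_le:
  fixes \<mu> :: "(real ^ 'n::finite) set measure"
  assumes mu: "invariant_lattice_measure \<mu>" and n: "CARD('n) \<ge> 3" and A: "A \<in> sets borel" "bounded A"
  defines "m \<equiv> measure lborel A / zeta (real CARD('n))"
  shows "(\<integral>\<^sup>+L. ennreal ((real (card (primitives L \<inter> A)))\<^sup>2) \<partial>\<mu>) \<le> ennreal (m\<^sup>2 + 2 * m)"
proof -
  have zpos: "zeta (real CARD('n)) > 0" using zeta_terms(4)[OF n] by simp
  have m0: "m \<ge> 0" using zpos by (simp add: m_def)
  have sets: "sets \<mu> = sets lattice_borel" using mu by (simp add: invariant_lattice_measure_def)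
  have Afin: "emeasure lborel A = ennreal (measure lborel A)"
    using emeasure_bounded_finite[OF A(2)] by (intro emeasure_eq_ennreal_measure) (simp add: less_top)
  \<comment> \<open>Independent pairs are described by a nonvanishing 2 by 2 minor: an open
    condition, and literally what the pair formula asks for.\<close>
  define Q where "Q = {x :: real ^ 'n ^ 2. (x $ 1 \<in> A \<and> x $ 2 \<in> A) \<and> (\<exists>i j. x $ 1 $ i * x $ 2 $ j \<noteq> x $ 1 $ j * x $ 2 $ i)}"
  have comp: "(\<lambda>x :: real ^ 'n ^ 2. x $ a) \<in> borel_measurable borel" for a
    by (intro borel_measurable_continuous_onI continuous_intros)
  have A2: "{x :: real ^ 'n ^ 2. x $ 1 \<in> A \<and> x $ 2 \<in> A} \<in> sets borel"
  proof -
    have "(\<lambda>x :: real ^ 'n ^ 2. x $ i) -` A \<in> sets borel" for i using measurable_sets[OF comp A(1)] by simp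
    from sets.Int[OF this this, of 1 2] show ?thesis by (simp add: vimage_def Int_def)
  qed
  have Qb: "Q \<in> sets borel"
  proof -
    have "open {x :: real ^ 'n ^ 2. \<exists>i j. x $ 1 $ i * x $ 2 $ j \<noteq> x $ 1 $ j * x $ 2 $ i}"
      by (intro open_Collect_ex open_Collect_neq continuous_intros)
    from sets.Int[OF A2 borel_open[OF this]] show ?thesis by (simp add: Q_def Int_def)
  qed
  have pair: "(\<integral>\<^sup>+L. siegel (indicator Q) L \<partial>\<mu>) \<le> ennreal (m\<^sup>2)"
  proof -
    have "(\<integral>\<^sup>+L. siegel (indicator Q) L \<partial>\<mu>) = ennreal (1 / zeta (real CARD('n)) ^ CARD(2)) * (\<integral>\<^sup>+x. indicator Q x \<partial>lborel)"
    proof (rule nn_integral_siegel[OF mu n])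
      fix x :: "real ^ 'n ^ 2" assume "indicator Q x \<noteq> (0 :: ennreal)"
      then obtain i j where ij: "x $ 1 $ i * x $ 2 $ j \<noteq> x $ 1 $ j * x $ 2 $ i" by (auto simp: Q_def indicator_def split: if_splits)
      show "\<exists>\<iota> :: 2 \<Rightarrow> 'n. det (\<chi> a b. x $ a $ \<iota> b) \<noteq> 0"
        by (rule exI[of _ "\<lambda>b. if b = 1 then i else j"]) (use ij in \<open>simp add: det_2\<close>)
    qed (use n Qb in auto)
    also have "(\<integral>\<^sup>+x. indicator Q x \<partial>lborel) = emeasure lborel Q" using Qb by simp
    also have "\<dots> \<le> emeasure lborel {x :: real ^ 'n ^ 2. x $ 1 \<in> A \<and> x $ 2 \<in> A}"
      using A2 by (intro emeasure_mono) (auto simp: Q_def)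
    also have "\<dots> = ennreal (measure lborel A * measure lborel A)"
      by (simp add: emeasure_lborel_vec2[OF A(1)] Afin ennreal_mult)
    finally have "(\<integral>\<^sup>+L. siegel (indicator Q) L \<partial>\<mu>) \<le> ennreal (1 / zeta (real CARD('n)) ^ 2) * ennreal (measure lborel A * measure lborel A)"
      by (simp add: mult_left_mono)
    also have "\<dots> = ennreal (m\<^sup>2)" using zpos by (simp add: m_def power2_eq_square flip: ennreal_mult)
    finally show ?thesis .
  qed
  have single: "(\<integral>\<^sup>+L. primitive_sum (indicator A) L \<partial>\<mu>) = ennreal m"
    using nn_integral_primitive_sum[OF mu n, of "indicator A"] A Afin zpos by (simp add: m_def flip: ennreal_mult)
  have point: "ennreal ((real (card (primitives L \<inter> A)))\<^sup>2) \<le> siegel (indicator Q) L + 2 * primitive_sum (indicator A) L"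
    if "L \<in> space \<mu>" for L
  proof -
    interpret discrete_subgroup L using that invariant_space[OF mu] discrete_subgroup_unimodular by blast
    let ?P = "primitives L \<inter> A"
    have fin: "finite ?P" by (rule finite_subset[OF _ finite_bounded[OF A(2)]]) (use primitives_subset in auto)
    have ps: "primitive_sum (indicator A) L = ennreal (real (card ?P))"
    proof -
      have "primitive_sum (indicator A) L = (\<integral>\<^sup>+w. indicator ?P w \<partial>count_space (primitives L))"
        unfolding primitive_sum_def by (intro nn_integral_cong) (auto simp: indicator_def)
      then show ?thesis using fin by (simp add: emeasure_count_space_finite ennreal_of_nat_eq_real_of_nat)
    qed
    define NC where "NC = {x \<in> ?P \<times> ?P. \<exists>i j. fst x $ i * snd x $ j \<noteq> fst x $ j * snd x $ i}"
    have finNC: "finite NC" unfolding NC_def using fin by simp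
    have bij: "bij_betw (\<lambda>x :: real ^ 'n ^ 2. (x $ 1, x $ 2)) (primitive_tuples L \<inter> Q) NC"
      by (rule bij_betwI[where g = "\<lambda>(v, w). \<chi> i. if i = 1 then v else w"])
        (fastforce simp: primitive_tuples_def Q_def NC_def vec_eq_iff forall_2)+
    have "finite (primitive_tuples L \<inter> Q)" using bij_betw_finite[OF bij] finNC by simp
    then have sQ: "siegel (indicator Q) L = ennreal (real (card NC))"
      using bij_betw_same_card[OF bij] by (simp add: siegel_indicator emeasure_count_space_finite ennreal_of_nat_eq_real_of_nat)
    have "?P \<times> ?P \<subseteq> NC \<union> ((\<lambda>w. (w, w)) ` ?P \<union> (\<lambda>w. (w, - w)) ` ?P)"
    proof
      fix x assume x: "x \<in> ?P \<times> ?P"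
      obtain v w where vw: "x = (v, w)" by (cases x)
      show "x \<in> NC \<union> ((\<lambda>w. (w, w)) ` ?P \<union> (\<lambda>w. (w, - w)) ` ?P)"
      proof (cases "x \<in> NC")
        case False
        then have "v $ i * w $ j = v $ j * w $ i" for i j using x by (auto simp: NC_def vw)
        moreover have "primitive_in L v" "primitive_in L w" using x vw by (auto simp: primitives_def)
        ultimately obtain t where t: "w = t *\<^sub>R v" using collinear_minors[of v w] primitive_nonzero by blast
        have "t = 1 \<or> t = -1" using primitive_collinear[OF _ _ t] x vw by (auto simp: primitives_def)
        then show ?thesis using x vw t by auto
      qed simp
    qed
    then have "card (?P \<times> ?P) \<le> card (NC \<union> ((\<lambda>w. (w, w)) ` ?P \<union> (\<lambda>w. (w, - w)) ` ?P))"
      using fin finNC by (intro card_mono) auto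
    also have "\<dots> \<le> card NC + (card ((\<lambda>w. (w, w)) ` ?P) + card ((\<lambda>w. (w, - w)) ` ?P))"
      by (intro order_trans[OF card_Un_le] add_left_mono card_Un_le)
    also have "\<dots> \<le> card NC + (card ?P + card ?P)"
      using fin by (intro add_left_mono add_mono card_image_le)
    finally have "card ?P * card ?P \<le> card NC + 2 * card ?P" by (simp add: card_cartesian_product)
    then have "real (card ?P * card ?P) \<le> real (card NC + 2 * card ?P)" by (simp only: of_nat_le_iff)
    then have "(real (card ?P))\<^sup>2 \<le> real (card NC) + 2 * real (card ?P)" by (simp add: power2_eq_square)
    then show ?thesis unfolding sQ ps by (simp add: ennreal_leI flip: ennreal_plus ennreal_mult ennreal_numeral)
  qed
  have "(\<integral>\<^sup>+L. ennreal ((real (card (primitives L \<inter> A)))\<^sup>2) \<partial>\<mu>) \<le>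
    (\<integral>\<^sup>+L. siegel (indicator Q) L + 2 * primitive_sum (indicator A) L \<partial>\<mu>)"
    by (rule nn_integral_mono) (rule point)
  also have "\<dots> = (\<integral>\<^sup>+L. siegel (indicator Q) L \<partial>\<mu>) + 2 * (\<integral>\<^sup>+L. primitive_sum (indicator A) L \<partial>\<mu>)"
  proof -
    have "siegel (indicator Q) \<in> borel_measurable \<mu>" "primitive_sum (indicator A) \<in> borel_measurable \<mu>"
      unfolding measurable_cong_sets[OF sets refl]
      by (intro siegel_measurable primitive_sum_measurable borel_measurable_indicator Qb A(1))+
    then show ?thesis by (simp add: nn_integral_add nn_integral_cmult)
  qed
  also have "\<dots> \<le> ennreal (m\<^sup>2) + 2 * ennreal m" unfolding single by (intro add_right_mono pair)
  also have "\<dots> = ennreal (m\<^sup>2 + 2 * m)"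
  proof -
    have "ennreal (2 * m) = 2 * ennreal m" by (simp add: ennreal_mult')
    then show ?thesis using m0 by (subst ennreal_plus) simp_all
  qed
  finally show ?thesis .
qed

lemma primitive_sum_indicator:
  assumes "L \<in> unimodular_lattices" "bounded A"
  shows "finite (primitives L \<inter> A)" "primitive_sum (indicator A) L = ennreal (real (card (primitives L \<inter> A)))"
proof -
  interpret discrete_subgroup L by (rule discrete_subgroup_unimodular[OF assms(1)])
  show fin: "finite (primitives L \<inter> A)"
    by (rule finite_subset[OF _ finite_bounded[OF assms(2)]]) (use primitives_subset in auto)
  have "primitive_sum (indicator A) L = (\<integral>\<^sup>+w. indicator (primitives L \<inter> A) w \<partial>count_space (primitives L))"
    unfolding primitive_sum_def by (intro nn_integral_cong) (auto simp: indicator_def)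
  then show "primitive_sum (indicator A) L = ennreal (real (card (primitives L \<inter> A)))"
    using fin by (simp add: emeasure_count_space_finite ennreal_of_nat_eq_real_of_nat)
qed

lemma card_primitives_measurable:
  assumes "sets \<mu> = sets lattice_borel" "A \<in> sets borel" "bounded A"
  shows "(\<lambda>L. real (card (primitives L \<inter> A))) \<in> borel_measurable \<mu>"
proof -
  have sp: "space \<mu> = unimodular_lattices" using sets_eq_imp_space_eq[OF assms(1)] by simp
  have "primitive_sum (indicator A) \<in> borel_measurable \<mu>"
    unfolding measurable_cong_sets[OF assms(1) refl]
    by (intro primitive_sum_measurable borel_measurable_indicator assms(2))
  then have "(\<lambda>L. enn2real (primitive_sum (indicator A) L)) \<in> borel_measurable \<mu>" by measurable
  moreover have "enn2real (primitive_sum (indicator A) L) = real (card (primitives L \<inter> A))" if "L \<in> space \<mu>" for L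
    using primitive_sum_indicator[OF _ assms(3), of L] that sp by simp
  ultimately show ?thesis by (subst measurable_cong[OF _ , symmetric]) auto
qed

text \<open>Chebyshev's inequality, arranged so that no difference of integrals occurs.\<close>

lemma prob_no_primitive:
  fixes \<mu> :: "(real ^ 'n::finite) set measure"
  assumes mu: "invariant_lattice_measure \<mu>" and n: "CARD('n) \<ge> 3" and A: "A \<in> sets borel" "bounded A" "measure lborel A > 0"
  shows "measure \<mu> {L \<in> space \<mu>. primitives L \<inter> A = {}} \<le> 2 * zeta (real CARD('n)) / measure lborel A"
proof -
  interpret prob_space \<mu> using mu by (simp add: invariant_lattice_measure_def)
  have sets: "sets \<mu> = sets lattice_borel" using mu by (simp add: invariant_lattice_measure_def)
  have sp: "space \<mu> = unimodular_lattices" by (rule invariant_space[OF mu])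
  have zpos: "zeta (real CARD('n)) > 0" using zeta_terms(4)[OF n] by simp
  define m where "m = measure lborel A / zeta (real CARD('n))"
  have m0: "m > 0" using zpos A by (simp add: m_def)
  define N where "N L = real (card (primitives L \<inter> A))" for L
  have N [measurable]: "N \<in> borel_measurable \<mu>" unfolding N_def by (rule card_primitives_measurable[OF sets A(1,2)])
  have Afin: "emeasure lborel A = ennreal (measure lborel A)"
    using emeasure_bounded_finite[OF A(2)] by (intro emeasure_eq_ennreal_measure) (simp add: less_top)
  have EN: "(\<integral>\<^sup>+L. ennreal (N L) \<partial>\<mu>) = ennreal m"
  proof -
    have "(\<integral>\<^sup>+L. ennreal (N L) \<partial>\<mu>) = (\<integral>\<^sup>+L. primitive_sum (indicator A) L \<partial>\<mu>)"
      using primitive_sum_indicator(2)[OF _ A(2)] sp by (intro nn_integral_cong) (simp add: N_def)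
    then show ?thesis
      using nn_integral_primitive_sum[OF mu n, of "indicator A"] A Afin zpos by (simp add: m_def flip: ennreal_mult)
  qed
  have "(\<integral>\<^sup>+L. ennreal ((N L - m)\<^sup>2) \<partial>\<mu>) + ennreal (2 * m\<^sup>2) =
    (\<integral>\<^sup>+L. ennreal ((N L - m)\<^sup>2) \<partial>\<mu>) + ennreal (2 * m) * (\<integral>\<^sup>+L. ennreal (N L) \<partial>\<mu>)"
    using m0 unfolding EN by (simp add: power2_eq_square mult.assoc flip: ennreal_mult)
  also have "\<dots> = (\<integral>\<^sup>+L. ennreal ((N L - m)\<^sup>2) + ennreal (2 * m) * ennreal (N L) \<partial>\<mu>)"
    by (simp add: nn_integral_add nn_integral_cmult)
  also have "\<dots> = (\<integral>\<^sup>+L. ennreal ((N L)\<^sup>2) + ennreal (m\<^sup>2) \<partial>\<mu>)"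
  proof (rule nn_integral_cong)
    fix L
    \<comment> \<open>Expanding the square with the mixed term moved to the left leaves only sums of
      nonnegative terms, as \<open>ennreal\<close> requires.\<close>
    have "(N L - m)\<^sup>2 + 2 * m * N L = (N L)\<^sup>2 + m\<^sup>2" by (simp add: power2_eq_square algebra_simps)
    then show "ennreal ((N L - m)\<^sup>2) + ennreal (2 * m) * ennreal (N L) = ennreal ((N L)\<^sup>2) + ennreal (m\<^sup>2)"
      using m0 by (simp add: N_def flip: ennreal_mult ennreal_plus)
  qed
  also have "\<dots> = (\<integral>\<^sup>+L. ennreal ((N L)\<^sup>2) \<partial>\<mu>) + ennreal (m\<^sup>2)" by (simp add: nn_integral_add emeasure_space_1)
  also have "\<dots> \<le> ennreal (m\<^sup>2 + 2 * m) + ennreal (m\<^sup>2)"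
    using second_moment_le[OF mu n A(1,2)] by (intro add_right_mono) (simp add: N_def m_def)
  also have "\<dots> = ennreal (2 * m) + ennreal (2 * m\<^sup>2)" using m0 by (simp flip: ennreal_plus)
  finally have var: "(\<integral>\<^sup>+L. ennreal ((N L - m)\<^sup>2) \<partial>\<mu>) \<le> ennreal (2 * m)"
    by (simp add: ennreal_add_left_cancel_le add.commute[of _ "ennreal (2 * m\<^sup>2)"])
  let ?E = "{L \<in> space \<mu>. primitives L \<inter> A = {}}"
  have Eeq: "?E = {L \<in> space \<mu>. N L = 0}"
    using primitive_sum_indicator(1)[OF _ A(2)] sp by (auto simp: N_def)
  have E: "?E \<in> sets \<mu>" unfolding Eeq by measurable
  \<comment> \<open>On this event the count is 0, so its squared deviation from the mean is m^2; the
    variance bound 2 m then yields 2/m.\<close>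
  have "ennreal (m\<^sup>2) * emeasure \<mu> ?E = (\<integral>\<^sup>+L. ennreal (m\<^sup>2) * indicator ?E L \<partial>\<mu>)"
    using E by (simp add: nn_integral_cmult_indicator)
  also have "\<dots> \<le> (\<integral>\<^sup>+L. ennreal ((N L - m)\<^sup>2) \<partial>\<mu>)"
    by (intro nn_integral_mono) (auto simp: indicator_def N_def)
  also note var
  finally have "ennreal (m\<^sup>2 * measure \<mu> ?E) \<le> ennreal (2 * m)" by (simp add: emeasure_eq_measure ennreal_mult)
  then have "m\<^sup>2 * measure \<mu> ?E \<le> 2 * m" using m0 by (simp add: ennreal_le_iff)
  then have "measure \<mu> ?E \<le> 2 / m" using m0 by (simp add: power2_eq_square field_simps)
  also have "2 / m = 2 * zeta (real CARD('n)) / measure lborel A" by (simp add: m_def)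
  finally show ?thesis .
qed

section \<open>Radial integrals\<close>

text \<open>The half-lines bounded above form an intersection-stable generator, so the volumes of
  balls determine the law of the norm.\<close>

lemma distr_norm_lborel:
  fixes dummy :: "real ^ 'n::finite"
  shows "distr (lborel :: (real ^ 'n) measure) borel norm =
    density lborel (\<lambda>r. ennreal (real CARD('n) * unit_ball_vol (real CARD('n)) * r ^ (CARD('n) - 1)) * indicator {0..} r)"
    (is "?M = ?N")
proof (rule measure_eqI_generator_eq[where E = "range atMost" and \<Omega> = UNIV and A = "\<lambda>i. {..real i}"])
  let ?n = "CARD('n)" and ?v = "unit_ball_vol (real CARD('n))"
  have v0: "?v \<ge> 0" by simp
  have M: "emeasure ?M {..a} = (if a \<ge> 0 then ennreal (?v * a ^ ?n) else 0)" for a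
  proof -
    have "emeasure ?M {..a} = emeasure lborel (cball (0 :: real ^ 'n) a)"
      by (subst emeasure_distr) (auto intro!: arg_cong2[where f = emeasure])
    then show ?thesis by (simp add: emeasure_cball)
  qed
  have N: "emeasure ?N {..a} = (if a \<ge> 0 then ennreal (?v * a ^ ?n) else 0)" for a
  proof (cases "a \<ge> 0")
    case True
    have "emeasure ?N {..a} = (\<integral>\<^sup>+r. ennreal (real ?n * ?v * r ^ (?n - 1)) * indicator {0..} r * indicator {..a} r \<partial>lborel)"
      by (subst emeasure_density) auto
    also have "\<dots> = (\<integral>\<^sup>+r. ennreal (real ?n * ?v * r ^ (?n - 1)) * indicator {0..a} r \<partial>lborel)"
      by (intro nn_integral_cong) (auto simp: indicator_def)
    also have "\<dots> = ennreal (?v * a ^ ?n - ?v * 0 ^ ?n)"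
    proof (rule nn_integral_FTC_Icc)
      show "((\<lambda>r. ?v * r ^ ?n) has_real_derivative real ?n * ?v * x ^ (?n - 1)) (at x)" for x
        by (auto intro!: derivative_eq_intros)
    qed (use True v0 in auto)
    finally show ?thesis using True by simp
  next
    case False
    have "emeasure ?N {..a} = (\<integral>\<^sup>+r. ennreal (real ?n * ?v * r ^ (?n - 1)) * indicator {0..} r * indicator {..a} r \<partial>lborel)"
      by (subst emeasure_density) auto
    also have "\<dots> = (\<integral>\<^sup>+(r::real). 0 \<partial>lborel)" using False by (intro nn_integral_cong) (auto simp: indicator_def)
    finally show ?thesis using False by simp
  qed
  show "emeasure ?M X = emeasure ?N X" if "X \<in> range atMost" for X using that M N by auto
  show "Int_stable (range (atMost :: real \<Rightarrow> real set))" by (auto simp: Int_stable_def Int_atMost)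
  show "(\<Union>i. {..real i}) = (UNIV :: real set)" by (auto simp: real_arch_simple)
  show "emeasure ?M {..real i} \<noteq> \<infinity>" for i using M by simp
qed (auto simp: borel_eq_atMost)

lemma nn_integral_radial:
  fixes g :: "real \<Rightarrow> ennreal"
  assumes [measurable]: "g \<in> borel_measurable borel"
  shows "(\<integral>\<^sup>+x. g (norm (x :: real ^ 'n::finite)) \<partial>lborel) =
    (\<integral>\<^sup>+r. ennreal (real CARD('n) * unit_ball_vol (real CARD('n)) * r ^ (CARD('n) - 1)) * indicator {0..} r * g r \<partial>lborel)"
proof -
  have "(\<integral>\<^sup>+x. g (norm (x :: real ^ 'n)) \<partial>lborel) = (\<integral>\<^sup>+r. g r \<partial>distr (lborel :: (real ^ 'n) measure) borel norm)"
    by (subst nn_integral_distr) auto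
  then show ?thesis unfolding distr_norm_lborel by (simp add: nn_integral_density)
qed

text \<open>F is an antiderivative of f times the radial density, so polar coordinates reduce the
  integral to the fundamental theorem of calculus.\<close>

lemma nn_integral_annulus:
  fixes f F :: "real \<Rightarrow> real"
  assumes ab: "0 < a" "a \<le> b" and [measurable]: "f \<in> borel_measurable borel"
    and f0: "\<And>r. a \<le> r \<Longrightarrow> r \<le> b \<Longrightarrow> 0 \<le> f r"
    and F: "\<And>r. a \<le> r \<Longrightarrow> r \<le> b \<Longrightarrow>
      (F has_real_derivative real CARD('n::finite) * unit_ball_vol (real CARD('n)) * r ^ (CARD('n) - 1) * f r) (at r)"
  shows "(\<integral>\<^sup>+x. ennreal (f (norm (x :: real ^ 'n))) * indicator {x. a < norm x \<and> norm x \<le> b} x \<partial>lborel) = ennreal (F b - F a)"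
proof -
  let ?w = "\<lambda>r. real CARD('n) * unit_ball_vol (real CARD('n)) * r ^ (CARD('n) - 1)"
  have w0: "?w r \<ge> 0" if "r \<ge> 0" for r using that by simp
  have "(\<integral>\<^sup>+x. ennreal (f (norm (x :: real ^ 'n))) * indicator {x. a < norm x \<and> norm x \<le> b} x \<partial>lborel) =
     (\<integral>\<^sup>+x. (\<lambda>r. ennreal (f r) * indicator {a<..b} r) (norm (x :: real ^ 'n)) \<partial>lborel)"
    by (intro nn_integral_cong) (auto simp: indicator_def)
  also have "\<dots> = (\<integral>\<^sup>+r. ennreal (?w r) * indicator {0..} r * (ennreal (f r) * indicator {a<..b} r) \<partial>lborel)"
    by (rule nn_integral_radial) measurable
  also have "\<dots> = (\<integral>\<^sup>+r. ennreal (?w r * f r) * indicator {a..b} r \<partial>lborel)"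
  proof (rule nn_integral_cong_AE)
    \<comment> \<open>The half-open and the closed interval differ only in the point a.\<close>
    show "AE r in lborel. ennreal (?w r) * indicator {0..} r * (ennreal (f r) * indicator {a<..b} r) = ennreal (?w r * f r) * indicator {a..b} r"
      using AE_lborel_singleton[of a]
    proof eventually_elim
      case (elim r)
      show ?case
      proof (cases "a \<le> r \<and> r \<le> b")
        case True
        then have "ennreal (?w r) * ennreal (f r) = ennreal (?w r * f r)"
          using w0[of r] f0[of r] ab by (intro ennreal_mult[symmetric]) auto
        then show ?thesis using True elim ab by (auto simp: indicator_def)
      qed (auto simp: indicator_def)
    qed
  qed
  also have "\<dots> = ennreal (F b - F a)"
    by (rule nn_integral_FTC_Icc) (use ab f0 w0 F in auto)
  finally show ?thesis .
qed

text \<open>Both sides are the surface area of the unit sphere.\<close>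

lemma sphere_area_eq:
  "real n > 0 \<Longrightarrow> real n * unit_ball_vol (real n) = 2 * pi powr (real n / 2) / Gamma (real n / 2)"
proof -
  assume n: "real n > 0"
  have "Gamma (real n / 2 + 1) = real n / 2 * Gamma (real n / 2)"
    using n nonpos_Ints_nonpos[of "real n / 2"] by (intro Gamma_plus1) auto
  then have "real n * unit_ball_vol (real n) = real n * (pi powr (real n / 2) / (real n / 2 * Gamma (real n / 2)))"
    by (simp only: unit_ball_vol_def)
  also have "\<dots> = 2 * pi powr (real n / 2) / Gamma (real n / 2)"
    using n by simp
  finally show ?thesis .
qed

lemma gamma_P_deriv:
  fixes k x :: real
  assumes k: "k > 1" and x: "x > 0"
  shows "(gamma_P k has_real_derivative x powr (k - 1) * exp (- x) / Gamma k) (at x)"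
proof -
  let ?f = "\<lambda>t::real. t powr (k - 1) * exp (- t)"
  \<comment> \<open>The condition k > 1 makes the integrand continuous at 0; the upper end 2 x puts
    x into the interior of the interval.\<close>
  have cont: "continuous_on {0..2 * x} ?f"
    using k by (intro continuous_on_mult continuous_on_powr' continuous_intros) auto
  have "((\<lambda>y. integral {0..y} ?f) has_real_derivative ?f x) (at x within {0..2 * x})"
    by (rule integral_has_real_derivative[OF cont]) (use x in auto)
  then have "((\<lambda>y. integral {0..y} ?f) has_real_derivative ?f x) (at x)"
    using x by (subst (asm) at_within_Icc_at) auto
  then have "((\<lambda>y. 1 / Gamma k * integral {0..y} ?f) has_real_derivative 1 / Gamma k * ?f x) (at x)"
    by (rule DERIV_cmult)
  then show ?thesis by (simp add: gamma_P_def[abs_def])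
qed

text \<open>The substitution pi r^2 turns the radial Gaussian integral into an incomplete gamma
  function with parameter n/2. This is the origin of the difference in \<open>M1\<close>.\<close>

lemma nn_integral_gauss_annulus:
  assumes ab: "0 < a" "a \<le> b" and n: "CARD('n::finite) \<ge> 3"
  shows "(\<integral>\<^sup>+x. ennreal (exp (- pi * (norm (x :: real ^ 'n))\<^sup>2)) * indicator {x. a < norm x \<and> norm x \<le> b} x \<partial>lborel) =
    ennreal (gamma_P (real CARD('n) / 2) (pi * b\<^sup>2) - gamma_P (real CARD('n) / 2) (pi * a\<^sup>2))"
proof (rule nn_integral_annulus[where f = "\<lambda>r. exp (- pi * r\<^sup>2)" and F = "\<lambda>r. gamma_P (real CARD('n) / 2) (pi * r\<^sup>2)"])
  fix r assume r: "a \<le> r" "r \<le> b"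
  let ?k = "real CARD('n) / 2"
  have r0: "r > 0" using r ab by simp
  have d: "((\<lambda>r. pi * r\<^sup>2) has_real_derivative 2 * pi * r) (at r)" by (auto intro!: derivative_eq_intros)
  have "((\<lambda>r. gamma_P ?k (pi * r\<^sup>2)) has_real_derivative
     (pi * r\<^sup>2) powr (?k - 1) * exp (- (pi * r\<^sup>2)) / Gamma ?k * (2 * pi * r)) (at r)"
    by (rule DERIV_chain'[OF d gamma_P_deriv]) (use n r0 in auto)
  moreover have "(pi * r\<^sup>2) powr (?k - 1) * exp (- (pi * r\<^sup>2)) / Gamma ?k * (2 * pi * r) =
     real CARD('n) * unit_ball_vol (real CARD('n)) * r ^ (CARD('n) - 1) * exp (- pi * r\<^sup>2)"
  proof -
    have 1: "(pi * r\<^sup>2) powr (?k - 1) = pi powr (?k - 1) * (r\<^sup>2) powr (?k - 1)" using r0 by (simp add: powr_mult)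
    have 2: "(r\<^sup>2) powr (?k - 1) = r powr (real CARD('n) - 2)"
    proof -
      have "(r\<^sup>2) powr (?k - 1) = (r powr 2) powr (?k - 1)" using r0 by (simp add: powr_numeral)
      also have "\<dots> = r powr (real CARD('n) - 2)" by (simp add: powr_powr right_diff_distrib)
      finally show ?thesis .
    qed
    have 3: "r powr (real CARD('n) - 2) * r = r ^ (CARD('n) - 1)"
    proof -
      have "r powr (real CARD('n) - 2) * r = r powr (real CARD('n) - 2) * r powr 1" using r0 by simp
      also have "\<dots> = r powr (real CARD('n) - 2 + 1)" by (rule powr_add[symmetric])
      also have "real CARD('n) - 2 + 1 = real (CARD('n) - 1)" using n by (simp add: of_nat_diff)
      finally show ?thesis using r0 by (simp only: powr_realpow)
    qed
    have 4: "pi powr (?k - 1) * pi = pi powr ?k" by (simp add: powr_diff)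
    have "(pi * r\<^sup>2) powr (?k - 1) * (2 * pi * r) = 2 * (pi powr (?k - 1) * pi) * (r powr (real CARD('n) - 2) * r)"
      unfolding 1 2 by (simp only: mult_ac)
    also have "\<dots> = 2 * pi powr ?k * r ^ (CARD('n) - 1)" by (simp only: 3 4)
    finally have "(pi * r\<^sup>2) powr (?k - 1) * (2 * pi * r) = 2 * pi powr ?k * r ^ (CARD('n) - 1)" .
    then show ?thesis using sphere_area_eq[of "CARD('n)"] n by (simp add: mult.assoc mult.left_commute mult.commute)
  qed
  ultimately show "((\<lambda>r. gamma_P ?k (pi * r\<^sup>2)) has_real_derivative
     real CARD('n) * unit_ball_vol (real CARD('n)) * r ^ (CARD('n) - 1) * exp (- pi * r\<^sup>2)) (at r)" by simp
qed (use ab in auto)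

text \<open>The power -n cancels the growth of spheres up to 1/r, hence the logarithm that appears
  in \<open>M2\<close>.\<close>

lemma nn_integral_power_annulus:
  assumes ab: "0 < a" "a \<le> b" and C: "C \<ge> 0"
  shows "(\<integral>\<^sup>+x. ennreal (C / norm (x :: real ^ 'n::finite) ^ CARD('n)) * indicator {x. a < norm x \<and> norm x \<le> b} x \<partial>lborel) =
    ennreal (C * (real CARD('n) * unit_ball_vol (real CARD('n)) * ln (b / a)))"
proof -
  let ?w = "real CARD('n) * unit_ball_vol (real CARD('n))"
  have "(\<integral>\<^sup>+x. ennreal (C / norm (x :: real ^ 'n) ^ CARD('n)) * indicator {x. a < norm x \<and> norm x \<le> b} x \<partial>lborel) =
    ennreal (C * ?w * ln b - C * ?w * ln a)"
  proof (rule nn_integral_annulus[where f = "\<lambda>r. C / r ^ CARD('n)" and F = "\<lambda>r. C * ?w * ln r"])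
    fix r assume r: "a \<le> r" "r \<le> b"
    then have r0: "r > 0" using ab by simp
    have "r ^ CARD('n) = r ^ (CARD('n) - 1) * r" by (metis One_nat_def Suc_pred power_Suc2 zero_less_card_finite)
    then have "?w * r ^ (CARD('n) - 1) * (C / r ^ CARD('n)) = C * ?w * (1 / r)" using r0 by simp
    moreover have "((\<lambda>r. C * ?w * ln r) has_real_derivative C * ?w * (1 / r)) (at r)"
      using r0 by (auto intro!: derivative_eq_intros)
    ultimately show "((\<lambda>r. C * ?w * ln r) has_real_derivative ?w * r ^ (CARD('n) - 1) * (C / r ^ CARD('n))) (at r)" by simp
  qed (use ab C in auto)
  also have "C * ?w * ln b - C * ?w * ln a = C * (?w * ln (b / a))" using ab by (simp add: ln_div algebra_simps)
  finally show ?thesis .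
qed

lemma nn_integral_gauss:
  assumes s: "s > 0"
  shows "(\<integral>\<^sup>+x. ennreal (exp (- pi * (norm (x :: real ^ 'n::finite))\<^sup>2 / s\<^sup>2)) \<partial>lborel) = ennreal (s ^ CARD('n))"
proof -
  have one: "(\<integral>\<^sup>+t. ennreal (exp (- pi * t\<^sup>2 / s\<^sup>2)) \<partial>lborel) = ennreal s"
  proof -
    \<comment> \<open>This standard deviation makes the integrand s times a normal density.\<close>
    define \<sigma> where "\<sigma> = s / sqrt (2 * pi)"
    have sq: "\<sigma>\<^sup>2 = s\<^sup>2 / (2 * pi)" unfolding \<sigma>_def power_divide by (subst real_sqrt_pow2) auto
    have \<sigma>: "\<sigma> > 0" "2 * \<sigma>\<^sup>2 = s\<^sup>2 / pi" "sqrt (2 * pi * \<sigma>\<^sup>2) = s"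
      unfolding sq using s by (auto simp: \<sigma>_def)
    interpret prob_space "density lborel (normal_density 0 \<sigma>)" by (rule prob_space_normal_density[OF \<sigma>(1)])
    have nd: "normal_density 0 \<sigma> t = exp (- pi * t\<^sup>2 / s\<^sup>2) / s" for t
      unfolding normal_density_def \<sigma>(2) using \<sigma>(3) by (simp add: mult.commute)
    have "(\<integral>\<^sup>+t. ennreal (exp (- pi * t\<^sup>2 / s\<^sup>2)) \<partial>lborel) = (\<integral>\<^sup>+t. ennreal s * ennreal (normal_density 0 \<sigma> t) \<partial>lborel)"
      using s by (intro nn_integral_cong) (simp add: nd flip: ennreal_mult)
    also have "\<dots> = ennreal s * (\<integral>\<^sup>+t. ennreal (normal_density 0 \<sigma> t) \<partial>lborel)" by (rule nn_integral_cmult) simp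
    also have "(\<integral>\<^sup>+t. ennreal (normal_density 0 \<sigma> t) \<partial>lborel) = 1"
      using emeasure_space_1 by (simp add: emeasure_density)
    finally show ?thesis by simp
  qed
  let ?f = "\<lambda>t::real. ennreal (exp (- pi * t\<^sup>2 / s\<^sup>2))"
  have "(\<integral>\<^sup>+x. ennreal (exp (- pi * (norm (x :: real ^ 'n))\<^sup>2 / s\<^sup>2)) \<partial>lborel) = (\<integral>\<^sup>+x. (\<Prod>b\<in>Basis. ?f ((x :: real ^ 'n) \<bullet> b)) \<partial>lborel)"
  proof (rule nn_integral_cong)
    fix x :: "real ^ 'n"
    have "(norm x)\<^sup>2 = (\<Sum>b\<in>Basis. (x \<bullet> b)\<^sup>2)" by (subst norm_eq_sqrt_inner, subst euclidean_inner) (simp add: sum_nonneg power2_eq_square)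
    then have "exp (- pi * (norm x)\<^sup>2 / s\<^sup>2) = (\<Prod>b\<in>Basis. exp (- pi * (x \<bullet> b)\<^sup>2 / s\<^sup>2))"
      by (simp add: sum_distrib_left sum_divide_distrib flip: exp_sum)
    then show "ennreal (exp (- pi * (norm x)\<^sup>2 / s\<^sup>2)) = (\<Prod>b\<in>Basis. ?f (x \<bullet> b))" by (simp add: prod_ennreal)
  qed
  also have "\<dots> = (\<Prod>b\<in>(Basis :: (real ^ 'n) set). \<integral>\<^sup>+t. ?f t \<partial>lborel)"
    by (rule nn_integral_lborel_prod) auto
  also have "\<dots> = ennreal s ^ CARD('n)" by (simp only: one prod_constant) simp
  also have "\<dots> = ennreal (s ^ CARD('n))" using s by (simp add: ennreal_power)
  finally show ?thesis .
qed

section \<open>Lower bounds for the Gaussian mass of a lattice\<close>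

definition theta :: "real \<Rightarrow> (real ^ 'n::finite) set \<Rightarrow> ennreal" where
  "theta s L = (\<integral>\<^sup>+v. ennreal (gauss_weight s v) \<partial>count_space L)"

text \<open>Dividing \<Theta> by s^n gives the integral of a Gaussian rounded to the mesh g/s. This
  form serves both for finiteness and for the limit of large s.\<close>

lemma theta_eq_nn_integral_round:
  fixes g :: "real ^ 'n::finite ^ 'n"
  assumes g: "g \<in> SL_real" and s: "s > 0"
  shows "(\<integral>\<^sup>+x. ennreal (exp (- pi * (norm (round_to ((1 / s) *\<^sub>R g) x))\<^sup>2)) \<partial>lborel) = ennreal (1 / s ^ CARD('n)) * theta s (lattice_of g)"
proof -
  let ?M = "(1 / s) *\<^sub>R g"
  have dg: "det g = 1" using g by (simp add: SL_real_def)
  have LM: "lattice_act int_vecs ?M = (\<lambda>v. (1 / s) *\<^sub>R v) ` lattice_of g"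
    by (auto simp: lattice_of_eq lattice_act_def image_image vector_scaleR_matrix_ac scaleR_vector_matrix_assoc)
  have "(\<integral>\<^sup>+x. ennreal (exp (- pi * (norm (round_to ?M x))\<^sup>2)) \<partial>lborel) =
    ennreal \<bar>det ?M\<bar> * (\<integral>\<^sup>+v. ennreal (exp (- pi * (norm v)\<^sup>2)) \<partial>count_space ((\<lambda>v. (1 / s) *\<^sub>R v) ` lattice_of g))"
    unfolding LM[symmetric] by (rule nn_integral_round_to) (use s in \<open>auto simp: det_scaleR dg\<close>)
  also have "(\<integral>\<^sup>+v. ennreal (exp (- pi * (norm v)\<^sup>2)) \<partial>count_space ((\<lambda>v. (1 / s) *\<^sub>R v) ` lattice_of g)) =
    (\<integral>\<^sup>+v. ennreal (exp (- pi * (norm ((1 / s) *\<^sub>R v))\<^sup>2)) \<partial>count_space (lattice_of g))"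
    by (rule nn_integral_bij_count_space[symmetric]) (use s in \<open>auto intro!: inj_on_imp_bij_betw simp: inj_on_def\<close>)
  also have "\<dots> = theta s (lattice_of g)"
    unfolding theta_def gauss_weight_def using s by (intro nn_integral_cong) (simp add: power_divide)
  also have "\<bar>det ?M\<bar> = 1 / s ^ CARD('n)" using s by (simp add: det_scaleR dg power_one_over)
  finally show ?thesis .
qed

text \<open>Rounding moves x by at most \<delta>, so |x|^2 / 2 is at most the rounded squared norm
  plus \<delta>^2; a Gaussian of width sqrt 2 therefore dominates.\<close>

lemma theta_finite:
  fixes L :: "(real ^ 'n::finite) set"
  assumes "L \<in> unimodular_lattices" "s > 0"
  shows "theta s L < \<infinity>"
proof -
  obtain g where g: "g \<in> SL_real" and L: "L = lattice_of g" using assms(1) by (rule unimodular_latticesE)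
  have dg: "det g \<noteq> 0" using g by (simp add: SL_real_def)
  obtain D where D: "D > 0" "\<And>T x. T > 0 \<Longrightarrow> norm (round_to ((1 / T) *\<^sub>R g) x - x) \<le> D / T"
    using norm_round_to_le[OF dg] by blast
  define \<delta> where "\<delta> = D / s"
  have bound: "exp (- pi * (norm (round_to ((1 / s) *\<^sub>R g) x))\<^sup>2) \<le> exp (pi * \<delta>\<^sup>2) * exp (- pi * (norm x)\<^sup>2 / (sqrt 2)\<^sup>2)" for x
  proof -
    let ?r = "round_to ((1 / s) *\<^sub>R g) x"
    have "norm x \<le> norm ?r + norm (?r - x)" by (metis norm_triangle_sub norm_minus_commute)
    then have "norm x \<le> norm ?r + \<delta>" using D(2)[OF assms(2), of x] by (simp add: \<delta>_def)
    then have "(norm x)\<^sup>2 \<le> (norm ?r + \<delta>)\<^sup>2" by (intro power_mono) auto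
    also have "\<dots> \<le> 2 * (norm ?r)\<^sup>2 + 2 * \<delta>\<^sup>2" using zero_le_power2[of "norm ?r - \<delta>"] by (simp add: power2_eq_square algebra_simps)
    finally have "(norm x)\<^sup>2 / 2 \<le> (norm ?r)\<^sup>2 + \<delta>\<^sup>2" by simp
    then have "pi * ((norm x)\<^sup>2 / 2) \<le> pi * ((norm ?r)\<^sup>2 + \<delta>\<^sup>2)" by (intro mult_left_mono) auto
    then have "- pi * (norm ?r)\<^sup>2 \<le> pi * \<delta>\<^sup>2 + - pi * (norm x)\<^sup>2 / (sqrt 2)\<^sup>2" by (simp add: algebra_simps)
    then show ?thesis unfolding exp_add[symmetric] by simp
  qed
  have "ennreal (1 / s ^ CARD('n)) * theta s L = (\<integral>\<^sup>+x. ennreal (exp (- pi * (norm (round_to ((1 / s) *\<^sub>R g) x))\<^sup>2)) \<partial>lborel)"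
    unfolding L by (rule theta_eq_nn_integral_round[OF g assms(2), symmetric])
  also have "\<dots> \<le> (\<integral>\<^sup>+x. ennreal (exp (pi * \<delta>\<^sup>2)) * ennreal (exp (- pi * (norm (x :: real ^ 'n))\<^sup>2 / (sqrt 2)\<^sup>2)) \<partial>lborel)"
    unfolding ennreal_mult[OF exp_ge_zero exp_ge_zero, symmetric] using bound by (intro nn_integral_mono ennreal_leI)
  also have "\<dots> = ennreal (exp (pi * \<delta>\<^sup>2)) * ennreal (sqrt 2 ^ CARD('n))"
    by (subst nn_integral_cmult) (auto simp only: nn_integral_gauss[of "sqrt 2"] real_sqrt_gt_0_iff, measurable)
  also have "\<dots> < \<infinity>" by (simp add: ennreal_mult_less_top)
  finally have "ennreal (1 / s ^ CARD('n)) * theta s L < \<infinity>" .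
  then show ?thesis using assms(2) by (auto simp: ennreal_mult_less_top)
qed

lemmas nn_integral_count_space_UNIV = nn_integral_count_space_indicator[unfolded NO_MATCH_def, OF TrueI]

lemma nn_integral_count_space_Times:
  "(\<integral>\<^sup>+a. p a \<partial>count_space A) * (\<integral>\<^sup>+b. q b \<partial>count_space B) = (\<integral>\<^sup>+z. p (fst z) * q (snd z) \<partial>count_space (A \<times> B))"
proof -
  have "(\<integral>\<^sup>+z. p (fst z) * q (snd z) \<partial>count_space (A \<times> B)) =
     (\<integral>\<^sup>+z. p (fst z) * q (snd z) * indicator (A \<times> B) z \<partial>count_space UNIV)"
    by (rule nn_integral_count_space_UNIV)
  also have "\<dots> = (\<integral>\<^sup>+a. \<integral>\<^sup>+b. p a * q b * indicator (A \<times> B) (a, b) \<partial>count_space UNIV \<partial>count_space UNIV)"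
    by (subst nn_integral_fst_count_space[symmetric]) simp
  also have "\<dots> = (\<integral>\<^sup>+a. \<integral>\<^sup>+b. (p a * indicator A a) * (q b * indicator B b) \<partial>count_space UNIV \<partial>count_space UNIV)"
    by (intro nn_integral_cong) (simp add: indicator_times mult_ac)
  also have "\<dots> = (\<integral>\<^sup>+a. p a * indicator A a \<partial>count_space UNIV) * (\<integral>\<^sup>+b. q b * indicator B b \<partial>count_space UNIV)"
    by (simp add: nn_integral_cmult nn_integral_multc)
  also have "\<dots> = (\<integral>\<^sup>+a. p a \<partial>count_space A) * (\<integral>\<^sup>+b. q b \<partial>count_space B)"
    by (simp only: nn_integral_count_space_UNIV[symmetric])
  finally show ?thesis by simp
qed

lemma nn_integral_count_space_subset_mono:
  assumes "A \<subseteq> B"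
  shows "(\<integral>\<^sup>+x. f x \<partial>count_space A) \<le> (\<integral>\<^sup>+x. f x \<partial>count_space B)"
  unfolding nn_integral_count_space_UNIV[of A] nn_integral_count_space_UNIV[of B]
  using assms by (intro nn_integral_mono mult_left_mono) (auto simp: indicator_def)

text \<open>The pairs \<open>u, w\<close> congruent modulo \<open>2L\<close> correspond to the pairs \<open>a, b\<close> by \<open>u = a + b\<close>, \<open>w = a - b\<close>, and
  \<open>\<bar>u\<bar>\<^sup>2 + \<bar>w\<bar>\<^sup>2 = 2\<bar>a\<bar>\<^sup>2 + 2\<bar>b\<bar>\<^sup>2\<close>; there are \<open>2\<^sup>n\<close> classes modulo \<open>2L\<close>.\<close>

lemma theta_doubling:
  fixes L :: "(real ^ 'n::finite) set"
  assumes L: "L \<in> unimodular_lattices" and s: "s > 0"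
  shows "theta (sqrt 2 * s) L \<le> ennreal (sqrt 2 ^ CARD('n)) * theta s L"
proof -
  obtain g where g: "g \<in> SL_real" and Lg: "L = lattice_of g" using L by (rule unimodular_latticesE)
  have dg: "det g \<noteq> 0" using g by (simp add: SL_real_def)
  define f where "f t a = ennreal (gauss_weight t (a v* g))" for t a
  have bij: "bij_betw (\<lambda>a. a v* g) int_vecs L"
    unfolding Lg lattice_of_eq lattice_act_def using inj_vector_matrix[OF dg] by (intro inj_on_imp_bij_betw) (auto intro: inj_on_subset)
  have th: "theta t L = (\<integral>\<^sup>+a. f t a \<partial>count_space int_vecs)" for t
    unfolding theta_def f_def by (rule nn_integral_bij_count_space[OF bij, symmetric])
  \<comment> \<open>The parity pattern identifies the class of an integer vector modulo 2, so
    classes are indexed by functions into \<open>bool\<close>.\<close>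
  define par :: "real ^ 'n \<Rightarrow> 'n \<Rightarrow> bool" where "par a = (\<lambda>i. odd \<lfloor>a $ i\<rfloor>)" for a
  define Z where "Z t = {a \<in> int_vecs. par a = t}" for t
  define G where "G t = (\<integral>\<^sup>+a. f (sqrt 2 * s) a \<partial>count_space (Z t))" for t
  define h where "h z = f s (fst z) * f s (snd z)" for z
  define \<phi> where "\<phi> = (\<lambda>(a, b). ((1 / 2) *\<^sub>R (a + b), (1 / 2) *\<^sub>R (a - b)) :: (real ^ 'n) \<times> (real ^ 'n))"
  have total: "theta (sqrt 2 * s) L = (\<Sum>t\<in>UNIV. G t)"
  proof -
    have "theta (sqrt 2 * s) L = (\<integral>\<^sup>+a. (\<Sum>t\<in>UNIV. f (sqrt 2 * s) a * indicator (Z t) a) \<partial>count_space UNIV)"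
      unfolding th nn_integral_count_space_UNIV[of int_vecs]
    proof (rule nn_integral_cong)
      fix a :: "real ^ 'n"
      have "(\<Sum>t\<in>UNIV. f (sqrt 2 * s) a * indicator (Z t) a) = (\<Sum>t\<in>UNIV. if t = par a then f (sqrt 2 * s) a * indicator int_vecs a else 0)"
        by (intro sum.cong refl) (auto simp: Z_def indicator_def)
      then show "f (sqrt 2 * s) a * indicator int_vecs a = (\<Sum>t\<in>UNIV. f (sqrt 2 * s) a * indicator (Z t) a)" by simp
    qed
    also have "\<dots> = (\<Sum>t\<in>UNIV. \<integral>\<^sup>+a. f (sqrt 2 * s) a * indicator (Z t) a \<partial>count_space UNIV)"
      by (rule nn_integral_sum) simp
    also have "\<dots> = (\<Sum>t\<in>UNIV. G t)" by (simp only: G_def nn_integral_count_space_UNIV[symmetric])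
    finally show ?thesis .
  qed
  have half: "\<phi> ` (Z t \<times> Z t) \<subseteq> int_vecs \<times> int_vecs" for t
  proof -
    have "(1 / 2) *\<^sub>R (a + b) \<in> int_vecs \<and> (1 / 2) *\<^sub>R (a - b) \<in> int_vecs" if "a \<in> Z t" "b \<in> Z t" for a b
    proof -
      have "(a $ i + b $ i) / 2 \<in> \<int> \<and> (a $ i - b $ i) / 2 \<in> \<int>" for i
      proof -
        have "a $ i \<in> \<int>" "b $ i \<in> \<int>" using that by (auto simp: Z_def int_vecs_def)
        then obtain p q where pq: "a $ i = of_int p" "b $ i = of_int q" by (auto elim!: Ints_cases)
        have "par a = par b" using that by (auto simp: Z_def)
        then have "odd p \<longleftrightarrow> odd q" by (auto simp: par_def fun_eq_iff pq dest!: spec[of _ i])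
        then have "even (p + q)" "even (p - q)" by auto
        then obtain c d where "p + q = 2 * c" "p - q = 2 * d" unfolding dvd_def by blast
        then have "real_of_int (p + q) = real_of_int (2 * c)" "real_of_int (p - q) = real_of_int (2 * d)" by (simp_all only:)
        then have "(a $ i + b $ i) / 2 = of_int c" "(a $ i - b $ i) / 2 = of_int d" unfolding pq by simp_all
        then show ?thesis by simp
      qed
      then show ?thesis by (simp add: int_vecs_def)
    qed
    then show ?thesis by (auto simp: \<phi>_def)
  qed
  have inj\<phi>: "inj \<phi>"
  proof (rule injI, clarify)
    fix a b c d assume "\<phi> (a, b) = \<phi> (c, d)"
    then have "(a + b) = (c + d)" "a - b = c - d" by (auto simp: \<phi>_def)
    then have "(a + b) + (a - b) = (c + d) + (c - d)" "(a + b) - (a - b) = (c + d) - (c - d)" by simp_all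
    then have "2 *\<^sub>R a = 2 *\<^sub>R c" "2 *\<^sub>R b = 2 *\<^sub>R d" by (simp_all add: scaleR_2)
    then show "a = c \<and> b = d" by simp
  qed
  have weight: "f (sqrt 2 * s) a * f (sqrt 2 * s) b = h (\<phi> (a, b))" for a b
  proof -
    let ?x = "a v* g" and ?y = "b v* g"
    have par_law: "(norm ((1 / 2) *\<^sub>R (?x + ?y)))\<^sup>2 + (norm ((1 / 2) *\<^sub>R (?x - ?y)))\<^sup>2 = ((norm ?x)\<^sup>2 + (norm ?y)\<^sup>2) / 2"
      by (simp add: power2_norm_eq_inner inner_simps algebra_simps inner_commute)
    then have e: "- pi * (norm ?x)\<^sup>2 / (sqrt 2 * s)\<^sup>2 + - pi * (norm ?y)\<^sup>2 / (sqrt 2 * s)\<^sup>2 =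
       - pi * (norm ((1 / 2) *\<^sub>R (?x + ?y)))\<^sup>2 / s\<^sup>2 + - pi * (norm ((1 / 2) *\<^sub>R (?x - ?y)))\<^sup>2 / s\<^sup>2"
    proof -
      have "- pi * X / (sqrt 2 * s)\<^sup>2 + - pi * Y / (sqrt 2 * s)\<^sup>2 = - pi * P / s\<^sup>2 + - pi * Q / s\<^sup>2"
        if "P + Q = (X + Y) / 2" for X Y P Q
      proof -
        have "- pi * X / (sqrt 2 * s)\<^sup>2 + - pi * Y / (sqrt 2 * s)\<^sup>2 = - pi * ((X + Y) / 2) / s\<^sup>2"
          using s by (simp add: power_mult_distrib field_simps)
        also have "\<dots> = - pi * P / s\<^sup>2 + - pi * Q / s\<^sup>2"
          unfolding that[symmetric] using s by (simp add: field_simps)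
        finally show ?thesis .
      qed
      from this[OF par_law] show ?thesis .
    qed
    have v: "((1 / 2) *\<^sub>R (a + b)) v* g = (1 / 2) *\<^sub>R (?x + ?y)" "((1 / 2) *\<^sub>R (a - b)) v* g = (1 / 2) *\<^sub>R (?x - ?y)"
      by (simp_all add: scaleR_vector_matrix_assoc vector_matrix_left_distrib vector_matrix_mult_diff_distrib)
    show ?thesis
      unfolding h_def \<phi>_def f_def gauss_weight_def prod.case fst_conv snd_conv v
        ennreal_mult[OF exp_ge_zero exp_ge_zero, symmetric] exp_add[symmetric] e ..
  qed
  have squares: "(\<Sum>t\<in>UNIV. G t * G t) \<le> theta s L * theta s L"
  proof -
    have "G t * G t = (\<integral>\<^sup>+z. h z \<partial>count_space (\<phi> ` (Z t \<times> Z t)))" for t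
    proof -
      have "G t * G t = (\<integral>\<^sup>+z. f (sqrt 2 * s) (fst z) * f (sqrt 2 * s) (snd z) \<partial>count_space (Z t \<times> Z t))"
        unfolding G_def by (rule nn_integral_count_space_Times)
      also have "\<dots> = (\<integral>\<^sup>+z. h (\<phi> z) \<partial>count_space (Z t \<times> Z t))" by (intro nn_integral_cong) (simp add: weight)
      also have "\<dots> = (\<integral>\<^sup>+z. h z \<partial>count_space (\<phi> ` (Z t \<times> Z t)))"
        using inj\<phi> by (intro nn_integral_bij_count_space inj_on_imp_bij_betw) (auto intro: inj_on_subset)
      finally show ?thesis .
    qed
    then have "(\<Sum>t\<in>UNIV. G t * G t) = (\<Sum>t\<in>UNIV. \<integral>\<^sup>+z. h z * indicator (\<phi> ` (Z t \<times> Z t)) z \<partial>count_space UNIV)"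
      by (simp only: nn_integral_count_space_UNIV[symmetric])
    also have "\<dots> = (\<integral>\<^sup>+z. (\<Sum>t\<in>UNIV. h z * indicator (\<phi> ` (Z t \<times> Z t)) z) \<partial>count_space UNIV)"
      by (rule nn_integral_sum[symmetric]) simp
    also have "\<dots> \<le> (\<integral>\<^sup>+z. h z * indicator (int_vecs \<times> int_vecs) z \<partial>count_space UNIV)"
    proof (rule nn_integral_mono)
      fix z
      \<comment> \<open>\<phi> is injective and a pair in \<open>Z t\<close> determines t, so every
        pair of integer vectors is counted at most once.\<close>
      have dis: "\<phi> ` (Z t \<times> Z t) \<inter> \<phi> ` (Z t' \<times> Z t') = {}" if "t \<noteq> t'" for t t'
      proof -
        have "(Z t \<times> Z t) \<inter> (Z t' \<times> Z t') = {}" using that by (auto simp: Z_def)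
        then show ?thesis unfolding image_Int[OF inj\<phi>, symmetric] by simp
      qed
      show "(\<Sum>t\<in>UNIV. h z * indicator (\<phi> ` (Z t \<times> Z t)) z) \<le> h z * indicator (int_vecs \<times> int_vecs) z"
      proof (cases "\<exists>t. z \<in> \<phi> ` (Z t \<times> Z t)")
        case True
        then obtain t where t: "z \<in> \<phi> ` (Z t \<times> Z t)" by blast
        have "(\<Sum>t'\<in>UNIV. h z * indicator (\<phi> ` (Z t' \<times> Z t')) z) = (\<Sum>t'\<in>UNIV. if t' = t then h z else 0)"
          using t dis by (intro sum.cong refl) (auto simp: indicator_def)
        then show ?thesis using t half[of t] by (auto simp: indicator_def)
      qed (auto simp: indicator_def)
    qed
    also have "\<dots> = (\<integral>\<^sup>+z. h z \<partial>count_space (int_vecs \<times> int_vecs))" by (simp only: nn_integral_count_space_UNIV[symmetric])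
    also have "\<dots> = theta s L * theta s L" unfolding h_def th by (rule nn_integral_count_space_Times[symmetric])
    finally show ?thesis .
  qed
  have fin: "theta t L = ennreal (enn2real (theta t L))" if "t > 0" for t
    using theta_finite[OF L that] by simp
  define r where "r t = enn2real (G t)" for t
  have Gr: "G t = ennreal (r t)" for t
  proof -
    have "G t \<le> theta (sqrt 2 * s) L" unfolding total by (rule member_le_sum) auto
    also have "\<dots> < \<infinity>" by (rule theta_finite[OF L]) (use s in simp)
    finally show ?thesis by (simp add: r_def)
  qed
  have r0: "r t \<ge> 0" for t by (simp add: r_def)
  let ?a = "enn2real (theta (sqrt 2 * s) L)" and ?b = "enn2real (theta s L)"
  have a: "?a = (\<Sum>t\<in>UNIV. r t)"
    unfolding total Gr by (simp add: sum_ennreal r0 sum_nonneg)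
  define bb where "bb = ?b"
  have bb: "theta s L = ennreal bb" using fin[OF s] by (simp only: bb_def)
  have bb0: "bb \<ge> 0" by (simp add: bb_def)
  have "ennreal (\<Sum>t\<in>UNIV. r t * r t) = (\<Sum>t\<in>UNIV. G t * G t)"
    unfolding Gr by (subst sum_ennreal[symmetric]) (auto simp: r0 ennreal_mult)
  also have "\<dots> \<le> ennreal (bb * bb)" using squares unfolding bb by (simp add: ennreal_mult bb0)
  finally have "ennreal (\<Sum>t\<in>UNIV. r t * r t) \<le> ennreal (?b * ?b)" by (simp only: bb_def)
  then have b: "(\<Sum>t\<in>UNIV. r t * r t) \<le> ?b * ?b" by (simp add: ennreal_le_iff)
  \<comment> \<open>Cauchy-Schwarz over the 2^n classes: the sum of squares of the class masses,
    bounded above, controls the square of the total mass.\<close>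
  have "?a\<^sup>2 \<le> (\<Sum>t\<in>(UNIV :: ('n \<Rightarrow> bool) set). (r t)\<^sup>2) * real (card (UNIV :: ('n \<Rightarrow> bool) set))"
    unfolding a by (rule sum_squared_le_sum_of_squares)
  also have "real (card (UNIV :: ('n \<Rightarrow> bool) set)) = 2 ^ CARD('n)" by (simp add: card_fun)
  also have "(\<Sum>t\<in>UNIV. (r t)\<^sup>2) * 2 ^ CARD('n) \<le> ?b\<^sup>2 * (sqrt 2 ^ CARD('n))\<^sup>2"
    using b by (intro mult_mono) (auto simp: power2_eq_square simp flip: power_mult_distrib intro!: sum_nonneg)
  finally have "?a\<^sup>2 \<le> (sqrt 2 ^ CARD('n) * ?b)\<^sup>2" by (simp add: power_mult_distrib mult.commute)
  then have "?a \<le> sqrt 2 ^ CARD('n) * ?b" by (rule power2_le_imp_le) simp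
  then have "ennreal ?a \<le> ennreal (sqrt 2 ^ CARD('n)) * ennreal ?b" by (simp flip: ennreal_mult)
  then show ?thesis using fin[of "sqrt 2 * s"] fin[OF s] s by simp
qed

text \<open>By doubling, \<open>\<Theta>\<^sub>s / s\<^sup>n\<close> decreases along \<open>s, sqrt 2 s, 2 s, \<dots>\<close>, and its limit is \<open>1\<close>.\<close>

lemma theta_ge_power:
  fixes L :: "(real ^ 'n::finite) set"
  assumes L: "L \<in> unimodular_lattices" and s: "s > 0"
  shows "ennreal (s ^ CARD('n)) \<le> theta s L"
proof -
  obtain g where g: "g \<in> SL_real" and Lg: "L = lattice_of g" using L by (rule unimodular_latticesE)
  have dg: "det g \<noteq> 0" using g by (simp add: SL_real_def)
  obtain D where D: "D > 0" "\<And>T x. T > 0 \<Longrightarrow> norm (round_to ((1 / T) *\<^sub>R g) x - x) \<le> D / T"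
    using norm_round_to_le[OF dg] by blast
  define w where "w j = sqrt 2 ^ j * s" for j :: nat
  have w0: "w j > 0" for j using s by (simp add: w_def)
  define q where "q t = ennreal (1 / t ^ CARD('n)) * theta t L" for t
  have dec: "q (w (Suc j)) \<le> q (w j)" for j
  proof -
    have "q (w (Suc j)) = ennreal (1 / w (Suc j) ^ CARD('n)) * theta (sqrt 2 * w j) L" by (simp add: q_def w_def mult.assoc)
    also have "\<dots> \<le> ennreal (1 / w (Suc j) ^ CARD('n)) * (ennreal (sqrt 2 ^ CARD('n)) * theta (w j) L)"
      by (intro mult_left_mono theta_doubling[OF L w0]) simp
    also have "\<dots> = ennreal (1 / w (Suc j) ^ CARD('n) * sqrt 2 ^ CARD('n)) * theta (w j) L"
      using w0[of "Suc j"] by (subst ennreal_mult) (auto simp: mult.assoc less_imp_le)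
    also have "1 / w (Suc j) ^ CARD('n) * sqrt 2 ^ CARD('n) = 1 / w j ^ CARD('n)"
      by (simp add: w_def power_mult_distrib)
    finally show ?thesis by (simp add: q_def)
  qed
  have le: "q (w j) \<le> q s" for j
    by (induction j) (use dec order_trans in \<open>auto simp: w_def\<close>)
  have winf: "filterlim w at_top sequentially"
    unfolding w_def[abs_def] using s
    by (intro filterlim_at_top_mult_tendsto_pos[OF tendsto_const]
      filterlim_at_infinity_imp_filterlim_at_top[OF filterlim_realpow_sequentially_gt1]) auto
  \<comment> \<open>Fatou's lemma suffices here: it gives 1 as a lower bound for the liminf along
    the sequence of widths, and q s dominates all members of the sequence.\<close>
  have "1 = (\<integral>\<^sup>+x. ennreal (exp (- pi * (norm (x :: real ^ 'n))\<^sup>2)) \<partial>lborel)"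
    using nn_integral_gauss[of 1, where 'n = 'n] by simp
  also have "\<dots> = (\<integral>\<^sup>+x. liminf (\<lambda>j. ennreal (exp (- pi * (norm (round_to ((1 / w j) *\<^sub>R g) x))\<^sup>2))) \<partial>lborel)"
  proof (rule nn_integral_cong)
    fix x :: "real ^ 'n"
    have "(\<lambda>j. round_to ((1 / w j) *\<^sub>R g) x - x) \<longlonglongrightarrow> 0"
    proof (rule Lim_null_comparison)
      show "\<forall>\<^sub>F j in sequentially. norm (round_to ((1 / w j) *\<^sub>R g) x - x) \<le> D / w j" using D(2) w0 by auto
      show "(\<lambda>j. D / w j) \<longlonglongrightarrow> 0" by (rule real_tendsto_divide_at_top[OF tendsto_const winf])
    qed
    then have "(\<lambda>j. round_to ((1 / w j) *\<^sub>R g) x) \<longlonglongrightarrow> x" by (simp add: LIM_zero_iff)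
    then have "(\<lambda>j. ennreal (exp (- pi * (norm (round_to ((1 / w j) *\<^sub>R g) x))\<^sup>2))) \<longlonglongrightarrow> ennreal (exp (- pi * (norm x)\<^sup>2))"
      by (intro tendsto_intros)
    then show "ennreal (exp (- pi * (norm x)\<^sup>2)) = liminf (\<lambda>j. ennreal (exp (- pi * (norm (round_to ((1 / w j) *\<^sub>R g) x))\<^sup>2)))"
      using lim_imp_Liminf[OF sequentially_bot] by metis
  qed
  also have "\<dots> \<le> liminf (\<lambda>j. \<integral>\<^sup>+x. ennreal (exp (- pi * (norm (round_to ((1 / w j) *\<^sub>R g) x))\<^sup>2)) \<partial>lborel)"
    by (rule nn_integral_liminf) measurable
  also have "(\<lambda>j. \<integral>\<^sup>+x. ennreal (exp (- pi * (norm (round_to ((1 / w j) *\<^sub>R g) x))\<^sup>2)) \<partial>lborel) = (\<lambda>j. q (w j))"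
    unfolding q_def Lg using theta_eq_nn_integral_round[OF g w0] by simp
  also have "liminf (\<lambda>j. q (w j)) \<le> liminf (\<lambda>j::nat. q s)" by (intro Liminf_mono always_eventually allI le)
  also have "\<dots> = q s" by (simp add: Liminf_const)
  finally have "ennreal (s ^ CARD('n)) * 1 \<le> ennreal (s ^ CARD('n)) * q s" by (intro mult_left_mono) auto
  also have "\<dots> = ennreal (s ^ CARD('n) * (1 / s ^ CARD('n))) * theta s L"
    unfolding q_def using s by (subst ennreal_mult) (auto simp: mult.assoc)
  finally show ?thesis using s by simp
qed

lemma theta_ge_1:
  fixes L :: "(real ^ 'n::finite) set"
  assumes "0 \<in> L"
  shows "1 \<le> theta s L"
proof -
  have "(\<integral>\<^sup>+v. ennreal (gauss_weight s v) \<partial>count_space {0 :: real ^ 'n}) \<le> theta s L"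
    unfolding theta_def using assms by (intro nn_integral_count_space_subset_mono) auto
  then show ?thesis by (simp add: nn_integral_count_space_finite gauss_weight_def)
qed

section \<open>Gaussian mass of short vectors\<close>

text \<open>The parameter \<open>t\<close> covers several cases at once: the multiple \<open>(m + 1) w\<close> of a primitive \<open>w\<close> is selected by
  its own length for \<open>t = Suc\<close>, by the length of its primitive part for \<open>t = (\<lambda>_. 1)\<close>, and always (\<open>r = 0\<close>)
  for \<open>t = (\<lambda>_. 0)\<close>.\<close>

definition part_mass :: "(nat \<Rightarrow> nat) \<Rightarrow> real \<Rightarrow> real \<Rightarrow> (real ^ 'n::finite) set \<Rightarrow> ennreal" where
  "part_mass t s r L = primitive_sum (\<lambda>w. \<Sum>m. ennreal (gauss_weight s (real (Suc m) *\<^sub>R w)) *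
     indicator {w. real (t m) * norm w \<le> r} w) L"

definition selected :: "(nat \<Rightarrow> nat) \<Rightarrow> real \<Rightarrow> (real ^ 'n::finite) set \<Rightarrow> (real ^ 'n) set" where
  "selected t r L = {real (Suc m) *\<^sub>R w | m w. w \<in> primitives L \<and> real (t m) * norm w \<le> r}"

lemma gauss_weight_nonneg: "gauss_weight s v \<ge> 0"
  by (simp add: gauss_weight_def)

text \<open>Links the real normalising sum in \<open>discrete_gaussian\<close> with
  \<open>theta\<close>; finiteness of \<open>theta\<close> supplies the summability without which
  \<open>infsum\<close> would default to 0.\<close>

lemma infsum_gauss_weight:
  assumes "L \<in> unimodular_lattices" "s > 0"
  shows "(\<Sum>\<^sub>\<infinity>x\<in>L. gauss_weight s x) = enn2real (theta s L)"
proof -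
  have int: "integrable (count_space L) (gauss_weight s)"
    using theta_finite[OF assms] by (intro integrableI_nonneg) (auto simp: theta_def gauss_weight_nonneg)
  have "infsetsum (gauss_weight s) L = infsum (gauss_weight s) L"
    by (rule infsetsum_infsum) (use int in \<open>simp add: Infinite_Set_Sum.abs_summable_on_def\<close>)
  moreover have "infsetsum (gauss_weight s) L = enn2real (theta s L)"
    unfolding infsetsum_def theta_def by (rule integral_eq_nn_integral) (auto simp: gauss_weight_nonneg)
  ultimately show ?thesis by simp
qed

context
  fixes L :: "(real ^ 'n::finite) set" and s :: real
  assumes L: "L \<in> unimodular_lattices" and s: "s > 0"
begin

interpretation discrete_subgroup L by (rule discrete_subgroup_unimodular[OF L])

lemma theta_real: "theta s L = ennreal (enn2real (theta s L))" "enn2real (theta s L) \<ge> 1"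
proof -
  show 1: "theta s L = ennreal (enn2real (theta s L))" using theta_finite[OF L s] by simp
  have "ennreal 1 \<le> ennreal (enn2real (theta s L))" using theta_ge_1[OF zero_closed, of s] 1 by simp
  then show "enn2real (theta s L) \<ge> 1" by (simp only: ennreal_le_iff enn2real_nonneg)
qed

text \<open>Unique decomposition into a multiple and a primitive vector turns the double sum into a
  sum over the lattice.\<close>

lemma part_mass_eq: "part_mass t s r L = (\<integral>\<^sup>+v. ennreal (gauss_weight s v) * indicator (selected t r L) v \<partial>count_space L)"
proof -
  let ?h = "\<lambda>(m, w). real (Suc m) *\<^sub>R w"
  let ?F = "\<lambda>v. ennreal (gauss_weight s v) * indicator (selected t r L) v"
  let ?G = "\<lambda>m w. ennreal (gauss_weight s (real (Suc m) *\<^sub>R w)) * indicator {w. real (t m) * norm w \<le> r} w"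
  have sel: "real (Suc m) *\<^sub>R w \<in> selected t r L \<longleftrightarrow> real (t m) * norm w \<le> r" if "w \<in> primitives L" for m w
  proof
    assume "real (Suc m) *\<^sub>R w \<in> selected t r L"
    then obtain m' w' where *: "real (Suc m) *\<^sub>R w = real (Suc m') *\<^sub>R w'" "w' \<in> primitives L" "real (t m') * norm w' \<le> r"
      unfolding selected_def by blast
    then have "Suc m = Suc m' \<and> w = w'"
      using that by (intro primitive_decomp_unique) (simp_all add: primitives_def del: of_nat_Suc)
    then show "real (t m) * norm w \<le> r" using * by simp
  qed (use that in \<open>auto simp: selected_def simp del: of_nat_Suc\<close>)
  have "(\<integral>\<^sup>+v. ?F v \<partial>count_space L) = (\<integral>\<^sup>+v. ?F v \<partial>count_space (L - {0}))"
  proof -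
    have "0 \<notin> selected t r L" using primitive_nonzero by (auto simp: selected_def primitives_def simp del: of_nat_Suc)
    then have "?F v * indicator L v = ?F v * indicator (L - {0}) v" for v by (auto simp: indicator_def)
    then show ?thesis unfolding nn_integral_count_space_UNIV[of L] nn_integral_count_space_UNIV[of "L - {0}"] by simp
  qed
  also have "\<dots> = (\<integral>\<^sup>+p. ?F (?h p) \<partial>count_space (UNIV \<times> primitives L))"
    by (rule nn_integral_bij_count_space[OF bij_betw_nonzero_vectors, symmetric])
  also have "\<dots> = (\<integral>\<^sup>+p. ?G (fst p) (snd p) * indicator (primitives L) (snd p) \<partial>count_space UNIV)"
    unfolding nn_integral_count_space_UNIV[of "UNIV \<times> primitives L"]
    using sel by (intro nn_integral_cong) (auto simp: indicator_def simp del: of_nat_Suc)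
  also have "\<dots> = (\<integral>\<^sup>+w. \<integral>\<^sup>+m. ?G m w * indicator (primitives L) w \<partial>count_space UNIV \<partial>count_space UNIV)"
    by (subst nn_integral_snd_count_space[symmetric]) simp
  also have "\<dots> = (\<integral>\<^sup>+w. (\<Sum>m. ?G m w) * indicator (primitives L) w \<partial>count_space UNIV)"
    by (intro nn_integral_cong) (simp only: nn_integral_count_space_nat ennreal_suminf_multc)
  also have "\<dots> = part_mass t s r L"
    unfolding part_mass_def primitive_sum_def by (simp only: nn_integral_count_space_UNIV[symmetric])
  finally show ?thesis by simp
qed

lemma selected_subset: "selected t r L \<subseteq> L"
  using primitives_subset scaleR_nat_closed by (auto simp: selected_def simp del: of_nat_Suc)

lemma part_mass_le_theta: "part_mass t s r L \<le> theta s L"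
  unfolding part_mass_eq theta_def by (intro nn_integral_mono) (auto simp: indicator_def)

lemma part_mass_real: "part_mass t s r L = ennreal (enn2real (part_mass t s r L))"
proof -
  have "part_mass t s r L < \<top>" using le_less_trans[OF part_mass_le_theta theta_finite[OF L s]] by simp
  then show ?thesis by simp
qed

lemma measure_discrete_gaussian:
  "measure (discrete_gaussian L s) (selected t r L) = enn2real (part_mass t s r L) / enn2real (theta s L)"
proof -
  let ?\<Theta> = "enn2real (theta s L)"
  have pos: "?\<Theta> > 0" using theta_real(2) by simp
  have "emeasure (discrete_gaussian L s) (selected t r L) =
    (\<integral>\<^sup>+v. ennreal (gauss_weight s v / ?\<Theta>) * indicator (selected t r L) v \<partial>count_space L)"
    unfolding discrete_gaussian_def infsum_gauss_weight[OF L s]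
    by (rule emeasure_density) (use selected_subset in auto)
  also have "\<dots> = (\<integral>\<^sup>+v. ennreal (1 / ?\<Theta>) * (ennreal (gauss_weight s v) * indicator (selected t r L) v) \<partial>count_space L)"
    using pos by (intro nn_integral_cong) (simp add: gauss_weight_nonneg ennreal_mult[symmetric] mult.assoc[symmetric])
  also have "\<dots> = ennreal (1 / ?\<Theta>) * part_mass t s r L"
    unfolding part_mass_eq by (rule nn_integral_cmult) simp
  also have "\<dots> = ennreal (enn2real (part_mass t s r L) / ?\<Theta>)"
    by (subst part_mass_real) (use pos in \<open>simp add: ennreal_mult[symmetric]\<close>)
  finally show ?thesis unfolding measure_def using pos by simp
qed

text \<open>The lengths t(m) |w| that are compared with r are lengths of lattice vectors, hence
  discrete, and a slightly larger rational radius selects the same vectors. This makes a radius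
  depending on L measurable.\<close>

lemma part_mass_gap: "\<exists>q\<in>\<rat>. r < q \<and> part_mass t s q L = part_mass t s r L"
proof -
  define V where "V = norm ` (L \<inter> cball 0 (\<bar>r\<bar> + 1)) \<inter> {r<..}"
  have fin: "finite (insert (\<bar>r\<bar> + 1) V)" using finite_bounded[of "cball 0 (\<bar>r\<bar> + 1)"] by (simp add: V_def)
  have "r < Min (insert (\<bar>r\<bar> + 1) V)" using fin by (subst Min_gr_iff) (auto simp: V_def)
  then obtain q where q: "q \<in> \<rat>" "r < q" "q < Min (insert (\<bar>r\<bar> + 1) V)" using Rats_dense_in_real by blast
  have gap: "norm v \<le> q \<longleftrightarrow> norm v \<le> r" if "v \<in> L" for v
  proof
    assume v: "norm v \<le> q"
    show "norm v \<le> r"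
    proof (rule ccontr)
      assume "\<not> norm v \<le> r"
      moreover have "q < \<bar>r\<bar> + 1" using q(3) fin by (subst (asm) Min_gr_iff) auto
      ultimately have "norm v \<in> V" using v that by (auto simp: V_def)
      then have "q < norm v" using q(3) fin by (subst (asm) Min_gr_iff) auto
      then show False using v by simp
    qed
  qed (use q in simp)
  have "real (t m) * norm w \<le> q \<longleftrightarrow> real (t m) * norm w \<le> r" if "w \<in> primitives L" for m w
    using gap[of "real (t m) *\<^sub>R w"] that primitives_subset scaleR_nat_closed by auto
  then have "part_mass t s q L = part_mass t s r L"
    unfolding part_mass_def primitive_sum_def
    by (intro nn_integral_cong suminf_cong) (auto simp: indicator_def simp del: of_nat_Suc)
  then show ?thesis using q by blast
qed

text \<open>With t = 0 and r = 0 all nonzero vectors are selected, so measurability of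
  \<open>theta\<close> reduces to that of \<open>part_mass\<close>.\<close>

lemma theta_eq_part_mass: "theta s L = 1 + part_mass (\<lambda>_. 0) s 0 L"
proof -
  have "selected (\<lambda>_. 0) 0 L = L - {0}"
  proof -
    have "selected (\<lambda>_. 0) 0 L = (\<lambda>(m, w). real (Suc m) *\<^sub>R w) ` (UNIV \<times> primitives L)"
      unfolding selected_def image_def by auto
    then show ?thesis using bij_betw_imp_surj_on[OF bij_betw_nonzero_vectors] by simp
  qed
  then have "part_mass (\<lambda>_. 0) s 0 L = (\<integral>\<^sup>+v. ennreal (gauss_weight s v) * indicator (L - {0}) v \<partial>count_space UNIV)"
    unfolding part_mass_eq nn_integral_count_space_UNIV[of L] by (intro nn_integral_cong) (auto simp: indicator_def)
  moreover have "theta s L = (\<integral>\<^sup>+v. ennreal (gauss_weight s v) * indicator {0} v + ennreal (gauss_weight s v) * indicator (L - {0}) v \<partial>count_space UNIV)"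
    unfolding theta_def nn_integral_count_space_UNIV[of L] using zero_closed by (intro nn_integral_cong) (auto simp: indicator_def)
  moreover have "(\<integral>\<^sup>+v. ennreal (gauss_weight s v) * indicator {0 :: real ^ 'n} v \<partial>count_space UNIV) = 1"
    unfolding nn_integral_count_space_UNIV[symmetric] by (simp add: nn_integral_count_space_finite gauss_weight_def)
  ultimately show ?thesis by (simp add: nn_integral_add)
qed

end

section \<open>Measurability of the masses and of the shortest length\<close>

lemma borel_measurable_gauss_weight [measurable]: "gauss_weight s \<in> borel_measurable borel"
  unfolding gauss_weight_def by (cases "s = 0") (auto intro!: borel_measurable_continuous_onI continuous_intros)

lemma part_mass_measurable: "part_mass t s r \<in> borel_measurable lattice_borel"
proof -
  have "(\<lambda>w. \<Sum>m. ennreal (gauss_weight s (real (Suc m) *\<^sub>R w)) * indicator {w. real (t m) * norm w \<le> r} w)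
    \<in> borel_measurable (borel :: (real ^ 'n::finite) measure)" by measurable
  from primitive_sum_measurable[OF this] show ?thesis by (simp only: part_mass_def[abs_def])
qed

text \<open>A shortest vector can be taken primitive, so the shortest length is governed by counts
  of primitive vectors, which are measurable.\<close>

lemma lambda1_less_iff:
  assumes "L \<in> unimodular_lattices"
  shows "lambda1 L < x \<longleftrightarrow> primitives L \<inter> ball 0 x \<noteq> {}" "lambda1 L \<le> x \<longleftrightarrow> primitives L \<inter> cball 0 x \<noteq> {}"
proof -
  interpret discrete_subgroup L by (rule discrete_subgroup_unimodular[OF assms])
  obtain w where w: "primitive_in L w" "norm w = lambda1 L" by (rule primitive_lambda1)
  have le: "lambda1 L \<le> norm v" if "v \<in> primitives L" for v
    using that lambda1_le[of v] primitive_nonzero by (auto simp: primitives_def primitive_in_def)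
  show "lambda1 L < x \<longleftrightarrow> primitives L \<inter> ball 0 x \<noteq> {}"
    using w le by (force simp: primitives_def)
  show "lambda1 L \<le> x \<longleftrightarrow> primitives L \<inter> cball 0 x \<noteq> {}"
    using w le by (force simp: primitives_def)
qed

context
  fixes \<mu> :: "(real ^ 'n::finite) set measure"
  assumes sets: "sets \<mu> = sets lattice_borel"
begin

lemma space_eq: "space \<mu> = unimodular_lattices"
  using sets_eq_imp_space_eq[OF sets] by simp

lemma part_mass_measurable' [measurable]: "part_mass t s r \<in> borel_measurable \<mu>"
  unfolding measurable_cong_sets[OF sets refl] by (rule part_mass_measurable)

lemma theta_measurable:
  assumes "s > 0"
  shows "theta s \<in> borel_measurable \<mu>"
proof -
  have "(\<lambda>L. 1 + part_mass (\<lambda>_. 0) s 0 L) \<in> borel_measurable \<mu>" by measurable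
  then show ?thesis by (subst measurable_cong[OF theta_eq_part_mass]) (auto simp: space_eq assms)
qed

lemma lambda1_measurable [measurable]: "lambda1 \<in> borel_measurable \<mu>"
proof (rule borel_measurable_iff_less[THEN iffD2], rule allI)
  fix x
  have "{L \<in> space \<mu>. lambda1 L < x} = {L \<in> space \<mu>. real (card (primitives L \<inter> ball 0 x)) \<noteq> 0}"
  proof (intro Collect_cong conj_cong refl)
    fix L assume "L \<in> space \<mu>"
    then have L: "L \<in> unimodular_lattices" by (simp only: space_eq)
    have "finite (primitives L \<inter> ball 0 x)" by (rule primitive_sum_indicator(1)[OF L bounded_ball])
    then show "lambda1 L < x \<longleftrightarrow> real (card (primitives L \<inter> ball 0 x)) \<noteq> 0"
      unfolding lambda1_less_iff(1)[OF L] by simp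
  qed
  also have "\<dots> \<in> sets \<mu>"
    using card_primitives_measurable[OF sets, of "ball 0 x"] by measurable
  finally show "{L \<in> space \<mu>. lambda1 L < x} \<in> sets \<mu>" .
qed

text \<open>The radius varies with L. As the mass increases with the radius, it is the infimum over
  rational radii above it, attained by \<open>part_mass_gap\<close>.\<close>

lemma part_mass_lambda1_measurable:
  assumes "s > 0"
  shows "(\<lambda>L. part_mass t s (\<gamma> * lambda1 L) L) \<in> borel_measurable \<mu>"
proof -
  \<comment> \<open>The value \<open>\<top>\<close> makes inadmissible rationals neutral for the
    infimum.\<close>
  have "(\<lambda>L. INF q\<in>\<rat>. if \<gamma> * lambda1 L < q then part_mass t s q L else \<top>) \<in> borel_measurable \<mu>"
    by (rule borel_measurable_INF[OF countable_rat]) measurable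
  moreover have "(INF q\<in>\<rat>. if \<gamma> * lambda1 L < q then part_mass t s q L else \<top>) = part_mass t s (\<gamma> * lambda1 L) L"
    if "L \<in> space \<mu>" for L
  proof (rule antisym)
    have L: "L \<in> unimodular_lattices" using that by (simp only: space_eq)
    obtain q where q: "q \<in> \<rat>" "\<gamma> * lambda1 L < q" "part_mass t s q L = part_mass t s (\<gamma> * lambda1 L) L"
      using part_mass_gap[OF L assms, of "\<gamma> * lambda1 L" t] by blast
    have "(INF q\<in>\<rat>. if \<gamma> * lambda1 L < q then part_mass t s q L else \<top>) \<le> (if \<gamma> * lambda1 L < q then part_mass t s q L else \<top>)"
      by (rule INF_lower[OF q(1)])
    then show "(INF q\<in>\<rat>. if \<gamma> * lambda1 L < q then part_mass t s q L else \<top>) \<le> part_mass t s (\<gamma> * lambda1 L) L" using q by simp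
    have "part_mass t s (\<gamma> * lambda1 L) L \<le> part_mass t s q' L" if "\<gamma> * lambda1 L < q'" for q'
      unfolding part_mass_def primitive_sum_def using that
      by (intro nn_integral_mono suminf_le summableI mult_left_mono) (auto simp: indicator_def)
    then show "part_mass t s (\<gamma> * lambda1 L) L \<le> (INF q\<in>\<rat>. if \<gamma> * lambda1 L < q then part_mass t s q L else \<top>)"
      by (intro INF_greatest) auto
  qed
  ultimately show ?thesis by (subst measurable_cong[symmetric]) auto
qed

end

text \<open>The common form of both probabilities, so that measurability and the estimate are proved
  once; only t distinguishes them.\<close>

definition mass_ratio :: "(nat \<Rightarrow> nat) \<Rightarrow> real \<Rightarrow> real \<Rightarrow> (real ^ 'n::finite) set \<Rightarrow> real" where
  "mass_ratio t \<gamma> c L = enn2real (part_mass t (gauss_width CARD('n) c) (\<gamma> * lambda1 L) L) / enn2real (theta (gauss_width CARD('n) c) L)"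

lemma GH_pos: "n > 0 \<Longrightarrow> GH n > 0"
  using unit_ball_vol_pos[of "real n"] by (simp add: GH_def less_imp_neq[symmetric])

lemma gauss_width_pos: "c > 0 \<Longrightarrow> gauss_width CARD('n::finite) c > 0"
  using GH_pos[of "CARD('n)"] by (simp add: gauss_width_def)

lemma u_prob_eq:
  fixes L :: "(real ^ 'n::finite) set"
  assumes L: "L \<in> unimodular_lattices" and c: "c > 0"
  shows "u_prob \<gamma> c L = mass_ratio Suc \<gamma> c L" "u_hat_prob \<gamma> c L = mass_ratio (\<lambda>_. 1) \<gamma> c L"
proof -
  interpret discrete_subgroup L by (rule discrete_subgroup_unimodular[OF L])
  have nz: "w \<noteq> 0" if "w \<in> primitives L" for w using that primitive_nonzero by (auto simp: primitives_def)
  have inL: "real (Suc m) *\<^sub>R w \<in> L" if "w \<in> primitives L" for m w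
    using that primitives_subset scaleR_nat_closed by blast
  have decomp: "\<exists>m. \<exists>w \<in> primitives L. v = real (Suc m) *\<^sub>R w" if v: "v \<in> L" "v \<noteq> 0" for v
  proof -
    obtain m w where mw: "m \<ge> (1::nat)" "primitive_in L w" "v = real m *\<^sub>R w" using primitive_decomp[OF v] .
    then show ?thesis by (intro exI[of _ "m - 1"] bexI[of _ w]) (auto simp: primitives_def)
  qed
  have pp: "primitive_part L (real (Suc m) *\<^sub>R w) = w" if "w \<in> primitives L" for m w
    using that by (intro primitive_part_eq) (auto simp: primitives_def)
  have "{v \<in> L. 0 < norm v \<and> norm v \<le> \<gamma> * lambda1 L} = selected Suc (\<gamma> * lambda1 L) L"
  proof (intro equalityI subsetI)
    fix v assume v: "v \<in> {v \<in> L. 0 < norm v \<and> norm v \<le> \<gamma> * lambda1 L}"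
    then obtain m w where "w \<in> primitives L" "v = real (Suc m) *\<^sub>R w" using decomp[of v] by auto
    then show "v \<in> selected Suc (\<gamma> * lambda1 L) L"
      using v unfolding selected_def by (auto simp del: of_nat_Suc)
  qed (use inL nz in \<open>auto simp: selected_def simp del: of_nat_Suc\<close>)
  then show "u_prob \<gamma> c L = mass_ratio Suc \<gamma> c L"
    unfolding u_prob_def mass_ratio_def by (simp add: measure_discrete_gaussian[OF L gauss_width_pos[OF c]])
  have "{v \<in> L. 0 < norm (primitive_part L v) \<and> norm (primitive_part L v) \<le> \<gamma> * lambda1 L} = selected (\<lambda>_. 1) (\<gamma> * lambda1 L) L"
  proof (intro equalityI subsetI)
    fix v assume v: "v \<in> {v \<in> L. 0 < norm (primitive_part L v) \<and> norm (primitive_part L v) \<le> \<gamma> * lambda1 L}"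
    then have "v \<noteq> 0" by (auto simp: primitive_part_def)
    then obtain m w where "w \<in> primitives L" "v = real (Suc m) *\<^sub>R w" using decomp[of v] v by auto
    then show "v \<in> selected (\<lambda>_. 1) (\<gamma> * lambda1 L) L"
      using v pp unfolding selected_def by (intro CollectI exI[of _ m] exI[of _ w]) (simp del: of_nat_Suc)
  qed (use inL nz pp in \<open>auto simp: selected_def simp del: of_nat_Suc\<close>)
  then show "u_hat_prob \<gamma> c L = mass_ratio (\<lambda>_. 1) \<gamma> c L"
    unfolding u_hat_prob_def mass_ratio_def by (simp add: measure_discrete_gaussian[OF L gauss_width_pos[OF c]])
qed

lemma mass_ratio_bounds:
  fixes L :: "(real ^ 'n::finite) set"
  assumes L: "L \<in> unimodular_lattices" and c: "c > 0"
  shows "0 \<le> mass_ratio t \<gamma> c L" "mass_ratio t \<gamma> c L \<le> 1"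
proof -
  note s = gauss_width_pos[OF c, where 'n = 'n]
  show "0 \<le> mass_ratio t \<gamma> c L" by (simp add: mass_ratio_def)
  have "enn2real (part_mass t (gauss_width CARD('n) c) (\<gamma> * lambda1 L) L) \<le> enn2real (theta (gauss_width CARD('n) c) L)"
    using part_mass_le_theta[OF L s] theta_finite[OF L s] by (intro enn2real_mono) auto
  then show "mass_ratio t \<gamma> c L \<le> 1"
    using theta_real(2)[OF L s] by (simp add: mass_ratio_def divide_le_eq)
qed

text \<open>The exponent is linear in c, which makes monotonicity and continuity in c
  visible.\<close>

lemma gauss_weight_width:
  fixes v :: "real ^ 'n::finite"
  assumes "c > 0"
  shows "gauss_weight (gauss_width CARD('n) c) v = exp (- (c * (real CARD('n) * (norm v)\<^sup>2 / (2 * (GH CARD('n))\<^sup>2))))"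
proof -
  have "(gauss_width CARD('n) c)\<^sup>2 = 2 * pi * (GH CARD('n))\<^sup>2 / (c * real CARD('n))"
    using assms unfolding gauss_width_def by (intro real_sqrt_pow2) auto
  then show ?thesis
    using GH_pos[of "CARD('n)"] unfolding gauss_weight_def by (simp only:) (simp add: field_simps)
qed

lemma gauss_weight_width_antimono:
  fixes v :: "real ^ 'n::finite"
  assumes "0 < c" "c \<le> c'"
  shows "gauss_weight (gauss_width CARD('n) c') v \<le> gauss_weight (gauss_width CARD('n) c) v"
proof -
  have "c' > 0" using assms by simp
  have "c * (real CARD('n) * (norm v)\<^sup>2 / (2 * (GH CARD('n))\<^sup>2)) \<le> c' * (real CARD('n) * (norm v)\<^sup>2 / (2 * (GH CARD('n))\<^sup>2))"
    by (intro mult_right_mono assms) simp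
  then show ?thesis
    unfolding gauss_weight_width[OF \<open>0 < c\<close>] gauss_weight_width[OF \<open>c' > 0\<close>] by (simp only: exp_le_cancel_iff neg_le_iff_le)
qed

text \<open>It suffices to approach \<open>c\<close> from the left: the numerator is decreasing in \<open>c\<close> and the denominator is continuous.\<close>

lemma mass_ratio_rational:
  fixes L :: "(real ^ 'n::finite) set"
  assumes L: "L \<in> unimodular_lattices" and c: "c > 0" and U: "mass_ratio t \<gamma> c L > U"
  shows "\<exists>q\<in>\<rat>. q > 0 \<and> mass_ratio t \<gamma> q L > U"
proof -
  let ?s = "gauss_width CARD('n)"
  let ?A = "\<lambda>c. enn2real (part_mass t (?s c) (\<gamma> * lambda1 L) L)" and ?B = "\<lambda>c. enn2real (theta (?s c) L)"
  \<comment> \<open>The offset 2 in the denominator keeps all chosen rationals above c/2, so the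
    weights at c/2 dominate all the others.\<close>
  have "\<exists>q\<in>\<rat>. c * (1 - 1 / real (j + 2)) < q \<and> q < c" for j
    using Rats_dense_in_real[of "c * (1 - 1 / real (j + 2))" c] c by (simp add: field_simps)
  then obtain q where q: "\<And>j. q j \<in> \<rat>" "\<And>j. c * (1 - 1 / real (j + 2)) < q j" "\<And>j. q j < c" by metis
  have qhalf: "q j > c / 2" for j
  proof -
    have "1 / real (j + 2) \<le> 1 / 2" by (intro divide_left_mono) auto
    then have "c * (1 / 2) \<le> c * (1 - 1 / real (j + 2))" using c by (intro mult_left_mono) auto
    then show ?thesis using q(2)[of j] by linarith
  qed
  have qpos: "q j > 0" for j using qhalf[of j] c by simp
  have qlim: "q \<longlonglongrightarrow> c"
  proof (rule tendsto_sandwich[of "\<lambda>j. c * (1 - 1 / real (j + 2))" _ _ "\<lambda>_. c"])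
    have "(\<lambda>j. 1 / real (j + 2)) \<longlonglongrightarrow> 0" using LIMSEQ_ignore_initial_segment[OF lim_1_over_n, of 2] by simp
    then have "(\<lambda>j. c * (1 - 1 / real (j + 2))) \<longlonglongrightarrow> c * (1 - 0)" by (intro tendsto_intros)
    then show "(\<lambda>j. c * (1 - 1 / real (j + 2))) \<longlonglongrightarrow> c" by simp
  qed (use q in \<open>auto intro!: always_eventually less_imp_le\<close>)
  have "(\<lambda>j. theta (?s (q j)) L) \<longlonglongrightarrow> theta (?s c) L"
    unfolding theta_def
  proof (rule nn_integral_dominated_convergence[where w = "\<lambda>v. ennreal (gauss_weight (?s (c / 2)) v)"])
    show "AE v in count_space L. (\<lambda>j. ennreal (gauss_weight (?s (q j)) v)) \<longlonglongrightarrow> ennreal (gauss_weight (?s c) v)"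
      unfolding gauss_weight_width[OF c] gauss_weight_width[OF qpos]
      by (intro AE_I2 tendsto_intros qlim)
    show "AE v in count_space L. ennreal (gauss_weight (?s (q j)) v) \<le> ennreal (gauss_weight (?s (c / 2)) v)" for j
      using qhalf[of j] c by (intro AE_I2 ennreal_leI gauss_weight_width_antimono) auto
    show "(\<integral>\<^sup>+v. ennreal (gauss_weight (?s (c / 2)) v) \<partial>count_space L) < \<infinity>"
      using theta_finite[OF L gauss_width_pos[OF half_gt_zero[OF c]]] by (simp add: theta_def)
  qed auto
  then have B: "(\<lambda>j. ?B (q j)) \<longlonglongrightarrow> ?B c"
    using theta_finite[OF L gauss_width_pos[OF c, where 'n = 'n]] by (intro tendsto_enn2real) (simp_all add: less_top)
  have Bc: "?B c \<ge> 1" by (rule theta_real(2)[OF L gauss_width_pos[OF c]])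
  then have "(\<lambda>j. ?A c / ?B (q j)) \<longlonglongrightarrow> ?A c / ?B c" by (intro tendsto_divide tendsto_const B) simp
  then have "\<forall>\<^sub>F j in sequentially. ?A c / ?B (q j) > U" using U by (intro order_tendstoD) (auto simp: mass_ratio_def)
  then obtain j where j: "?A c / ?B (q j) > U" by (auto simp: eventually_sequentially)
  have "part_mass t (?s c) (\<gamma> * lambda1 L) L \<le> part_mass t (?s (q j)) (\<gamma> * lambda1 L) L"
    unfolding part_mass_def primitive_sum_def using q(3)[of j] qpos
    by (intro nn_integral_mono suminf_le summableI mult_right_mono ennreal_leI gauss_weight_width_antimono) auto
  then have "?A c \<le> ?A (q j)"
    using le_less_trans[OF part_mass_le_theta[OF L gauss_width_pos[OF qpos]] theta_finite[OF L gauss_width_pos[OF qpos]]]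
    by (intro enn2real_mono) simp_all
  then have "?A c / ?B (q j) \<le> mass_ratio t \<gamma> (q j) L" unfolding mass_ratio_def by (intro divide_right_mono) auto
  then show ?thesis using j q(1) qpos by (intro bexI[of _ "q j"]) auto
qed

text \<open>The ratios are bounded by 1, so the conditionally complete supremum behaves as
  expected.\<close>

lemma SUP_mass_ratio_iff:
  fixes L :: "(real ^ 'n::finite) set"
  assumes L: "L \<in> unimodular_lattices"
  shows "(SUP c\<in>{0<..}. mass_ratio t \<gamma> c L) > U \<longleftrightarrow> (\<exists>c>0. mass_ratio t \<gamma> c L > U)"
proof -
  have "bdd_above ((\<lambda>c. mass_ratio t \<gamma> c L) ` {0<..})"
    using mass_ratio_bounds(2)[OF L] by (intro bdd_aboveI2[where M = 1]) auto
  then show ?thesis by (subst less_cSUP_iff) auto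
qed

text \<open>A supremum over uncountably many c; by \<open>mass_ratio_rational\<close> it exceeds U
  iff some rational c does, and the event becomes a countable union.\<close>

lemma SUP_mass_ratio_sets:
  fixes \<mu> :: "(real ^ 'n::finite) set measure"
  assumes sets: "sets \<mu> = sets lattice_borel"
  shows "{L \<in> space \<mu>. (SUP c\<in>{0<..}. mass_ratio t \<gamma> c L) > U} \<in> sets \<mu>"
proof -
  have "{L \<in> space \<mu>. (SUP c\<in>{0<..}. mass_ratio t \<gamma> c L) > U} = (\<Union>q\<in>\<rat> \<inter> {0<..}. {L \<in> space \<mu>. mass_ratio t \<gamma> q L > U})"
  proof (intro equalityI subsetI)
    fix L assume *: "L \<in> {L \<in> space \<mu>. (SUP c\<in>{0<..}. mass_ratio t \<gamma> c L) > U}"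
    then have L: "L \<in> unimodular_lattices" by (simp add: space_eq[OF sets])
    obtain c where "c > 0" "mass_ratio t \<gamma> c L > U" using * unfolding mem_Collect_eq SUP_mass_ratio_iff[OF L] by blast
    then obtain q where "q \<in> \<rat>" "q > 0" "mass_ratio t \<gamma> q L > U" using mass_ratio_rational[OF L] by blast
    then show "L \<in> (\<Union>q\<in>\<rat> \<inter> {0<..}. {L \<in> space \<mu>. mass_ratio t \<gamma> q L > U})" using * by blast
  next
    fix L assume *: "L \<in> (\<Union>q\<in>\<rat> \<inter> {0<..}. {L \<in> space \<mu>. mass_ratio t \<gamma> q L > U})"
    then have L: "L \<in> unimodular_lattices" by (auto simp: space_eq[OF sets])
    show "L \<in> {L \<in> space \<mu>. (SUP c\<in>{0<..}. mass_ratio t \<gamma> c L) > U}"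
      using * unfolding mem_Collect_eq SUP_mass_ratio_iff[OF L] by auto
  qed
  also have "\<dots> \<in> sets \<mu>"
  proof (intro sets.countable_UN'')
    show "countable (\<rat> \<inter> {0<..} :: real set)" using countable_rat by (rule countable_Int1)
    fix q :: real assume "q \<in> \<rat> \<inter> {0<..}"
    then have "gauss_width CARD('n) q > 0" by (intro gauss_width_pos) simp
    from part_mass_lambda1_measurable[OF sets this, of t \<gamma>] theta_measurable[OF sets this]
    show "{L \<in> space \<mu>. mass_ratio t \<gamma> q L > U} \<in> sets \<mu>" unfolding mass_ratio_def by measurable
  qed
  finally show ?thesis .
qed

section \<open>The bound for the supremum over all widths\<close>

text \<open>The supremum of \<open>r\<^sup>n exp (- \<pi> r\<^sup>2 / s\<^sup>2) / s\<^sup>n\<close> over \<open>s\<close>.\<close>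

definition gauss_sup_const :: "nat \<Rightarrow> real" where
  "gauss_sup_const n = (real n / 2 / exp 1 / pi) powr (real n / 2)"

lemma gauss_sup_const_nonneg: "gauss_sup_const n \<ge> 0"
  by (simp add: gauss_sup_const_def)

text \<open>In z = pi r^2 / (k s^2) with k = n/2 the claim is ln z <= z - 1; the extremal width is z
  = 1.\<close>

lemma gauss_over_power_le:
  fixes r s :: real
  assumes r: "r > 0" and s: "s > 0" and n: "n > 0"
  shows "exp (- pi * r\<^sup>2 / s\<^sup>2) / s ^ n \<le> gauss_sup_const n / r ^ n"
proof -
  define k where "k = real n / 2"
  have k: "k > 0" using n by (simp add: k_def)
  define z where "z = pi * r\<^sup>2 / (k * s\<^sup>2)"
  have z: "z > 0" using r s k by (simp add: z_def)
  have "ln z = ln pi + 2 * ln r - ln k - 2 * ln s"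
    using r s k by (simp add: z_def ln_div ln_mult ln_realpow)
  then have "k * (ln pi + 2 * ln r - ln k - 2 * ln s) \<le> k * (z - 1)"
    using ln_le_minus_one[OF z] k by (intro mult_left_mono) auto
  moreover have "k * z = pi * r\<^sup>2 / s\<^sup>2" using k by (simp add: z_def)
  moreover have "real n = 2 * k" by (simp add: k_def)
  ultimately have "- pi * r\<^sup>2 / s\<^sup>2 - real n * ln s \<le> k * (ln k - 1 - ln pi) - real n * ln r"
    by (simp add: algebra_simps)
  then have "exp (- pi * r\<^sup>2 / s\<^sup>2 - real n * ln s) \<le> exp (k * (ln k - 1 - ln pi) - real n * ln r)"
    by (simp only: exp_le_cancel_iff)
  moreover have "exp (real n * ln x) = x ^ n" if "x > 0" for x :: real using that by (simp add: exp_of_nat_mult)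
  moreover have "exp (k * (ln k - 1 - ln pi)) = gauss_sup_const n"
    using k by (simp add: gauss_sup_const_def powr_def ln_div ln_mult flip: k_def)
  ultimately show ?thesis using r s by (simp add: exp_diff)
qed

text \<open>For s <= 1 the bound 1 on \<Theta> suffices, since the Gaussian weight grows with s. For
  s > 1 the gain in the exponent is pi r^2 (1 - 1/s^2), at most n ln s by the assumption on r, and
  the bound s^n compensates it.\<close>

lemma gauss_over_theta_le:
  fixes r s \<Theta> :: real
  assumes s: "s > 0" and r: "pi * r\<^sup>2 \<le> real n / 2" and \<Theta>: "\<Theta> \<ge> 1" "\<Theta> \<ge> s ^ n"
  shows "exp (- pi * r\<^sup>2 / s\<^sup>2) / \<Theta> \<le> exp (- pi * r\<^sup>2)"
proof (cases "s \<le> 1")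
  case True
  then have "s\<^sup>2 \<le> 1" using s by (simp add: power_le_one)
  then have "pi * r\<^sup>2 / 1 \<le> pi * r\<^sup>2 / s\<^sup>2" using s by (intro divide_left_mono) auto
  then have "exp (- pi * r\<^sup>2 / s\<^sup>2) \<le> exp (- pi * r\<^sup>2)" by simp
  moreover have "exp (- pi * r\<^sup>2 / s\<^sup>2) / \<Theta> \<le> exp (- pi * r\<^sup>2 / s\<^sup>2) / 1" using \<Theta> by (intro divide_left_mono) auto
  ultimately show ?thesis by linarith
next
  case False
  have "ln (1 / s\<^sup>2) \<le> 1 / s\<^sup>2 - 1" using s by (intro ln_le_minus_one) simp
  then have ln: "1 - 1 / s\<^sup>2 \<le> 2 * ln s" using s by (simp add: ln_div ln_realpow)
  have "1 / s\<^sup>2 \<le> 1" using False by simp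
  then have "pi * r\<^sup>2 * (1 - 1 / s\<^sup>2) \<le> real n / 2 * (1 - 1 / s\<^sup>2)" by (intro mult_right_mono r) simp
  also have "\<dots> \<le> real n / 2 * (2 * ln s)" by (intro mult_left_mono ln) simp
  finally have "- pi * r\<^sup>2 / s\<^sup>2 \<le> - pi * r\<^sup>2 + real n * ln s" by (simp add: algebra_simps)
  then have "exp (- pi * r\<^sup>2 / s\<^sup>2) \<le> exp (- pi * r\<^sup>2 + real n * ln s)" by (simp only: exp_le_cancel_iff)
  also have "\<dots> = exp (- pi * r\<^sup>2) * s ^ n" using s by (simp only: exp_add exp_of_nat_mult exp_ln)
  also have "\<dots> \<le> exp (- pi * r\<^sup>2) * \<Theta>" by (intro mult_left_mono \<Theta>) simp
  finally show ?thesis using \<Theta> by (simp add: divide_le_eq)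
qed

text \<open>The first summand bounds the share of w itself, the second that of its multiples m >= 2,
  whose weights m^-n add up to zeta(n) - 1.\<close>

definition annulus_bound :: "real \<Rightarrow> real \<Rightarrow> real ^ 'n::finite \<Rightarrow> ennreal" where
  "annulus_bound a b w = ennreal (exp (- pi * (norm w)\<^sup>2)) * indicator {w. a < norm w \<and> norm w \<le> b} w +
     ennreal (gauss_sup_const CARD('n) * (zeta (real CARD('n)) - 1) / norm w ^ CARD('n)) * indicator {w. a < norm w \<and> norm w \<le> b} w"

lemma annulus_bound_measurable: "annulus_bound a b \<in> borel_measurable borel"
  unfolding annulus_bound_def by measurable

lemma mass_ratio_le:
  fixes L :: "(real ^ 'n::finite) set"
  assumes L: "L \<in> unimodular_lattices" and c: "c > 0" and n: "CARD('n) \<ge> 3"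
    and t: "\<And>m. t m \<ge> 1" and a: "0 < a" "a < lambda1 L" and b: "\<gamma> * lambda1 L \<le> b" "pi * b\<^sup>2 \<le> real CARD('n) / 2"
  shows "ennreal (mass_ratio t \<gamma> c L) \<le> primitive_sum (annulus_bound a b) L"
proof -
  interpret discrete_subgroup L by (rule discrete_subgroup_unimodular[OF L])
  define s where "s = gauss_width CARD('n) c"
  have s: "s > 0" unfolding s_def by (rule gauss_width_pos[OF c])
  define \<Theta> where "\<Theta> = enn2real (theta s L)"
  have \<Theta>1: "\<Theta> \<ge> 1" unfolding \<Theta>_def by (rule theta_real(2)[OF L s])
  have \<Theta>n: "\<Theta> \<ge> s ^ CARD('n)"
    using theta_ge_power[OF L s] \<Theta>1 theta_real(1)[OF L s] by (simp add: \<Theta>_def[symmetric] ennreal_le_iff)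
  let ?g = "\<lambda>w. \<Sum>m. ennreal (gauss_weight s (real (Suc m) *\<^sub>R w)) * indicator {w. real (t m) * norm w \<le> \<gamma> * lambda1 L} w"
  have "ennreal (mass_ratio t \<gamma> c L) = ennreal (1 / \<Theta>) * part_mass t s (\<gamma> * lambda1 L) L"
    by (subst part_mass_real[OF L s]) (use \<Theta>1 in \<open>simp add: mass_ratio_def \<Theta>_def s_def ennreal_mult[symmetric]\<close>)
  also have "\<dots> = (\<integral>\<^sup>+w. ennreal (1 / \<Theta>) * ?g w \<partial>count_space (primitives L))"
    unfolding part_mass_def primitive_sum_def by (rule nn_integral_cmult[symmetric]) simp
  also have "\<dots> \<le> primitive_sum (annulus_bound a b) L"
    unfolding primitive_sum_def
  proof (rule nn_integral_mono)
    fix w assume "w \<in> space (count_space (primitives L))"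
    then have w: "w \<in> primitives L" by simp
    have w0: "norm w > 0" using w primitive_nonzero by (auto simp: primitives_def)
    have "lambda1 L \<le> norm w" using lambda1_less_iff(2)[OF L, of "norm w"] w by auto
    then have aw: "a < norm w" using a by simp
    show "ennreal (1 / \<Theta>) * ?g w \<le> annulus_bound a b w"
    proof (cases "norm w \<le> b")
      case False
      have "\<not> real (t m) * norm w \<le> \<gamma> * lambda1 L" for m
      proof -
        have "1 * norm w \<le> real (t m) * norm w" using t[of m] by (intro mult_right_mono) auto
        then show ?thesis using False b(1) by simp
      qed
      then show ?thesis by simp
    next
      case True
      define Z where "Z = (\<lambda>m. 1 / real (Suc (Suc m)) ^ CARD('n))"
      define C where "C = gauss_sup_const CARD('n) / norm w ^ CARD('n)"
      have C0: "C \<ge> 0" using gauss_sup_const_nonneg by (simp add: C_def)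
      \<comment> \<open>Entry 0 belongs to w and gets the sharp bound; entry m >= 1 belongs to the
        multiple m + 1 and carries the weight (m+1)^-n.\<close>
      define h where "h = (\<lambda>m. case m of 0 \<Rightarrow> exp (- pi * (norm w)\<^sup>2) | Suc m \<Rightarrow> C * Z m)"
      have h0: "h m \<ge> 0" for m using C0 by (simp add: h_def Z_def split: nat.split)
      have Z: "summable Z" "suminf Z = zeta (real CARD('n)) - 1"
        using zeta_terms(3)[OF n] summable_Suc_iff[THEN iffD2, OF zeta_terms(1)[OF n]] by (simp_all add: Z_def)
      have hS: "(\<lambda>m. h (Suc m)) = (\<lambda>m. C * Z m)" by (simp add: h_def)
      have h00: "h 0 = exp (- pi * (norm w)\<^sup>2)" by (simp add: h_def)
      have hsum: "summable h" by (subst summable_Suc_iff[symmetric], subst hS) (intro summable_mult Z)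
      have hval: "suminf h = exp (- pi * (norm w)\<^sup>2) + C * (zeta (real CARD('n)) - 1)"
        using suminf_split_head[OF hsum] suminf_mult[OF Z(1), of C] h00 unfolding hS Z(2) by linarith
      have gh: "gauss_weight s (real (Suc m) *\<^sub>R w) / \<Theta> \<le> h m" for m
      proof (cases m)
        case 0
        have "pi * (norm w)\<^sup>2 \<le> pi * b\<^sup>2" using True by (intro mult_left_mono power_mono) auto
        then have "exp (- pi * (norm w)\<^sup>2 / s\<^sup>2) / \<Theta> \<le> exp (- pi * (norm w)\<^sup>2)"
          using b(2) by (intro gauss_over_theta_le[OF s _ \<Theta>1 \<Theta>n]) linarith
        then show ?thesis by (simp add: 0 h_def gauss_weight_def)
      next
        case (Suc j)
        define r where "r = real (Suc m) * norm w"
        have r: "r > 0" using w0 by (simp add: r_def)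
        have "exp (- pi * r\<^sup>2 / s\<^sup>2) / \<Theta> \<le> exp (- pi * r\<^sup>2 / s\<^sup>2) / s ^ CARD('n)"
          using \<Theta>n \<Theta>1 s by (intro divide_left_mono) auto
        also have "\<dots> \<le> gauss_sup_const CARD('n) / r ^ CARD('n)" by (rule gauss_over_power_le[OF r s]) simp
        also have "\<dots> = h m" by (simp add: Suc h_def C_def Z_def r_def power_mult_distrib mult.commute)
        finally show ?thesis by (simp add: gauss_weight_def r_def)
      qed
      have "ennreal (1 / \<Theta>) * ?g w \<le> (\<Sum>m. ennreal (h m))"
        unfolding ennreal_suminf_cmult[symmetric]
      proof (intro suminf_le summableI)
        fix m
        have "ennreal (1 / \<Theta>) * (ennreal (gauss_weight s (real (Suc m) *\<^sub>R w)) * indicator {w. real (t m) * norm w \<le> \<gamma> * lambda1 L} w)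
          \<le> ennreal (1 / \<Theta>) * ennreal (gauss_weight s (real (Suc m) *\<^sub>R w))"
          by (intro mult_left_mono) (auto simp: indicator_def)
        also have "\<dots> = ennreal (gauss_weight s (real (Suc m) *\<^sub>R w) / \<Theta>)"
          using \<Theta>1 by (simp add: gauss_weight_nonneg del: of_nat_Suc flip: ennreal_mult)
        also have "\<dots> \<le> ennreal (h m)" by (intro ennreal_leI gh)
        finally show "ennreal (1 / \<Theta>) * (ennreal (gauss_weight s (real (Suc m) *\<^sub>R w)) * indicator {w. real (t m) * norm w \<le> \<gamma> * lambda1 L} w)
          \<le> ennreal (h m)" .
      qed
      also have "\<dots> = ennreal (suminf h)" by (rule suminf_ennreal2[OF h0 hsum])
      also have "\<dots> = annulus_bound a b w"
        unfolding hval using True aw zeta_terms(4)[OF n] C0 gauss_sup_const_nonneg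
        by (subst ennreal_plus) (auto simp: annulus_bound_def C_def)
      finally show ?thesis .
    qed
  qed
  finally show ?thesis .
qed

section \<open>The expected bound and the exceptional events\<close>

lemma nn_integral_annulus_bound:
  assumes ab: "0 < a" "a \<le> b" and n: "CARD('n::finite) \<ge> 3"
  shows "(\<integral>\<^sup>+w. annulus_bound a b (w :: real ^ 'n) \<partial>lborel) =
    ennreal (gamma_P (real CARD('n) / 2) (pi * b\<^sup>2) - gamma_P (real CARD('n) / 2) (pi * a\<^sup>2)) +
    ennreal (gauss_sup_const CARD('n) * (zeta (real CARD('n)) - 1) * (real CARD('n) * unit_ball_vol (real CARD('n)) * ln (b / a)))"
proof -
  have C: "gauss_sup_const CARD('n) * (zeta (real CARD('n)) - 1) \<ge> 0"
    using gauss_sup_const_nonneg zeta_terms(4)[OF n] by simp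
  show ?thesis
    unfolding annulus_bound_def nn_integral_gauss_annulus[OF ab n, symmetric] nn_integral_power_annulus[OF ab C, symmetric]
    by (rule nn_integral_add) measurable
qed

lemma gamma_P_mono:
  assumes "k > 1" "0 < x" "x \<le> y"
  shows "gamma_P k x \<le> gamma_P k y"
proof (rule DERIV_nonneg_imp_nondecreasing[OF assms(3)])
  fix u assume "x \<le> u" "u \<le> y"
  then show "\<exists>d. (gamma_P k has_real_derivative d) (at u) \<and> d \<ge> 0"
    using gamma_P_deriv[OF assms(1), of u] assms Gamma_real_pos[of k] by (intro exI conjI) auto
qed

text \<open>The factor pi^k of the ball volume cancels pi^-k in \<open>gauss_sup_const\<close>,
  leaving the constant of \<open>M2\<close> up to the factor n.\<close>

lemma gauss_sup_const_volume:
  assumes "n > 0"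
  shows "gauss_sup_const n * unit_ball_vol (real n) = (real n / 2 / exp 1) powr (real n / 2) / Gamma (real n / 2 + 1)"
  using powr_divide[of "real n / 2 / exp 1" pi "real n / 2"] by (simp add: gauss_sup_const_def unit_ball_vol_def)

text \<open>\<open>GH\<close> is the radius of a ball of volume 1.\<close>

lemma measure_cball_GH:
  assumes "r \<ge> 0"
  shows "measure lborel (cball (0 :: real ^ 'n::finite) (r * GH CARD('n))) = r ^ CARD('n)"
proof -
  let ?v = "unit_ball_vol (real CARD('n))"
  have v: "?v > 0" by (rule unit_ball_vol_pos) simp
  have "GH CARD('n) ^ CARD('n) = GH CARD('n) powr real CARD('n)" using GH_pos[of "CARD('n)"] by (simp add: powr_realpow)
  also have "\<dots> = 1 / ?v" using v by (simp only: GH_def powr_powr) (simp add: powr_minus_divide)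
  finally have "GH CARD('n) ^ CARD('n) = 1 / ?v" .
  then show ?thesis
    using less_imp_neq[OF v] GH_pos[of "CARD('n)"] assms by (simp add: content_cball power_mult_distrib)
qed

lemma prob_lambda1_le:
  fixes \<mu> :: "(real ^ 'n::finite) set measure"
  assumes mu: "invariant_lattice_measure \<mu>" and n: "CARD('n) \<ge> 3"
  shows "measure \<mu> {L \<in> space \<mu>. lambda1 L \<le> r} \<le> measure lborel (cball (0 :: real ^ 'n) r) / (2 * zeta (real CARD('n)))"
proof -
  interpret prob_space \<mu> using mu by (simp add: invariant_lattice_measure_def)
  have sp: "space \<mu> = unimodular_lattices" by (rule invariant_space[OF mu])
  have sets: "sets \<mu> = sets lattice_borel" using mu by (simp add: invariant_lattice_measure_def)
  have zpos: "zeta (real CARD('n)) > 0" using zeta_terms(4)[OF n] by simp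
  let ?A = "cball (0 :: real ^ 'n) r"
  let ?N = "\<lambda>L. ennreal (real (card (primitives L \<inter> ?A)))"
  have "bounded ?A" by simp
  note ind = primitive_sum_indicator[OF _ this]
  have N: "?N \<in> borel_measurable \<mu>" using card_primitives_measurable[OF sets, of ?A] by measurable
  have EN: "(\<integral>\<^sup>+L. ?N L \<partial>\<mu>) = ennreal (measure lborel ?A / zeta (real CARD('n)))"
  proof -
    have "(\<integral>\<^sup>+L. ?N L \<partial>\<mu>) = (\<integral>\<^sup>+L. primitive_sum (indicator ?A) L \<partial>\<mu>)"
      using ind(2) sp by (intro nn_integral_cong) simp
    moreover have "emeasure lborel ?A = ennreal (measure lborel ?A)"
      using emeasure_bounded_finite[of ?A] by (intro emeasure_eq_ennreal_measure) (simp add: less_top)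
    ultimately show ?thesis
      using nn_integral_primitive_sum[OF mu n borel_measurable_indicator[OF borel_closed[OF closed_cball]], of 0 r] zpos
      by (simp flip: ennreal_mult)
  qed
  have two: "?N L \<ge> 2" if L: "L \<in> space \<mu>" "lambda1 L \<le> r" for L
  proof -
    have Lu: "L \<in> unimodular_lattices" using L sp by simp
    interpret discrete_subgroup L by (rule discrete_subgroup_unimodular[OF Lu])
    obtain w where w: "w \<in> primitives L \<inter> ?A" using lambda1_less_iff(2)[OF Lu] L by blast
    then have "w \<noteq> 0" "- w \<in> primitives L \<inter> ?A" using primitive_nonzero primitive_uminus by (auto simp: primitives_def)
    then have "card {w, - w} \<le> card (primitives L \<inter> ?A)" using w by (intro card_mono ind(1)[OF Lu]) auto
    moreover have "card {w, - w} = 2" using \<open>w \<noteq> 0\<close> by (simp add: eq_neg_iff_add_eq_0 flip: scaleR_2)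
    ultimately have "ennreal 2 \<le> ?N L" by (intro ennreal_leI) simp
    then show ?thesis by simp
  qed
  have "emeasure \<mu> {L \<in> space \<mu>. lambda1 L \<le> r} * 2 \<le> (\<integral>\<^sup>+L. ?N L \<partial>\<mu>)"
  proof -
    have m: "{L \<in> space \<mu>. lambda1 L \<le> r} \<in> sets \<mu>" using lambda1_measurable[OF sets] by measurable
    have "emeasure \<mu> {L \<in> space \<mu>. lambda1 L \<le> r} * 2 = (\<integral>\<^sup>+L. 2 * indicator {L \<in> space \<mu>. lambda1 L \<le> r} L \<partial>\<mu>)"
      by (simp add: nn_integral_cmult_indicator[OF m] mult.commute)
    also have "\<dots> \<le> (\<integral>\<^sup>+L. ?N L \<partial>\<mu>)" using two by (intro nn_integral_mono) (auto simp: indicator_def)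
    finally show ?thesis .
  qed
  then have "ennreal (measure \<mu> {L \<in> space \<mu>. lambda1 L \<le> r} * 2) \<le> ennreal (measure lborel ?A / zeta (real CARD('n)))"
    unfolding EN by (simp add: emeasure_eq_measure ennreal_mult)
  then have "measure \<mu> {L \<in> space \<mu>. lambda1 L \<le> r} * 2 \<le> measure lborel ?A / zeta (real CARD('n))"
    using zpos by (subst (asm) ennreal_le_iff) auto
  then show ?thesis using zpos by (simp add: field_simps)
qed

text \<open>Outside the two exceptional events \<kappa> GH < \<open>lambda1\<close> <= R GH, so
  \<gamma> \<open>lambda1\<close> is at most \<rho> GH, and \<open>X\<close> bounds all mass ratios
  simultaneously. One application of Markov's inequality therefore handles the supremum.\<close>

lemma prob_mass_ratio_le:
  fixes \<mu> :: "(real ^ 'n::finite) set measure" and n :: nat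
    and \<gamma> k \<alpha> \<eta> \<kappa> R \<rho> M1 M2 U E_plus :: real
  assumes mu: "invariant_lattice_measure \<mu>"
    and n_def: "n = CARD('n)" and n_ge: "n \<ge> 3"
    and gamma_ge: "\<gamma> \<ge> 1"
    and k_def: "k = real n / 2"
    and alpha_def: "\<alpha> = sqrt (real n / (2 * pi)) / GH n"
    and eta: "0 < \<eta>"
    and kappa: "0 < \<kappa>" "\<kappa> < 1" and R: "1 < R"
    and rho_def: "\<rho> = \<gamma> * R" and rho_alpha: "\<rho> \<le> \<alpha>"
    and M1_def: "M1 = (gamma_P k (pi * \<rho>\<^sup>2 * (GH n)\<^sup>2) - gamma_P k (pi * \<kappa>\<^sup>2 * (GH n)\<^sup>2))
                        / zeta (real n)"
    and M2_def: "M2 = real n * (k / exp 1) powr k / Gamma (k + 1)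
                        * ((zeta (real n) - 1) / zeta (real n)) * ln (\<rho> / \<kappa>)"
    and U_def: "U = min 1 ((M1 + M2) / \<eta>)"
    and E_def: "E_plus = \<eta> + \<kappa> ^ n / (2 * zeta (real n)) + 2 * zeta (real n) / R ^ n"
    and t: "\<And>m. t m \<ge> 1"
  shows "measure \<mu> {L \<in> space \<mu>. (SUP c\<in>{0<..}. mass_ratio t \<gamma> c L) > U} \<le> E_plus"
proof -
  interpret prob_space \<mu> using mu by (simp add: invariant_lattice_measure_def)
  have sp: "space \<mu> = unimodular_lattices" by (rule invariant_space[OF mu])
  have sets: "sets \<mu> = sets lattice_borel" using mu by (simp add: invariant_lattice_measure_def)
  note [measurable] = lambda1_measurable[OF sets]
  have n3: "CARD('n) \<ge> 3" using n_ge n_def by simp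
  have zeta1: "zeta (real n) > 1" using zeta_terms(4)[OF n_ge] .
  have GH: "GH n > 0" using GH_pos n_ge by simp
  have k: "k > 1" using n_ge by (simp add: k_def)
  have rho: "R \<le> \<rho>" using mult_right_mono[OF gamma_ge, of R] R by (simp add: rho_def)
  define a b where "a = \<kappa> * GH n" and "b = \<rho> * GH n"
  have ab: "0 < a" "a < b" using kappa GH R rho by (simp_all add: a_def b_def)
  \<comment> \<open>The hypothesis \<rho> <= \<alpha> says exactly that pi b^2 <= n/2, the range of
    the sharp bound.\<close>
  have "b \<le> sqrt (real n / (2 * pi))" using rho_alpha GH by (simp add: b_def alpha_def pos_le_divide_eq)
  then have "b\<^sup>2 \<le> (sqrt (real n / (2 * pi)))\<^sup>2" using ab by (intro power_mono) auto
  then have pib: "pi * b\<^sup>2 \<le> real CARD('n) / 2" by (simp add: field_simps n_def)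
  define X where "X = primitive_sum (annulus_bound a b :: real ^ 'n \<Rightarrow> ennreal)"
  have X [measurable]: "X \<in> borel_measurable \<mu>"
    unfolding X_def measurable_cong_sets[OF sets refl] by (rule primitive_sum_measurable[OF annulus_bound_measurable])
  have M1: "M1 = 1 / zeta (real n) * (gamma_P (real CARD('n) / 2) (pi * b\<^sup>2) - gamma_P (real CARD('n) / 2) (pi * a\<^sup>2))"
    unfolding M1_def a_def b_def k_def n_def by (simp add: power_mult_distrib mult.assoc)
  have M1_nonneg: "M1 \<ge> 0"
  proof -
    have "pi * a\<^sup>2 \<le> pi * b\<^sup>2" using ab by (intro mult_left_mono power_mono) auto
    then have "gamma_P k (pi * a\<^sup>2) \<le> gamma_P k (pi * b\<^sup>2)" using k ab by (intro gamma_P_mono) auto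
    then show ?thesis unfolding M1 using zeta1 by (simp add: k_def n_def)
  qed
  have M2: "M2 = 1 / zeta (real n) * (gauss_sup_const CARD('n) * (zeta (real CARD('n)) - 1) * (real CARD('n) * unit_ball_vol (real CARD('n)) * ln (b / a)))"
  proof -
    have "b / a = \<rho> / \<kappa>" using GH by (simp add: a_def b_def)
    moreover have "(k / exp 1) powr k / Gamma (k + 1) = gauss_sup_const n * unit_ball_vol (real n)"
      unfolding k_def using n_ge by (intro gauss_sup_const_volume[symmetric]) simp
    ultimately show ?thesis unfolding M2_def n_def[symmetric] times_divide_eq_right[symmetric] by simp
  qed
  \<comment> \<open>Strict, because \<rho> >= R > 1 > \<kappa> makes the logarithm positive; hence V
    > 0 and division by V is safe.\<close>
  have M2_pos: "M2 > 0"
  proof -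
    have "ln (\<rho> / \<kappa>) > 0" using kappa R rho by (intro ln_gt_zero) simp
    then show ?thesis unfolding M2_def using zeta1 n_ge k by (intro mult_pos_pos divide_pos_pos Gamma_real_pos) auto
  qed
  define V where "V = M1 + M2"
  have V: "V > 0" using M1_nonneg M2_pos by (simp add: V_def)
  have EX: "(\<integral>\<^sup>+L. X L \<partial>\<mu>) = ennreal V"
    using ab zeta1 M1_nonneg M2_pos
    unfolding X_def nn_integral_primitive_sum[OF mu n3 annulus_bound_measurable] nn_integral_annulus_bound[OF ab(1) less_imp_le[OF ab(2)] n3]
      distrib_left V_def M1 M2 by (subst ennreal_plus) (simp_all add: ennreal_mult'[symmetric] n_def)
  let ?A = "{L \<in> space \<mu>. lambda1 L \<le> a}" and ?B = "{L \<in> space \<mu>. \<not> lambda1 L \<le> R * GH n}"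
  \<comment> \<open>The event that X reaches V / \<eta>, in the multiplicative form of Markov's
    inequality.\<close>
  let ?C = "{L \<in> space \<mu>. 1 \<le> ennreal (\<eta> / V) * X L}"
  have cover: "{L \<in> space \<mu>. (SUP c\<in>{0<..}. mass_ratio t \<gamma> c L) > U} \<subseteq> ?A \<union> ?B \<union> ?C"
  proof (rule subsetI, rule ccontr)
    fix L assume *: "L \<in> {L \<in> space \<mu>. (SUP c\<in>{0<..}. mass_ratio t \<gamma> c L) > U}" "L \<notin> ?A \<union> ?B \<union> ?C"
    then have L: "L \<in> unimodular_lattices" using sp by simp
    obtain c where c: "c > 0" "mass_ratio t \<gamma> c L > U" using * SUP_mass_ratio_iff[OF L] by blast
    \<comment> \<open>A mass ratio is at most 1, so it can exceed U only if the minimum in U is V /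
      \<eta>.\<close>
    have "V / \<eta> < mass_ratio t \<gamma> c L" using c mass_ratio_bounds(2)[OF L c(1), of t \<gamma>] by (auto simp: U_def V_def min_def split: if_splits)
    then have "1 \<le> \<eta> / V * mass_ratio t \<gamma> c L" using V eta by (simp add: field_simps)
    then have "1 \<le> ennreal (\<eta> / V * mass_ratio t \<gamma> c L)" by simp
    also have "\<dots> = ennreal (\<eta> / V) * ennreal (mass_ratio t \<gamma> c L)" using V eta mass_ratio_bounds(1)[OF L c(1)] by (simp only: ennreal_mult divide_nonneg_nonneg less_imp_le)
    also have "\<dots> \<le> ennreal (\<eta> / V) * X L"
      unfolding X_def
    proof (intro mult_left_mono mass_ratio_le[OF L c(1) n3 t ab(1) _ _ pib])
      show "a < lambda1 L" using * by auto
      have "\<gamma> * lambda1 L \<le> \<gamma> * (R * GH n)" using * gamma_ge by (intro mult_left_mono) auto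
      then show "\<gamma> * lambda1 L \<le> b" by (simp add: b_def rho_def)
    qed simp
    finally show False using * by simp
  qed
  have "prob {L \<in> space \<mu>. (SUP c\<in>{0<..}. mass_ratio t \<gamma> c L) > U} \<le> prob (?A \<union> ?B \<union> ?C)"
    by (intro finite_measure_mono cover) measurable
  also have "\<dots> \<le> prob ?A + prob ?B + prob ?C"
    by (intro order_trans[OF measure_Un_le] add_mono order_refl measure_Un_le) measurable
  also have "\<dots> \<le> \<kappa> ^ n / (2 * zeta (real n)) + 2 * zeta (real n) / R ^ n + \<eta>"
  proof (intro add_mono)
    show "prob ?A \<le> \<kappa> ^ n / (2 * zeta (real n))"
      using prob_lambda1_le[OF mu n3, of a] measure_cball_GH[of \<kappa>, where 'n = 'n] kappa by (simp add: a_def n_def)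
    have "?B = {L \<in> space \<mu>. primitives L \<inter> cball 0 (R * GH n) = {}}"
      unfolding sp by (intro Collect_cong conj_cong refl) (simp only: lambda1_less_iff(2) not_not)
    moreover have "measure lborel (cball (0 :: real ^ 'n) (R * GH n)) = R ^ n"
      using measure_cball_GH[of R, where 'n = 'n] R by (simp add: n_def)
    ultimately show "prob ?B \<le> 2 * zeta (real n) / R ^ n"
      using prob_no_primitive[OF mu n3, of "cball 0 (R * GH n)"] R by (simp add: n_def)
    have "emeasure \<mu> ?C \<le> ennreal (\<eta> / V) * (\<integral>\<^sup>+L. X L * indicator (space \<mu>) L \<partial>\<mu>)"
      using nn_integral_Markov_inequality[of X "space \<mu>" \<mu> "ennreal (\<eta> / V)"] X by simp
    also have "(\<integral>\<^sup>+L. X L * indicator (space \<mu>) L \<partial>\<mu>) = ennreal V"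
      unfolding EX[symmetric] by (rule nn_integral_cong) simp
    also have "ennreal (\<eta> / V) * ennreal V = ennreal \<eta>" using V eta by (simp flip: ennreal_mult)
    finally show "prob ?C \<le> \<eta>" using eta by (simp add: emeasure_eq_measure)
  qed
  finally show ?thesis by (simp add: E_def)
qed

text \<open>\<open>measure\<close> is 0 outside the sigma-algebra, so the bounds come together with
  measurability of the events. The selector \<open>\<lambda>_. 1\<close> tests the primitive part,
  \<open>Suc\<close> the vector itself.\<close>

theorem theorem4p7:
  fixes \<mu> :: "(real ^ 'n::finite) set measure"
    and n :: nat
    and \<gamma> k \<alpha> \<eta> \<kappa> R \<rho> M1 M2 U E_plus :: real
  assumes mu: "invariant_lattice_measure \<mu>"
    and n_def: "n = CARD('n)" and n_ge: "n \<ge> 3"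
    and gamma_ge: "\<gamma> \<ge> 1"
    and k_def: "k = real n / 2"
    and alpha_def: "\<alpha> = sqrt (real n / (2 * pi)) / GH n"
    and eta: "0 < \<eta>" "\<eta> < 1"
    and kappa: "0 < \<kappa>" "\<kappa> < 1" and R: "1 < R"
    and rho_def: "\<rho> = \<gamma> * R"
    and alpha_kappa: "\<alpha> / 2 \<le> \<kappa>" and rho_alpha: "\<rho> \<le> \<alpha>"
    and M1_def: "M1 = (gamma_P k (pi * \<rho>\<^sup>2 * (GH n)\<^sup>2) - gamma_P k (pi * \<kappa>\<^sup>2 * (GH n)\<^sup>2))
                        / zeta (real n)"
    and M2_def: "M2 = real n * (k / exp 1) powr k / Gamma (k + 1)
                        * ((zeta (real n) - 1) / zeta (real n)) * ln (\<rho> / \<kappa>)"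
    and U_def: "U = min 1 ((M1 + M2) / \<eta>)"
    and E_def: "E_plus = \<eta> + \<kappa> ^ n / (2 * zeta (real n)) + 2 * zeta (real n) / R ^ n"
  shows "{L \<in> space \<mu>. (SUP c\<in>{0<..}. u_hat_prob \<gamma> c L) > U} \<in> sets \<mu> \<and>
         measure \<mu> {L \<in> space \<mu>. (SUP c\<in>{0<..}. u_hat_prob \<gamma> c L) > U} \<le> E_plus \<and>
         {L \<in> space \<mu>. (SUP c\<in>{0<..}. u_prob \<gamma> c L) > U} \<in> sets \<mu> \<and>
         measure \<mu> {L \<in> space \<mu>. (SUP c\<in>{0<..}. u_prob \<gamma> c L) > U} \<le> E_plus"
proof -
  have sets: "sets \<mu> = sets lattice_borel" using mu by (simp add: invariant_lattice_measure_def)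
  have hat: "{L \<in> space \<mu>. (SUP c\<in>{0<..}. u_hat_prob \<gamma> c L) > U} = {L \<in> space \<mu>. (SUP c\<in>{0<..}. mass_ratio (\<lambda>_. 1) \<gamma> c L) > U}"
    and plain: "{L \<in> space \<mu>. (SUP c\<in>{0<..}. u_prob \<gamma> c L) > U} = {L \<in> space \<mu>. (SUP c\<in>{0<..}. mass_ratio Suc \<gamma> c L) > U}"
    by (intro Collect_cong conj_cong refl arg_cong2[where f = "(<)"] SUP_cong; simp add: u_prob_eq space_eq[OF sets])+
  note bound = prob_mass_ratio_le[OF mu n_def n_ge gamma_ge k_def alpha_def eta(1) kappa R rho_def rho_alpha M1_def M2_def U_def E_def]
  show ?thesis
    unfolding hat plain by (intro conjI bound SUP_mass_ratio_sets[OF sets]) simp_all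
qed

end
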